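(* Let $P$, $S$ and $T$ be the monads on $[\mathcal H^{\mathrm{op}},\mathbf{Set}]$ induced by the free-forgetful adjunctions for $\{w,p\}$-GATs, $\{s\}$-GATs and GATs ($=\{w,p,s\}$-GATs) respectively, and let $\rho\colon P\Rightarrow T$ and $\sigma\colon S\Rightarrow T$ be the canonical natural transformations. For any $X\in[\mathcal H^{\mathrm{op}},\mathbf{Set}]$ the composite map $$\kappa_X:=\Big(PSX\xrightarrow{\ P\sigma_X\ }PTX\xrightarrow{\ \rho_{TX}\ }TTX\xrightarrow{\ \mu^T_X\ }TX\Big)$$ is invertible.
   Context: \textbf{Expressions and judgements.} Fix a denumerable set $\mathrm{Var}$ of variables. Given an alphabet $\Xi$, the expressions over $\Xi$ are generated as follows: each $x\in\mathrm{Var}$ is an expression; if $n\geq 0$, $e_1,\dots,e_n$ are expressions and $w\in\Xi$, then $w(e_1,\dots,e_n)$ is an expression (written $w$ when $n=0$). $\mathsf{fv}$ denotes free variables and $e'[e/x]$ substitution of $e$ for $x$ in $e'$. A context is a (possibly empty) list $x_1:T_1,\dots,x_n:T_n$ of distinct variables $x_i$ and expressions $T_i$; $\mathsf{fv}(\Gamma)$ is the set of variables occurring in $\Gamma$. A judgement is a string $\Gamma\vdash T\ \mathsf{type}$ (type judgement), $\Gamma\vdash t:T$ (term judgement), $\Gamma\vdash T=T'\ \mathsf{type}$ (type equality) or $\Gamma\vdash t=t':T$ (term equality), with $\Gamma$ a context and $t,t',T,T'$ expressions; its degree is one more than the length of $\Gamma$. The boundary of a judgement is a list of judgements: $\partial(\vdash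 T\ \mathsf{type})=()$; $\partial(\Gamma,x:T\vdash T'\ \mathsf{type})=(\Gamma\vdash T\ \mathsf{type})$; $\partial(\Gamma\vdash t:T)=(\Gamma\vdash T\ \mathsf{type})$; $\partial(\Gamma\vdash T=T'\ \mathsf{type})=(\Gamma\vdash T\ \mathsf{type},\ \Gamma\vdash T'\ \mathsf{type})$; $\partial(\Gamma\vdash t=t':T)=(\Gamma\vdash t:T,\ \Gamma\vdash t':T)$. \textbf{Deduction rules} (premises $\Longrightarrow$ conclusion; $\mathcal J$ stands for the right-hand side of any of the four judgement forms). \emph{Equality and $\alpha$ rules}: $\Gamma\vdash t:T\Longrightarrow\Gamma\vdash t=t:T$; $\Gamma\vdash t_1=t_2:T\Longrightarrow\Gamma\vdash t_2=t_1:T$; $\Gamma\vdash t_1=t_2:T$ and $\Gamma\vdash t_2=t_3:T\Longrightarrow\Gamma\vdash t_1=t_3:T$; $\Gamma\vdash T\ \mathsf{type}\Longrightarrow\Gamma\vdash T=T\ \mathsf{type}$; $\Gamma\vdash T_1=T_2\ \mathsf{type}\Longrightarrow\Gamma\vdash T_2=T_1\ \mathsf{type}$; $\Gamma\vdash T_1=T_2\ \mathsf{type}$ and $\Gamma\vdash T_2=T_3\ \mathsf{type}\Longrightarrow\Gamma\vdash T_1=T_3\ \mathsf{type}$; $\Gamma\vdash T_1=T_2\ \mathsf{type}$ and $\Gamma\vdash t:T_1\Longrightarrow\Gamma\vdash t:T_2$; $\Gamma\vdash T_1=T_2\ \mathsf{type}$ and $\Gamma\vdash t_1=t_2:T_1\Longrightarrow\Gamma\vdash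 t_1=t_2:T_2$; $\Gamma\vdash\mathcal J\Longrightarrow\sigma\cdot\Gamma\vdash\sigma\cdot\mathcal J$ for any permutation $\sigma\in\mathrm{Sym}(\mathrm{Var})$ acting on variables. \emph{Weakening} ($w$): $\Gamma\vdash T\ \mathsf{type}$ and $\Gamma,\Delta\vdash\mathcal J\Longrightarrow\Gamma,y:T,\Delta\vdash\mathcal J$, for $y\notin\mathsf{fv}(\Gamma)\cup\mathsf{fv}(\Delta)$. \emph{Projection} ($p$): $\Gamma\vdash T\ \mathsf{type}\Longrightarrow\Gamma,y:T\vdash y:T$, for $y\notin\mathsf{fv}(\Gamma)$. \emph{Substitution} ($s$): $\Gamma\vdash t:T$ and $\Gamma,y:T,\Delta\vdash\mathcal J\Longrightarrow\Gamma,\Delta[t/y]\vdash\mathcal J[t/y]$; $\Gamma\vdash t_1=t_2:T$ and $\Gamma,y:T,\Delta\vdash T'\ \mathsf{type}\Longrightarrow\Gamma,\Delta[t_2/y]\vdash T'[t_1/y]=T'[t_2/y]\ \mathsf{type}$; $\Gamma\vdash t_1=t_2:T$ and $\Gamma,y:T,\Delta\vdash t':T'\Longrightarrow\Gamma,\Delta[t_2/y]\vdash t'[t_1/y]=t'[t_2/y]:T'[t_2/y]$. \textbf{$D$-GATs.} Let $D\subset\{w,p,s\}$ be such that $p\in D$ implies $w\in D$. A $D$-GAT $\mathbb T$ consists of a collection $\Omega$ of type-constants, a collection $\Sigma$ of term-constants and a collection $\Lambda$ of basic judgements over $\Omega\amalg\Sigma$ such that: for each $A\in\Omega$ there is a unique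 judgement in $\Lambda$ of the form $x_1:T_1,\dots,x_{n-1}:T_{n-1}\vdash A(x_1,\dots,x_{n-1})\ \mathsf{type}$; for each $f\in\Sigma$ there is a unique judgement in $\Lambda$ of the form $x_1:T_1,\dots,x_{n-1}:T_{n-1}\vdash f(x_1,\dots,x_{n-1}):T$; all other elements of $\Lambda$ are type or term equality judgements; each element of $\Lambda$ lies in $\mathbb T^*$. Here $\mathbb T^*$, the collection of derived judgements, is the smallest collection closed under the equality and $\alpha$ rules and the rules in $D$, and containing $\mathcal J\in\Lambda$ whenever it contains each judgement in $\partial(\mathcal J)$. An interpretation $\phi\colon\mathbb T\to\mathbb U$ of $D$-GATs is a function $\phi\colon\mathbb T^*\to\mathbb U^*$ preserving boundaries and preserving deduction: viewing each available rule with $n$ premises (for each choice of parameters such as $y$ or $\sigma$) as an $n$-ary partial function $r$ on judgements, $\phi(r(\mathcal J_1,\dots,\mathcal J_n))=r(\phi(\mathcal J_1),\dots,\phi(\mathcal J_n))$ whenever both sides are defined. On derived type judgements, $(x_1:S_1,\dots,x_{n-1}:S_{n-1}\vdash S_n\ \mathsf{type})\equiv(y_1:T_1,\dots,y_{m-1}:T_{m-1}\vdash T_m\ \mathsf{type})$ iff $n=m$ and for $1\le i\le n$ the judgement $x_1:S_1,\dots,x_{i-1}:S_{i-1}\vdash S_i=T_i[x_1/y_1,\dots,x_{i-1}/y_{i-1}]\ \mathsf{type}$ is derived. On derived term judgements, $(x_1:S_1,\dots,x_{n-1}:S_{n-1}\vdash s:S_n)\equiv(y_1:T_1,\dots,y_{m-1}:T_{m-1}\vdash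 t:T_m)$ iff their boundaries are $\equiv$ and $x_1:S_1,\dots,x_{n-1}:S_{n-1}\vdash s=t[x_1/y_1,\dots,x_{n-1}/y_{n-1}]:S_n$ is derived. $D\text{-}\mathbf{GAT}$ has $D$-GATs as objects and, as morphisms, interpretations modulo: $\phi\sim\phi'$ iff $\phi(\mathcal J)\equiv\phi'(\mathcal J)$ for each derived type or term judgement $\mathcal J$. \textbf{Type-and-term structures and the monads.} $\mathcal H$ is the category freely generated by the graph with objects $n$ and $n_t$ ($n\ge1$) and arrows $n\to n+1$ and $n\to n_t$. For $X\in[\mathcal H^{\mathrm{op}},\mathbf{Set}]$ the maps $X(n+1)\to X(n)$, $X(n_t)\to X(n)$ are written $\partial$; elements of $X(n)$ are type-elements, elements of $X(n_t)$ term-elements; for $A\in X(n)$, $\mathrm{Tm}_X(A)=\{a\in X(n_t):\partial a=A\}$. The forgetful functor $V_D\colon D\text{-}\mathbf{GAT}\to[\mathcal H^{\mathrm{op}},\mathbf{Set}]$ has $V_D\mathbb T(n)$ (resp. $V_D\mathbb T(n_t)$) the set of derived type (resp. term) judgements of degree $n$ modulo $\equiv$, boundaries induced by $\partial$, and $V_D\phi([\mathcal J])=[\phi(\mathcal J)]$. Its left adjoint $G_D$ sends $X$ to the free $D$-GAT $G_DX$ whose type- and term-constants are the type- and term-elements of $X$ and whose basic judgements are $\mathcal J_A=(x_1:A_1,x_2:A_2(x_1),\dots,x_{n-1}:A_{n-1}(x_1,\dots,x_{n-2})\vdash A(x_1,\dots,x_{n-1})\ \mathsf{type})$ for $A\in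 X(n)$, where $A_i=\partial^{n-i}A$, and, in the same context, $\mathcal J_a=(\dots\vdash a(x_1,\dots,x_{n-1}):A(x_1,\dots,x_{n-1}))$ for $a\in\mathrm{Tm}_X(A)$. The adjunction unit is $A\mapsto[\mathcal J_A]$, $a\mapsto[\mathcal J_a]$; the counit $\epsilon_{\mathbb T}\colon G_DV_D\mathbb T\to\mathbb T$ is given on basic judgements by $\mathcal J_{[\mathcal J]}\mapsto\mathcal J$. The induced monad is $V_DG_D$ with multiplication $V_D\epsilon G_D$; $P$, $S$, $T$ are the cases $D=\{w,p\}$, $\{s\}$, $\{w,p,s\}$. \textbf{The transformations $\rho$ and $\sigma$.} Every judgement derivable in the free $\{w,p\}$-GAT (resp. $\{s\}$-GAT) on $X$ is derivable in the free GAT on $X$; $\rho_X\colon PX\to TX$ (resp. $\sigma_X\colon SX\to TX$) sends the class of such a judgement to the class of the same judgement in the free GAT on $X$. *)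

theory Defs
  imports Main
begin

section \<open>Expressions and judgements\<close>

text \<open>The denumerable set of variables is \<open>nat\<close>; the variable \<open>x\<^sub>i\<close> is \<open>i\<close>.\<close>

type_synonym var = nat

datatype (syms: 'c) expr = Var var | App 'c "'c expr list"

primrec fv :: "'c expr \<Rightarrow> var set" where
  "fv (Var x) = {x}"
| "fv (App c es) = \<Union> (set (map fv es))"

primrec subst :: "(var \<Rightarrow> 'c expr) \<Rightarrow> 'c expr \<Rightarrow> 'c expr" where
  "subst \<theta> (Var x) = \<theta> x"
| "subst \<theta> (App c es) = App c (map (subst \<theta>) es)"

definition single :: "'c expr \<Rightarrow> var \<Rightarrow> var \<Rightarrow> 'c expr" where
  "single t y = Var(y := t)"

text \<open>\<open>subst (rename xs ys) e\<close> is \<open>e[x\<^sub>1/y\<^sub>1, x\<^sub>2/y\<^sub>2, \<dots>]\<close>, for distinct \<open>ys\<close>.\<close>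

definition rename :: "var list \<Rightarrow> var list \<Rightarrow> var \<Rightarrow> 'c expr" where
  "rename xs ys z = (case map_of (zip ys xs) z of None \<Rightarrow> Var z | Some x \<Rightarrow> Var x)"

type_synonym 'c ctx = "(var \<times> 'c expr) list"

definition fv_ctx :: "'c ctx \<Rightarrow> var set" where
  "fv_ctx \<Gamma> = (\<Union>(x, T)\<in>set \<Gamma>. insert x (fv T))"

definition subst_ctx :: "(var \<Rightarrow> 'c expr) \<Rightarrow> 'c ctx \<Rightarrow> 'c ctx" where
  "subst_ctx \<theta> = map (\<lambda>(x, T). (x, subst \<theta> T))"

text \<open>Right-hand sides: \<open>T type\<close>, \<open>t : T\<close>, \<open>T = T' type\<close> and \<open>t = t' : T\<close>, with arguments
  in this order.\<close>

datatype (exprs: 'e) rhs = IsTy 'e | HasTy 'e 'e | TyEq 'e 'e | TmEq 'e 'e 'e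

type_synonym 'c judgement = "'c ctx \<times> 'c expr rhs"

definition judgement_over :: "'c set \<Rightarrow> 'c judgement \<Rightarrow> bool" where
  "judgement_over \<Xi> J \<longleftrightarrow> distinct (map fst (fst J)) \<and>
     (\<forall>e \<in> snd ` set (fst J) \<union> exprs (snd J). syms e \<subseteq> \<Xi>)"

definition degree :: "'c judgement \<Rightarrow> nat" where
  "degree J = Suc (length (fst J))"

fun is_type :: "'c judgement \<Rightarrow> bool" where
  "is_type (\<Gamma>, IsTy T) = True"
| "is_type _ = False"

fun is_term :: "'c judgement \<Rightarrow> bool" where
  "is_term (\<Gamma>, HasTy t T) = True"
| "is_term _ = False"

fun same_form :: "'c judgement \<Rightarrow> 'd judgement \<Rightarrow> bool" where
  "same_form (\<Gamma>, IsTy T) (\<Gamma>', IsTy T') = True"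
| "same_form (\<Gamma>, HasTy t T) (\<Gamma>', HasTy t' T') = True"
| "same_form (\<Gamma>, TyEq S T) (\<Gamma>', TyEq S' T') = True"
| "same_form (\<Gamma>, TmEq s t T) (\<Gamma>', TmEq s' t' T') = True"
| "same_form _ _ = False"

fun boundary :: "'c judgement \<Rightarrow> 'c judgement list" where
  "boundary (\<Gamma>, IsTy T) = (if \<Gamma> = [] then [] else [(butlast \<Gamma>, IsTy (snd (last \<Gamma>)))])"
| "boundary (\<Gamma>, HasTy t T) = [(\<Gamma>, IsTy T)]"
| "boundary (\<Gamma>, TyEq T T') = [(\<Gamma>, IsTy T), (\<Gamma>, IsTy T')]"
| "boundary (\<Gamma>, TmEq t t' T) = [(\<Gamma>, HasTy t T), (\<Gamma>, HasTy t' T)]"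

definition permute :: "(var \<Rightarrow> var) \<Rightarrow> 'c judgement \<Rightarrow> 'c judgement" where
  "permute \<sigma> J = (map (\<lambda>(x, T). (\<sigma> x, subst (Var \<circ> \<sigma>) T)) (fst J),
                  map_rhs (subst (Var \<circ> \<sigma>)) (snd J))"


section \<open>Deduction rules\<close>

datatype structural = W | P | S

text \<open>A \<open>rule\<close> is a deduction rule together with its parameters. By \<open>rule_app r Js J\<close> the
  rule \<open>r\<close>, seen as a partial function on judgements, is defined at \<open>Js\<close> with value \<open>J\<close>.\<close>

datatype rule =
    TmRefl | TmSym | TmTrans | TyRefl | TySym | TyTrans | TmConv | TmEqConv
  | Perm "var \<Rightarrow> var"
  | Weaken var | Project var
  | Subst var | SubstTy var | SubstTm var

inductive rule_app :: "rule \<Rightarrow> 'c judgement list \<Rightarrow> 'c judgement \<Rightarrow> bool" where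
  "rule_app TmRefl [(\<Gamma>, HasTy t T)] (\<Gamma>, TmEq t t T)"
| "rule_app TmSym [(\<Gamma>, TmEq t1 t2 T)] (\<Gamma>, TmEq t2 t1 T)"
| "rule_app TmTrans [(\<Gamma>, TmEq t1 t2 T), (\<Gamma>, TmEq t2 t3 T)] (\<Gamma>, TmEq t1 t3 T)"
| "rule_app TyRefl [(\<Gamma>, IsTy T)] (\<Gamma>, TyEq T T)"
| "rule_app TySym [(\<Gamma>, TyEq T1 T2)] (\<Gamma>, TyEq T2 T1)"
| "rule_app TyTrans [(\<Gamma>, TyEq T1 T2), (\<Gamma>, TyEq T2 T3)] (\<Gamma>, TyEq T1 T3)"
| "rule_app TmConv [(\<Gamma>, TyEq T1 T2), (\<Gamma>, HasTy t T1)] (\<Gamma>, HasTy t T2)"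
| "rule_app TmEqConv [(\<Gamma>, TyEq T1 T2), (\<Gamma>, TmEq t1 t2 T1)] (\<Gamma>, TmEq t1 t2 T2)"
| "bij \<sigma> \<Longrightarrow> rule_app (Perm \<sigma>) [J] (permute \<sigma> J)"
| "y \<notin> fv_ctx \<Gamma> \<union> fv_ctx \<Delta> \<Longrightarrow>
   rule_app (Weaken y) [(\<Gamma>, IsTy T), (\<Gamma> @ \<Delta>, R)] (\<Gamma> @ (y, T) # \<Delta>, R)"
| "y \<notin> fv_ctx \<Gamma> \<Longrightarrow>
   rule_app (Project y) [(\<Gamma>, IsTy T)] (\<Gamma> @ [(y, T)], HasTy (Var y) T)"
| "rule_app (Subst y) [(\<Gamma>, HasTy t T), (\<Gamma> @ (y, T) # \<Delta>, R)]
     (\<Gamma> @ subst_ctx (single t y) \<Delta>, map_rhs (subst (single t y)) R)"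
| "rule_app (SubstTy y) [(\<Gamma>, TmEq t1 t2 T), (\<Gamma> @ (y, T) # \<Delta>, IsTy T')]
     (\<Gamma> @ subst_ctx (single t2 y) \<Delta>, TyEq (subst (single t1 y) T') (subst (single t2 y) T'))"
| "rule_app (SubstTm y) [(\<Gamma>, TmEq t1 t2 T), (\<Gamma> @ (y, T) # \<Delta>, HasTy t' T')]
     (\<Gamma> @ subst_ctx (single t2 y) \<Delta>,
      TmEq (subst (single t1 y) t') (subst (single t2 y) t') (subst (single t2 y) T'))"

fun available :: "structural set \<Rightarrow> rule \<Rightarrow> bool" where
  "available D (Weaken y) = (W \<in> D)"
| "available D (Project y) = (P \<in> D)"
| "available D (Subst y) = (S \<in> D)"
| "available D (SubstTy y) = (S \<in> D)"
| "available D (SubstTm y) = (S \<in> D)"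
| "available D _ = True"


section \<open>Generalised algebraic theories\<close>

record ('o, 's) gat =
  ty_consts :: "'o set"
  tm_consts :: "'s set"
  basics :: "('o + 's) judgement set"

inductive_set derived :: "structural set \<Rightarrow> ('o, 's) gat \<Rightarrow> ('o + 's) judgement set"
  for D :: "structural set" and \<T> :: "('o, 's) gat" where
  basic: "\<lbrakk>J \<in> basics \<T>; \<And>B. B \<in> set (boundary J) \<Longrightarrow> B \<in> derived D \<T>\<rbrakk> \<Longrightarrow> J \<in> derived D \<T>"
| deduce: "\<lbrakk>available D r; rule_app r Js J; \<And>B. B \<in> set Js \<Longrightarrow> B \<in> derived D \<T>\<rbrakk>
    \<Longrightarrow> J \<in> derived D \<T>"

definition introduces_ty :: "'o \<Rightarrow> ('o + 's) judgement \<Rightarrow> bool" where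
  "introduces_ty A J \<longleftrightarrow> (\<exists>\<Gamma>. J = (\<Gamma>, IsTy (App (Inl A) (map (Var \<circ> fst) \<Gamma>))))"

definition introduces_tm :: "'s \<Rightarrow> ('o + 's) judgement \<Rightarrow> bool" where
  "introduces_tm f J \<longleftrightarrow> (\<exists>\<Gamma> T. J = (\<Gamma>, HasTy (App (Inr f) (map (Var \<circ> fst) \<Gamma>)) T))"

definition dgat :: "structural set \<Rightarrow> ('o, 's) gat \<Rightarrow> bool" where
  "dgat D \<T> \<longleftrightarrow>
     (P \<in> D \<longrightarrow> W \<in> D) \<and>
     (\<forall>J\<in>basics \<T>. judgement_over (ty_consts \<T> <+> tm_consts \<T>) J) \<and>
     (\<forall>A\<in>ty_consts \<T>. \<exists>!J. J \<in> basics \<T> \<and> introduces_ty A J) \<and>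
     (\<forall>f\<in>tm_consts \<T>. \<exists>!J. J \<in> basics \<T> \<and> introduces_tm f J) \<and>
     (\<forall>J\<in>basics \<T>. is_type J \<longrightarrow> (\<exists>A\<in>ty_consts \<T>. introduces_ty A J)) \<and>
     (\<forall>J\<in>basics \<T>. is_term J \<longrightarrow> (\<exists>f\<in>tm_consts \<T>. introduces_tm f J)) \<and>
     basics \<T> \<subseteq> derived D \<T>"

definition type_equiv ::
  "structural set \<Rightarrow> ('o, 's) gat \<Rightarrow> ('o + 's) ctx \<Rightarrow> ('o + 's) expr \<Rightarrow>
   ('o + 's) ctx \<Rightarrow> ('o + 's) expr \<Rightarrow> bool" where
  "type_equiv D \<T> \<Gamma> U \<Delta> V \<longleftrightarrow> length \<Gamma> = length \<Delta> \<and>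
     (\<forall>i \<le> length \<Gamma>.
        (take i \<Gamma>,
         TyEq ((map snd \<Gamma> @ [U]) ! i)
              (subst (rename (map fst (take i \<Gamma>)) (map fst (take i \<Delta>)))
                     ((map snd \<Delta> @ [V]) ! i))) \<in> derived D \<T>)"

fun judg_equiv ::
  "structural set \<Rightarrow> ('o, 's) gat \<Rightarrow> ('o + 's) judgement \<Rightarrow> ('o + 's) judgement \<Rightarrow> bool" where
  "judg_equiv D \<T> (\<Gamma>, IsTy U) (\<Delta>, IsTy V) = type_equiv D \<T> \<Gamma> U \<Delta> V"
| "judg_equiv D \<T> (\<Gamma>, HasTy u U) (\<Delta>, HasTy v V) =
     (type_equiv D \<T> \<Gamma> U \<Delta> V \<and>
      (\<Gamma>, TmEq u (subst (rename (map fst \<Gamma>) (map fst \<Delta>)) v) U) \<in> derived D \<T>)"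
| "judg_equiv D \<T> _ _ = False"

definition judg_rel ::
  "structural set \<Rightarrow> ('o, 's) gat \<Rightarrow> (('o + 's) judgement \<times> ('o + 's) judgement) set" where
  "judg_rel D \<T> = {(J, J'). J \<in> derived D \<T> \<and> J' \<in> derived D \<T> \<and> judg_equiv D \<T> J J'}"

abbreviation judg_class ::
  "structural set \<Rightarrow> ('o, 's) gat \<Rightarrow> ('o + 's) judgement \<Rightarrow> ('o + 's) judgement set" where
  "judg_class D \<T> J \<equiv> judg_rel D \<T> `` {J}"

text \<open>A function \<open>\<T>\<^sup>* \<rightarrow> \<U>\<^sup>*\<close> is a function on all judgements of which only the values on
  \<open>\<T>\<^sup>*\<close> matter. Boundaries alone do not tell \<open>\<Gamma>, x : T \<turnstile> T' type\<close> from \<open>\<Gamma> \<turnstile> t : T\<close>, so preservation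
  of the form of a judgement is a separate clause.\<close>

definition interp ::
  "structural set \<Rightarrow> ('o, 's) gat \<Rightarrow> ('p, 't) gat \<Rightarrow>
   (('o + 's) judgement \<Rightarrow> ('p + 't) judgement) \<Rightarrow> bool" where
  "interp D \<T> \<U> \<phi> \<longleftrightarrow> dgat D \<T> \<and> dgat D \<U> \<and>
     (\<forall>J\<in>derived D \<T>. \<phi> J \<in> derived D \<U> \<and> same_form J (\<phi> J) \<and>
        boundary (\<phi> J) = map \<phi> (boundary J)) \<and>
     (\<forall>r Js J J'. available D r \<and> set Js \<subseteq> derived D \<T> \<and>
        rule_app r Js J \<and> rule_app r (map \<phi> Js) J' \<longrightarrow> \<phi> J = J')"

definition interp_rel ::
  "structural set \<Rightarrow> ('o, 's) gat \<Rightarrow> ('p, 't) gat \<Rightarrow>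
   ((('o + 's) judgement \<Rightarrow> ('p + 't) judgement) \<times>
    (('o + 's) judgement \<Rightarrow> ('p + 't) judgement)) set" where
  "interp_rel D \<T> \<U> = {(\<phi>, \<phi>'). interp D \<T> \<U> \<phi> \<and> interp D \<T> \<U> \<phi>' \<and>
     (\<forall>J\<in>derived D \<T>. is_type J \<or> is_term J \<longrightarrow> judg_equiv D \<U> (\<phi> J) (\<phi>' J))}"

definition gat_hom ::
  "structural set \<Rightarrow> ('o, 's) gat \<Rightarrow> ('p, 't) gat \<Rightarrow>
   (('o + 's) judgement \<Rightarrow> ('p + 't) judgement) set set" where
  "gat_hom D \<T> \<U> = Collect (interp D \<T> \<U>) // interp_rel D \<T> \<U>"


section \<open>Type-and-term structures\<close>

text \<open>A presheaf on the free category \<open>\<H>\<close> is given by its values on objects and on generating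
  arrows: \<open>ty X n\<close> is \<open>X(n)\<close>, \<open>tm X n\<close> is \<open>X(n\<^sub>t)\<close>, \<open>ty_bd X n\<close> is the map \<open>X(n+1) \<rightarrow> X(n)\<close> and
  \<open>tm_bd X n\<close> the map \<open>X(n\<^sub>t) \<rightarrow> X(n)\<close>. Only indices \<open>n \<ge> 1\<close> are meaningful. The sets for
  different \<open>n\<close> need not be disjoint.\<close>

record ('a, 'b) tts =
  ty :: "nat \<Rightarrow> 'a set"
  tm :: "nat \<Rightarrow> 'b set"
  ty_bd :: "nat \<Rightarrow> 'a \<Rightarrow> 'a"
  tm_bd :: "nat \<Rightarrow> 'b \<Rightarrow> 'a"

definition is_tts :: "('a, 'b) tts \<Rightarrow> bool" where
  "is_tts X \<longleftrightarrow> (\<forall>n\<ge>1. ty_bd X n ` ty X (Suc n) \<subseteq> ty X n \<and> tm_bd X n ` tm X n \<subseteq> ty X n)"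

record ('a, 'b, 'c, 'd) tts_map =
  on_ty :: "nat \<Rightarrow> 'a \<Rightarrow> 'c"
  on_tm :: "nat \<Rightarrow> 'b \<Rightarrow> 'd"

definition is_tts_map ::
  "('a, 'b) tts \<Rightarrow> ('c, 'd) tts \<Rightarrow> ('a, 'b, 'c, 'd) tts_map \<Rightarrow> bool" where
  "is_tts_map X Y f \<longleftrightarrow> is_tts X \<and> is_tts Y \<and>
     (\<forall>n\<ge>1.
        (\<forall>A\<in>ty X n. on_ty f n A \<in> ty Y n) \<and>
        (\<forall>a\<in>tm X n. on_tm f n a \<in> tm Y n) \<and>
        (\<forall>A\<in>ty X (Suc n). ty_bd Y n (on_ty f (Suc n) A) = on_ty f n (ty_bd X n A)) \<and>
        (\<forall>a\<in>tm X n. tm_bd Y n (on_tm f n a) = on_ty f n (tm_bd X n a)))"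

definition tts_id :: "('a, 'b, 'a, 'b) tts_map" where
  "tts_id = \<lparr>on_ty = \<lambda>n. id, on_tm = \<lambda>n. id\<rparr>"

definition tts_comp ::
  "('c, 'd, 'e, 'f) tts_map \<Rightarrow> ('a, 'b, 'c, 'd) tts_map \<Rightarrow> ('a, 'b, 'e, 'f) tts_map" where
  "tts_comp g f = \<lparr>on_ty = \<lambda>n. on_ty g n \<circ> on_ty f n, on_tm = \<lambda>n. on_tm g n \<circ> on_tm f n\<rparr>"

text \<open>Equality of maps with domain \<open>X\<close>.\<close>

definition tts_map_eq ::
  "('a, 'b) tts \<Rightarrow> ('a, 'b, 'c, 'd) tts_map \<Rightarrow> ('a, 'b, 'c, 'd) tts_map \<Rightarrow> bool" where
  "tts_map_eq X f g \<longleftrightarrow>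
     (\<forall>n\<ge>1. (\<forall>A\<in>ty X n. on_ty f n A = on_ty g n A) \<and> (\<forall>a\<in>tm X n. on_tm f n a = on_tm g n a))"

definition tts_invertible ::
  "('a, 'b) tts \<Rightarrow> ('c, 'd) tts \<Rightarrow> ('a, 'b, 'c, 'd) tts_map \<Rightarrow> bool" where
  "tts_invertible X Y f \<longleftrightarrow> is_tts_map X Y f \<and>
     (\<exists>g. is_tts_map Y X g \<and>
        tts_map_eq X (tts_comp g f) tts_id \<and> tts_map_eq Y (tts_comp f g) tts_id)"


section \<open>The free-forgetful adjunctions\<close>

text \<open>Here and below, \<open>\<Union>J\<in>c. judg_class D \<T> (h J)\<close> is the class of \<open>h J\<close> for any
  representative \<open>J\<close> of the class \<open>c\<close>.\<close>

definition forget ::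
  "structural set \<Rightarrow> ('o, 's) gat \<Rightarrow>
   (('o + 's) judgement set, ('o + 's) judgement set) tts" where
  "forget D \<T> = \<lparr>
     ty = \<lambda>n. {J \<in> derived D \<T>. is_type J \<and> degree J = n} // judg_rel D \<T>,
     tm = \<lambda>n. {J \<in> derived D \<T>. is_term J \<and> degree J = n} // judg_rel D \<T>,
     ty_bd = \<lambda>n c. \<Union>J\<in>c. judg_class D \<T> (hd (boundary J)),
     tm_bd = \<lambda>n c. \<Union>J\<in>c. judg_class D \<T> (hd (boundary J))\<rparr>"

definition forget_map ::
  "structural set \<Rightarrow> ('p, 't) gat \<Rightarrow> (('o + 's) judgement \<Rightarrow> ('p + 't) judgement) set \<Rightarrow>
   (('o + 's) judgement set, ('o + 's) judgement set,
    ('p + 't) judgement set, ('p + 't) judgement set) tts_map" where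
  "forget_map D \<U> \<Phi> = \<lparr>
     on_ty = \<lambda>n c. \<Union>\<phi>\<in>\<Phi>. \<Union>J\<in>c. judg_class D \<U> (\<phi> J),
     on_tm = \<lambda>n c. \<Union>\<phi>\<in>\<Phi>. \<Union>J\<in>c. judg_class D \<U> (\<phi> J)\<rparr>"

text \<open>\<open>bd_iter X n k A\<close> is \<open>\<partial>\<^sup>k A \<in> X(n - k)\<close>, for \<open>A \<in> X(n)\<close>.\<close>

primrec bd_iter :: "('a, 'b) tts \<Rightarrow> nat \<Rightarrow> nat \<Rightarrow> 'a \<Rightarrow> 'a" where
  "bd_iter X n 0 A = A"
| "bd_iter X n (Suc k) A = ty_bd X (n - Suc k) (bd_iter X n k A)"

type_synonym ('a, 'b) elem_sym = "(nat \<times> 'a) + (nat \<times> 'b)"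

definition ty_elem_expr :: "nat \<Rightarrow> 'a \<Rightarrow> ('a, 'b) elem_sym expr" where
  "ty_elem_expr n A = App (Inl (n, A)) (map Var [1..<n])"

definition tm_elem_expr :: "nat \<Rightarrow> 'b \<Rightarrow> ('a, 'b) elem_sym expr" where
  "tm_elem_expr n a = App (Inr (n, a)) (map Var [1..<n])"

definition elem_ctx :: "('a, 'b) tts \<Rightarrow> nat \<Rightarrow> 'a \<Rightarrow> ('a, 'b) elem_sym ctx" where
  "elem_ctx X n A = map (\<lambda>i. (i, ty_elem_expr i (bd_iter X n (n - i) A))) [1..<n]"

definition ty_basic :: "('a, 'b) tts \<Rightarrow> nat \<Rightarrow> 'a \<Rightarrow> ('a, 'b) elem_sym judgement" where
  "ty_basic X n A = (elem_ctx X n A, IsTy (ty_elem_expr n A))"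

definition tm_basic :: "('a, 'b) tts \<Rightarrow> nat \<Rightarrow> 'b \<Rightarrow> ('a, 'b) elem_sym judgement" where
  "tm_basic X n a =
     (elem_ctx X n (tm_bd X n a), HasTy (tm_elem_expr n a) (ty_elem_expr n (tm_bd X n a)))"

text \<open>The constants and basic judgements of the free \<open>D\<close>-GAT on \<open>X\<close> do not depend on \<open>D\<close>; only
  its derived judgements do.\<close>

definition free_gat :: "('a, 'b) tts \<Rightarrow> (nat \<times> 'a, nat \<times> 'b) gat" where
  "free_gat X = \<lparr>
     ty_consts = {(n, A). n \<ge> 1 \<and> A \<in> ty X n},
     tm_consts = {(n, a). n \<ge> 1 \<and> a \<in> tm X n},
     basics = {ty_basic X n A | n A. n \<ge> 1 \<and> A \<in> ty X n} \<union>
              {tm_basic X n a | n a. n \<ge> 1 \<and> a \<in> tm X n}\<rparr>"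

definition adj_unit ::
  "structural set \<Rightarrow> ('a, 'b) tts \<Rightarrow>
   ('a, 'b, ('a, 'b) elem_sym judgement set, ('a, 'b) elem_sym judgement set) tts_map" where
  "adj_unit D X = \<lparr>
     on_ty = \<lambda>n A. judg_class D (free_gat X) (ty_basic X n A),
     on_tm = \<lambda>n a. judg_class D (free_gat X) (tm_basic X n a)\<rparr>"

text \<open>The morphism of \<open>D\<close>-GATs from the free one on \<open>X\<close> to \<open>\<U>\<close> that corresponds to
  \<open>f : X \<rightarrow> forget D \<U>\<close> under the adjunction.\<close>

definition transpose ::
  "structural set \<Rightarrow> ('a, 'b) tts \<Rightarrow> ('p, 't) gat \<Rightarrow>
   ('a, 'b, ('p + 't) judgement set, ('p + 't) judgement set) tts_map \<Rightarrow>
   (('a, 'b) elem_sym judgement \<Rightarrow> ('p + 't) judgement) set" where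
  "transpose D X \<U> f = (THE \<Phi>. \<Phi> \<in> gat_hom D (free_gat X) \<U> \<and>
     tts_map_eq X (tts_comp (forget_map D \<U> \<Phi>) (adj_unit D X)) f)"

definition free_map ::
  "structural set \<Rightarrow> ('a, 'b) tts \<Rightarrow> ('c, 'd) tts \<Rightarrow> ('a, 'b, 'c, 'd) tts_map \<Rightarrow>
   (('a, 'b) elem_sym judgement \<Rightarrow> ('c, 'd) elem_sym judgement) set" where
  "free_map D X Y f = transpose D X (free_gat Y) (tts_comp (adj_unit D Y) f)"

text \<open>The counit sends the basic judgement of the element \<open>[J]\<close> to \<open>J\<close>, up to equivalence.\<close>

definition adj_counit ::
  "structural set \<Rightarrow> ('o, 's) gat \<Rightarrow>
   ((('o + 's) judgement set, ('o + 's) judgement set) elem_sym judgement \<Rightarrow>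
    ('o + 's) judgement) set" where
  "adj_counit D \<T> = transpose D (forget D \<T>) \<T> tts_id"


section \<open>The monads and the comparison map\<close>

type_synonym ('a, 'b) free_elem = "('a, 'b) elem_sym judgement set"

definition monad_obj ::
  "structural set \<Rightarrow> ('a, 'b) tts \<Rightarrow> (('a, 'b) free_elem, ('a, 'b) free_elem) tts" where
  "monad_obj D X = forget D (free_gat X)"

definition monad_map ::
  "structural set \<Rightarrow> ('a, 'b) tts \<Rightarrow> ('c, 'd) tts \<Rightarrow> ('a, 'b, 'c, 'd) tts_map \<Rightarrow>
   (('a, 'b) free_elem, ('a, 'b) free_elem, ('c, 'd) free_elem, ('c, 'd) free_elem) tts_map" where
  "monad_map D X Y f = forget_map D (free_gat Y) (free_map D X Y f)"

definition monad_mult ::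
  "structural set \<Rightarrow> ('a, 'b) tts \<Rightarrow>
   ((('a, 'b) free_elem, ('a, 'b) free_elem) free_elem,
    (('a, 'b) free_elem, ('a, 'b) free_elem) free_elem,
    ('a, 'b) free_elem, ('a, 'b) free_elem) tts_map" where
  "monad_mult D X = forget_map D (free_gat X) (adj_counit D (free_gat X))"

abbreviation (input) "P_rules \<equiv> {W, P}"
abbreviation (input) "S_rules \<equiv> {S}"
abbreviation (input) "T_rules \<equiv> {W, P, S}"

text \<open>The class of a judgement derivable with the rules \<open>D\<close> is sent to the class of the same
  judgement in the free GAT.\<close>

definition to_T ::
  "structural set \<Rightarrow> ('a, 'b) tts \<Rightarrow>
   (('a, 'b) free_elem, ('a, 'b) free_elem, ('a, 'b) free_elem, ('a, 'b) free_elem) tts_map" where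
  "to_T D X = \<lparr>
     on_ty = \<lambda>n c. \<Union>J\<in>c. judg_class T_rules (free_gat X) J,
     on_tm = \<lambda>n c. \<Union>J\<in>c. judg_class T_rules (free_gat X) J\<rparr>"

definition rho ::
  "('a, 'b) tts \<Rightarrow>
   (('a, 'b) free_elem, ('a, 'b) free_elem, ('a, 'b) free_elem, ('a, 'b) free_elem) tts_map" where
  "rho X = to_T P_rules X"

definition sigma ::
  "('a, 'b) tts \<Rightarrow>
   (('a, 'b) free_elem, ('a, 'b) free_elem, ('a, 'b) free_elem, ('a, 'b) free_elem) tts_map" where
  "sigma X = to_T S_rules X"

definition kappa ::
  "('a, 'b) tts \<Rightarrow>
   ((('a, 'b) free_elem, ('a, 'b) free_elem) free_elem,
    (('a, 'b) free_elem, ('a, 'b) free_elem) free_elem,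
    ('a, 'b) free_elem, ('a, 'b) free_elem) tts_map" where
  "kappa X =
     tts_comp (monad_mult T_rules X)
       (tts_comp (rho (monad_obj T_rules X))
          (monad_map P_rules (monad_obj S_rules X) (monad_obj T_rules X) (sigma X)))"

end

theory Submission
  imports Defs
begin

text \<open>Write \<open>S X\<close>, \<open>P X\<close>, \<open>T X\<close> for the values of the three monads.  The proof rests on a normal
form for the judgements of a free theory.

No axiom of a free theory is an equation, and every rule that yields an equation yields an
identity when its premises are identities.  So all derived equations are syntactic identities
(\<open>free_derived_induct\<close>), conversion does nothing, and the class of a derived type or term judgement
is its orbit under renaming of variables (\<open>judg_class_eq_orbit\<close>).  This orbit is the same for each
set of rules that derives the judgement, so \<open>\<rho>\<close> and \<open>\<sigma>\<close> do not change classes.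

A type over \<open>X\<close> in a context \<open>\<Gamma>\<close> has the form \<open>A(t\<^sub>1,\<dots>,t\<^sub>n\<^sub>-\<^sub>1)\<close> with \<open>A \<in> X(n)\<close>.  The \<open>j\<close>-th argument has
type \<open>A\<^sub>j(t\<^sub>1,\<dots>,t\<^sub>j\<^sub>-\<^sub>1)\<close>, which mentions all earlier arguments.  Hence \<open>t\<^sub>j\<close> is either a variable of this
type in \<open>\<Gamma>\<close> or \<open>a(t\<^sub>1,\<dots>,t\<^sub>j\<^sub>-\<^sub>1)\<close> with \<open>\<partial>a = A\<^sub>j\<close>, applied to precisely the earlier arguments (\<open>spine\<close>,
\<open>derived_ok\<close>).  The fragments of the theory are visible in this form:

\<^item> substitution alone derives the judgements in which the variable arguments, from left to right,
  are all the variables of the context (\<open>linear_spine\<close>, \<open>S_derived_linear_judg\<close>,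
  \<open>linear_spine_derived\<close>);
\<^item> weakening and projection derive the judgements in which all arguments are variables
  (\<open>P_derived_var_judg\<close>, \<open>var_spine_derived\<close>).

Let now \<open>U\<close> be any type or constant term over \<open>X\<close> in \<open>\<Gamma>\<close>.  The variables among its arguments form
a part \<open>\<Gamma>\<^sub>s\<close> of \<open>\<Gamma>\<close>, over which \<open>U\<close> is derivable by substitution alone, and \<open>U\<close> determines \<open>\<Gamma>\<^sub>s\<close>.  So
\<open>U\<close> is an element \<open>c\<close> of \<open>S X\<close> applied to the variables of \<open>\<Gamma>\<^sub>s\<close>, and \<open>c(y\<^sub>1,\<dots>,y\<^sub>m)\<close> is a type or
term of the theory with weakening and projection on \<open>S X\<close>.  Passing from \<open>U\<close> to \<open>c(y\<^sub>1,\<dots>,y\<^sub>m)\<close>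
throughout a judgement is \<open>collapse\<close>.  Its inverse puts a representative of \<open>c\<close>, renamed to
\<open>y\<^sub>1,\<dots>,y\<^sub>m\<close>, in the place of \<open>c(y\<^sub>1,\<dots>,y\<^sub>m)\<close> (\<open>expand\<close>).  The two passages are mutually inverse on derived
judgements (\<open>translate_judg_collapse_judg\<close>, \<open>collapse_judg_translate_judg\<close>).

It remains to see that \<open>\<kappa>\<close> is expansion (\<open>kappa_orbit\<close>).  Both the map \<open>P \<sigma>\<close> and the counit are
defined by the universal property of free theories.  An interpretation between free theories
commutes with renaming, so it keeps the variables of each context; it is therefore determined by
the classes of the images of the basic judgements.  The interpretation with given images is the
substitution of fixed expressions for the constants (\<open>transpose_eq\<close>).\<close>

section \<open>Substitution, renaming and orbits\<close>

lemma subst_Var [simp]: "subst Var e = e"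
  by (induction e) (auto simp: map_idI)

lemma subst_subst: "subst \<theta> (subst \<eta> e) = subst (\<lambda>x. subst \<theta> (\<eta> x)) e"
  by (induction e) auto

lemma subst_cong: "(\<And>x. x \<in> fv e \<Longrightarrow> \<theta> x = \<eta> x) \<Longrightarrow> subst \<theta> e = subst \<eta> e"
  by (induction e) auto

lemma fv_subst: "fv (subst \<theta> e) = (\<Union>x\<in>fv e. fv (\<theta> x))"
  by (induction e) auto

lemma subst_single_fresh: "y \<notin> fv e \<Longrightarrow> subst (single t y) e = e"
proof -
  assume "y \<notin> fv e"
  then have "subst (single t y) e = subst Var e"
    by (intro subst_cong) (auto simp: single_def)
  then show ?thesis by simp
qed

abbreviation permute_ctx :: "(var \<Rightarrow> var) \<Rightarrow> 'c ctx \<Rightarrow> 'c ctx" where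
  "permute_ctx \<sigma> \<equiv> map (\<lambda>(x, T). (\<sigma> x, subst (Var \<circ> \<sigma>) T))"

lemma permute_pair:
  "permute \<sigma> (\<Gamma>, R) = (permute_ctx \<sigma> \<Gamma>, map_rhs (subst (Var \<circ> \<sigma>)) R)"
  by (simp add: permute_def)

lemma permute_id: "permute id J = J"
proof -
  have "subst (Var \<circ> id) = (id :: 'a expr \<Rightarrow> 'a expr)" by (rule ext) simp
  then show ?thesis by (simp add: permute_def rhs.map_id map_idI case_prod_beta)
qed

lemma permute_permute: "permute \<sigma> (permute \<tau> J) = permute (\<sigma> \<circ> \<tau>) J"
  by (cases J) (auto simp: permute_pair rhs.map_comp subst_subst o_def intro!: rhs.map_cong)

definition orbit :: "'c judgement \<Rightarrow> 'c judgement set" where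
  "orbit J = {permute \<pi> J | \<pi>. bij \<pi>}"

lemma orbit_self: "J \<in> orbit J"
  unfolding orbit_def using permute_id[of J, symmetric] bij_id by blast

lemma orbit_permute:
  assumes "bij \<pi>"
  shows "orbit (permute \<pi> J) = orbit J"
proof
  show "orbit (permute \<pi> J) \<subseteq> orbit J"
    using assms by (auto simp: orbit_def permute_permute intro: bij_comp)
next
  have "permute \<sigma> J = permute (\<sigma> \<circ> inv \<pi>) (permute \<pi> J)" for \<sigma>
    using assms by (simp add: permute_permute o_assoc[symmetric] bij_is_inj)
  then show "orbit J \<subseteq> orbit (permute \<pi> J)"
    using assms bij_comp bij_imp_bij_inv unfolding orbit_def by blast
qed

lemma orbit_eq: "J' \<in> orbit J \<Longrightarrow> orbit J' = orbit J"
proof -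
  assume "J' \<in> orbit J"
  then obtain \<pi> where "bij \<pi>" "J' = permute \<pi> J" by (auto simp: orbit_def)
  then show ?thesis by (simp add: orbit_permute)
qed

text \<open>The bijection found for the tails is corrected at the heads by a transposition, which fixes all
values that were already prescribed.\<close>

lemma bij_extending:
  assumes "distinct xs" "distinct ys" "length xs = length ys"
  shows "\<exists>\<pi>. bij (\<pi> :: var \<Rightarrow> var) \<and> map \<pi> xs = ys"
  using assms(3,1,2)
proof (induction xs ys rule: list_induct2)
  case Nil
  show ?case using bij_id by auto
next
  case (Cons x xs y ys)
  then obtain \<pi> where \<pi>: "bij \<pi>" "map \<pi> xs = ys" by auto
  define s where "s = (\<lambda>z. if z = \<pi> x then y else if z = y then \<pi> x else z)"
  have "s \<circ> s = id" by (auto simp: s_def fun_eq_iff)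
  then have "bij s" by (rule o_bij) (simp add: \<open>s \<circ> s = id\<close>)
  have "s (\<pi> z) = \<pi> z" if "z \<in> set xs" for z
  proof -
    have "\<pi> z \<noteq> \<pi> x" using \<pi>(1) that Cons.prems by (auto simp: bij_def inj_def)
    moreover have "\<pi> z \<noteq> y" using that Cons.prems \<pi>(2) by auto
    ultimately show ?thesis by (simp add: s_def)
  qed
  then have "map (s \<circ> \<pi>) (x # xs) = y # ys" using \<pi>(2) by (auto simp: s_def)
  moreover have "bij (s \<circ> \<pi>)" using bij_comp[OF \<pi>(1) \<open>bij s\<close>] .
  ultimately show ?case by (intro exI[of _ "s \<circ> \<pi>"] conjI)
qed

lemma length_permute [simp]: "length (fst (permute \<sigma> J)) = length (fst J)"
  by (simp add: permute_def)

lemma degree_permute [simp]: "degree (permute \<sigma> J) = degree J"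
  by (simp add: degree_def)

lemma map_fst_permute [simp]: "map fst (fst (permute \<sigma> J)) = map \<sigma> (map fst (fst J))"
  by (auto simp: permute_def)

lemma boundary_permute: "boundary (permute \<sigma> J) = map (permute \<sigma>) (boundary J)"
  by (cases J rule: boundary.cases)
     (auto simp: permute_pair map_butlast last_map case_prod_beta)

lemma is_type_permute [simp]: "is_type (permute \<sigma> J) = is_type J"
  by (cases J rule: is_type.cases) (auto simp: permute_pair)

lemma is_term_permute [simp]: "is_term (permute \<sigma> J) = is_term J"
  by (cases J rule: is_term.cases) (auto simp: permute_pair)

section \<open>Derived equations of a free theory\<close>

fun trivial_eq :: "'e rhs \<Rightarrow> bool" where
  "trivial_eq (TyEq T T') = (T = T')"
| "trivial_eq (TmEq t t' T) = (t = t')"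
| "trivial_eq _ = True"

text \<open>Once the two sides of an equation are known to coincide, all its information is in the judgement
that its left side is well typed.\<close>

fun lhs_typing :: "'e rhs \<Rightarrow> 'e rhs" where
  "lhs_typing (TyEq T T') = IsTy T"
| "lhs_typing (TmEq t t' T) = HasTy t T"
| "lhs_typing R = R"

definition typing :: "'e rhs \<Rightarrow> bool" where
  "typing R \<longleftrightarrow> (\<exists>T. R = IsTy T) \<or> (\<exists>t T. R = HasTy t T)"

lemma typing_simps [simp]: "typing (IsTy T)" "typing (HasTy t T)" "\<not> typing (TyEq T T')"
  "\<not> typing (TmEq t t' T)" "typing (lhs_typing R)" "typing (map_rhs f R) = typing R"
  by (auto simp: typing_def) (cases R; auto)+

lemma typingE:
  assumes "typing (snd J)"
  obtains (ty) \<Gamma> U where "J = (\<Gamma>, IsTy U)" | (tm) \<Gamma> u U where "J = (\<Gamma>, HasTy u U)"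
  using assms by (cases J) (auto simp: typing_def)

lemma lhs_typing_typing [simp]: "typing R \<Longrightarrow> lhs_typing R = R"
  by (auto simp: typing_def)

lemma lhs_typing_map [simp]: "lhs_typing (map_rhs f R) = map_rhs f (lhs_typing R)"
  by (cases R) auto

lemma trivial_eq_map: "trivial_eq R \<Longrightarrow> trivial_eq (map_rhs f R)"
  by (cases R) auto

lemma trivial_eq_typing [simp]: "typing R \<Longrightarrow> trivial_eq R"
  by (auto simp: typing_def)

lemma typing_iff: "typing (snd J) \<longleftrightarrow> is_type J \<or> is_term J"
  by (cases J rule: is_type.cases) auto

abbreviation der :: "structural set \<Rightarrow> ('a, 'b) tts \<Rightarrow> ('a, 'b) elem_sym judgement set" where
  "der D X \<equiv> derived D (free_gat X)"

text \<open>The boundary of a projection \<open>\<Gamma>, y : T \<turnstile> y : T\<close> is a weakening.  Under this condition on \<open>D\<close> the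
derived judgements are therefore closed under boundaries.\<close>

abbreviation gat_rules :: "structural set \<Rightarrow> bool" where
  "gat_rules D \<equiv> P \<in> D \<longrightarrow> W \<in> D"

lemma derived_perm: "J \<in> derived D \<T> \<Longrightarrow> bij \<sigma> \<Longrightarrow> permute \<sigma> J \<in> derived D \<T>"
  using derived.deduce[of D "Perm \<sigma>" "[J]" "permute \<sigma> J" \<T>] by (auto intro: rule_app.intros)

lemma derived_weaken:
  "W \<in> D \<Longrightarrow> y \<notin> fv_ctx \<Gamma> \<union> fv_ctx \<Delta> \<Longrightarrow> (\<Gamma>, IsTy T) \<in> derived D \<T> \<Longrightarrow>
   (\<Gamma> @ \<Delta>, R) \<in> derived D \<T> \<Longrightarrow> (\<Gamma> @ (y, T) # \<Delta>, R) \<in> derived D \<T>"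
  using derived.deduce[of D "Weaken y" "[(\<Gamma>, IsTy T), (\<Gamma> @ \<Delta>, R)]" _ \<T>]
  by (auto intro: rule_app.intros)

lemma derived_project:
  "P \<in> D \<Longrightarrow> y \<notin> fv_ctx \<Gamma> \<Longrightarrow> (\<Gamma>, IsTy T) \<in> derived D \<T> \<Longrightarrow>
   (\<Gamma> @ [(y, T)], HasTy (Var y) T) \<in> derived D \<T>"
  using derived.deduce[of D "Project y" "[(\<Gamma>, IsTy T)]" _ \<T>]
  by (auto intro: rule_app.intros)

lemma derived_subst:
  "S \<in> D \<Longrightarrow> (\<Gamma>, HasTy t T) \<in> derived D \<T> \<Longrightarrow> (\<Gamma> @ (y, T) # \<Delta>, R) \<in> derived D \<T> \<Longrightarrow>
   (\<Gamma> @ subst_ctx (single t y) \<Delta>, map_rhs (subst (single t y)) R) \<in> derived D \<T>"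
  using derived.deduce[of D "Subst y" "[(\<Gamma>, HasTy t T), (\<Gamma> @ (y, T) # \<Delta>, R)]" _ \<T>]
  by (auto intro: rule_app.intros)

lemma derived_tyrefl: "(\<Gamma>, IsTy T) \<in> derived D \<T> \<Longrightarrow> (\<Gamma>, TyEq T T) \<in> derived D \<T>"
  using derived.deduce[of D "TyRefl" "[(\<Gamma>, IsTy T)]" _ \<T>]
  by (auto intro: rule_app.intros)

lemma derived_tmrefl: "(\<Gamma>, HasTy t T) \<in> derived D \<T> \<Longrightarrow> (\<Gamma>, TmEq t t T) \<in> derived D \<T>"
  using derived.deduce[of D "TmRefl" "[(\<Gamma>, HasTy t T)]" _ \<T>]
  by (auto intro: rule_app.intros)

lemma derived_mono:
  assumes "J \<in> derived D \<T>" "D \<subseteq> D'"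
  shows "J \<in> derived D' \<T>"
  using assms(1)
proof (induction rule: derived.induct)
  case (basic J)
  then show ?case using derived.basic[of J \<T> D'] by simp
next
  case (deduce r Js J)
  have "available D' r" using deduce.hyps(1) assms(2) by (cases r) auto
  then show ?case using derived.deduce deduce.hyps(2) deduce.IH by metis
qed

text \<open>The only source of equations is reflexivity, because no basic judgement is an equation; symmetry,
transitivity, conversion and congruence preserve identities.  So an induction over derivations
has to treat only the rules for type and term judgements, the two congruence rules being instances
of substitution.\<close>

lemma free_derived_induct:
  assumes "J \<in> der D X"
    and basic_ty: "\<And>n A. n \<ge> 1 \<Longrightarrow> A \<in> ty X n \<Longrightarrow> ty_basic X n A \<in> der D X \<Longrightarrow>
      (\<And>B. B \<in> set (boundary (ty_basic X n A)) \<Longrightarrow> Q B \<and> B \<in> der D X) \<Longrightarrow> Q (ty_basic X n A)"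
    and basic_tm: "\<And>n a. n \<ge> 1 \<Longrightarrow> a \<in> tm X n \<Longrightarrow> tm_basic X n a \<in> der D X \<Longrightarrow>
      (\<And>B. B \<in> set (boundary (tm_basic X n a)) \<Longrightarrow> Q B \<and> B \<in> der D X) \<Longrightarrow> Q (tm_basic X n a)"
    and perm: "\<And>\<sigma> \<Gamma> R. bij \<sigma> \<Longrightarrow> typing R \<Longrightarrow> (\<Gamma>, R) \<in> der D X \<Longrightarrow> Q (\<Gamma>, R) \<Longrightarrow>
      Q (permute \<sigma> (\<Gamma>, R))"
    and weaken: "\<And>y \<Gamma> \<Delta> T R. W \<in> D \<Longrightarrow> y \<notin> fv_ctx \<Gamma> \<union> fv_ctx \<Delta> \<Longrightarrow> typing R \<Longrightarrow>
      (\<Gamma>, IsTy T) \<in> der D X \<Longrightarrow> Q (\<Gamma>, IsTy T) \<Longrightarrow> (\<Gamma> @ \<Delta>, R) \<in> der D X \<Longrightarrow> Q (\<Gamma> @ \<Delta>, R) \<Longrightarrow>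
      Q (\<Gamma> @ (y, T) # \<Delta>, R)"
    and project: "\<And>y \<Gamma> T. P \<in> D \<Longrightarrow> y \<notin> fv_ctx \<Gamma> \<Longrightarrow>
      (\<Gamma>, IsTy T) \<in> der D X \<Longrightarrow> Q (\<Gamma>, IsTy T) \<Longrightarrow> Q (\<Gamma> @ [(y, T)], HasTy (Var y) T)"
    and subst: "\<And>y \<Gamma> \<Delta> t T R. S \<in> D \<Longrightarrow> typing R \<Longrightarrow>
      (\<Gamma>, HasTy t T) \<in> der D X \<Longrightarrow> Q (\<Gamma>, HasTy t T) \<Longrightarrow>
      (\<Gamma> @ (y, T) # \<Delta>, R) \<in> der D X \<Longrightarrow> Q (\<Gamma> @ (y, T) # \<Delta>, R) \<Longrightarrow>
      Q (\<Gamma> @ subst_ctx (single t y) \<Delta>, map_rhs (subst (single t y)) R)"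
  shows "trivial_eq (snd J) \<and> (fst J, lhs_typing (snd J)) \<in> der D X \<and> Q (fst J, lhs_typing (snd J))"
  using assms(1)
proof (induction rule: derived.induct)
  case (basic J)
  have J: "J \<in> der D X" using basic derived.basic by blast
  have type: "B \<in> set (boundary J) \<Longrightarrow> typing (snd B)" for B
    using basic(1) by (auto simp: free_gat_def ty_basic_def tm_basic_def split: if_splits)
  have B: "Q B \<and> B \<in> der D X" if "B \<in> set (boundary J)" for B
    using basic.IH[OF that] type[OF that] by simp
  have "typing (snd J)" "Q J"
    using basic(1) B J basic_ty basic_tm by (auto simp: free_gat_def ty_basic_def tm_basic_def)
  then show ?case using J by (cases J) auto
next
  case (deduce r Js J)
  have IH: "\<forall>B\<in>set Js. trivial_eq (snd B) \<and> (fst B, lhs_typing (snd B)) \<in> der D X \<and> Q (fst B, lhs_typing (snd B))"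
    using deduce.IH by simp
  show ?case
    using deduce.hyps(2)
  proof cases
    case (9 \<sigma> J0)
    have D: "trivial_eq (snd J0)" "(fst J0, lhs_typing (snd J0)) \<in> der D X" "Q (fst J0, lhs_typing (snd J0))"
      using IH 9 by simp_all
    show ?thesis
      using D trivial_eq_map derived_perm[OF D(2) 9(4)] perm[OF 9(4) _ D(2,3)] 9
      by (cases J0) (auto simp: permute_pair)
  next
    case (10 y \<Gamma> \<Delta> T R)
    have D: "(\<Gamma>, IsTy T) \<in> der D X" "Q (\<Gamma>, IsTy T)" "trivial_eq R" "(\<Gamma> @ \<Delta>, lhs_typing R) \<in> der D X"
      "Q (\<Gamma> @ \<Delta>, lhs_typing R)"
      using IH 10 by simp_all
    have "W \<in> D" using deduce.hyps(1) 10 by simp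
    then show ?thesis
      using D 10 weaken[OF _ 10(4) _ D(1,2,4,5)] derived_weaken[OF _ 10(4) D(1,4)] by simp
  next
    case (11 y \<Gamma> T)
    have D: "(\<Gamma>, IsTy T) \<in> der D X" "Q (\<Gamma>, IsTy T)" using IH 11 by simp_all
    have "P \<in> D" using deduce.hyps(1) 11 by simp
    then show ?thesis using D 11 project derived_project by simp
  next
    case (12 y \<Gamma> t T \<Delta> R)
    have D: "(\<Gamma>, HasTy t T) \<in> der D X" "Q (\<Gamma>, HasTy t T)" "trivial_eq R"
      "(\<Gamma> @ (y, T) # \<Delta>, lhs_typing R) \<in> der D X" "Q (\<Gamma> @ (y, T) # \<Delta>, lhs_typing R)"
      using IH 12 by simp_all
    have "S \<in> D" using deduce.hyps(1) 12 by simp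
    then show ?thesis
      using D 12 subst[OF _ _ D(1,2,4,5)] derived_subst[OF _ D(1,4)] trivial_eq_map by simp
  next
    case (13 y \<Gamma> t1 t2 T \<Delta> T')
    have eq: "t1 = t2" using IH 13 by simp
    have D: "(\<Gamma>, HasTy t2 T) \<in> der D X" "Q (\<Gamma>, HasTy t2 T)"
      "(\<Gamma> @ (y, T) # \<Delta>, IsTy T') \<in> der D X" "Q (\<Gamma> @ (y, T) # \<Delta>, IsTy T')"
      using IH 13 eq by simp_all
    have "S \<in> D" using deduce.hyps(1) 13 by simp
    then show ?thesis
      using D eq 13 subst[OF _ _ D(1,2,3,4)] derived_subst[OF _ D(1,3)] by simp
  next
    case (14 y \<Gamma> t1 t2 T \<Delta> t' T')
    have eq: "t1 = t2" using IH 14 by simp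
    have D: "(\<Gamma>, HasTy t2 T) \<in> der D X" "Q (\<Gamma>, HasTy t2 T)"
      "(\<Gamma> @ (y, T) # \<Delta>, HasTy t' T') \<in> der D X" "Q (\<Gamma> @ (y, T) # \<Delta>, HasTy t' T')"
      using IH 14 eq by simp_all
    have "S \<in> D" using deduce.hyps(1) 14 by simp
    then show ?thesis
      using D eq 14 subst[OF _ _ D(1,2,3,4)] derived_subst[OF _ D(1,3)] by simp
  next
    case (3 \<Gamma> t1 t2 T t3)
    then have "t1 = t2" "t2 = t3" using IH by simp_all
    then show ?thesis using IH 3 by simp
  next
    case (6 \<Gamma> T1 T2 T3)
    then have "T1 = T2" "T2 = T3" using IH by simp_all
    then show ?thesis using IH 6 by simp
  next
    case (7 \<Gamma> T1 T2 t)
    then have "T1 = T2" using IH by simp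
    then show ?thesis using IH 7 by simp
  next
    case (8 \<Gamma> T1 T2 t1 t2)
    then have "T1 = T2" "t1 = t2" using IH by simp_all
    then show ?thesis using IH 8 by simp
  next
    case (2 \<Gamma> t1 t2 T)
    then have "t1 = t2" using IH by simp
    then show ?thesis using IH 2 by simp
  next
    case (5 \<Gamma> T1 T2)
    then have "T1 = T2" using IH by simp
    then show ?thesis using IH 5 by simp
  next
    case (1 \<Gamma> t T)
    then show ?thesis using IH by simp
  next
    case (4 \<Gamma> T)
    then show ?thesis using IH by simp
  qed
qed

section \<open>Well-formed judgements\<close>

text \<open>The predicate is asked of each type over the part of the context that precedes it.\<close>

definition ctx_all :: "('c ctx \<Rightarrow> 'c expr \<Rightarrow> bool) \<Rightarrow> 'c ctx \<Rightarrow> bool" where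
  "ctx_all Pr \<Gamma> \<longleftrightarrow> distinct (map fst \<Gamma>) \<and> (\<forall>\<Gamma>1 y T \<Gamma>2. \<Gamma> = \<Gamma>1 @ (y, T) # \<Gamma>2 \<longrightarrow> Pr \<Gamma>1 T)"

abbreviation derived_ctx :: "structural set \<Rightarrow> ('a, 'b) tts \<Rightarrow> ('a, 'b) elem_sym ctx \<Rightarrow> bool" where
  "derived_ctx D X \<equiv> ctx_all (\<lambda>\<Gamma> T. (\<Gamma>, IsTy T) \<in> der D X)"

lemma ctx_all_Nil [simp]: "ctx_all Pr []"
  by (simp add: ctx_all_def)

lemma ctx_all_snoc [simp]:
  "ctx_all Pr (\<Gamma> @ [(y, T)]) \<longleftrightarrow> ctx_all Pr \<Gamma> \<and> y \<notin> fst ` set \<Gamma> \<and> Pr \<Gamma> T"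
proof -
  have "(\<forall>\<Gamma>1 z U \<Gamma>2. \<Gamma> @ [(y, T)] = \<Gamma>1 @ (z, U) # \<Gamma>2 \<longrightarrow> Pr \<Gamma>1 U) \<longleftrightarrow>
    (\<forall>\<Gamma>1 z U \<Gamma>2. \<Gamma> = \<Gamma>1 @ (z, U) # \<Gamma>2 \<longrightarrow> Pr \<Gamma>1 U) \<and> Pr \<Gamma> T" (is "?L \<longleftrightarrow> ?R")
  proof
    assume L: ?L
    show ?R
    proof (intro conjI allI impI)
      fix \<Gamma>1 z U \<Gamma>2
      assume "\<Gamma> = \<Gamma>1 @ (z, U) # \<Gamma>2"
      then have "\<Gamma> @ [(y, T)] = \<Gamma>1 @ (z, U) # (\<Gamma>2 @ [(y, T)])" by simp
      then show "Pr \<Gamma>1 U" using L by blast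
    qed (use L in blast)
  next
    assume R: ?R
    show ?L
    proof (intro allI impI)
      fix \<Gamma>1 z U \<Gamma>2
      assume eq: "\<Gamma> @ [(y, T)] = \<Gamma>1 @ (z, U) # \<Gamma>2"
      show "Pr \<Gamma>1 U"
      proof (cases \<Gamma>2 rule: rev_cases)
        case Nil
        then show ?thesis using eq R by simp
      next
        case (snoc \<Gamma>3 v)
        then have "\<Gamma> = \<Gamma>1 @ (z, U) # \<Gamma>3" using eq by simp
        then show ?thesis using R by blast
      qed
    qed
  qed
  then show ?thesis by (auto simp: ctx_all_def)
qed

lemma ctx_all_distinct: "ctx_all Pr \<Gamma> \<Longrightarrow> distinct (map fst \<Gamma>)"
  by (simp add: ctx_all_def)

lemma ctx_all_prefix: "ctx_all Pr (\<Gamma> @ \<Delta>) \<Longrightarrow> ctx_all Pr \<Gamma>"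
  by (auto simp: ctx_all_def)

lemma ctx_all_mono: "ctx_all Pr \<Gamma> \<Longrightarrow> (\<And>\<Gamma> T. Pr \<Gamma> T \<Longrightarrow> Pr' \<Gamma> T) \<Longrightarrow> ctx_all Pr' \<Gamma>"
  by (auto simp: ctx_all_def)

lemma ctx_all_mem:
  "ctx_all Pr \<Gamma> \<Longrightarrow> (y, T) \<in> set \<Gamma> \<Longrightarrow>
   \<exists>\<Gamma>1 \<Gamma>2. \<Gamma> = \<Gamma>1 @ (y, T) # \<Gamma>2 \<and> ctx_all Pr \<Gamma>1 \<and> y \<notin> fst ` set \<Gamma>1 \<and> Pr \<Gamma>1 T"
proof -
  assume A: "ctx_all Pr \<Gamma>" "(y, T) \<in> set \<Gamma>"
  then obtain \<Gamma>1 \<Gamma>2 where \<Gamma>: "\<Gamma> = \<Gamma>1 @ (y, T) # \<Gamma>2" by (auto dest: split_list)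
  then have "ctx_all Pr (\<Gamma>1 @ [(y, T)])" using A(1) ctx_all_prefix[of Pr "\<Gamma>1 @ [(y, T)]" \<Gamma>2] by simp
  then show ?thesis using \<Gamma> by (auto simp: image_iff)
qed

lemma ctx_all_permute:
  assumes "ctx_all Pr \<Gamma>" "bij \<sigma>"
    and "\<And>\<Gamma> T. Pr \<Gamma> T \<Longrightarrow> Pr (permute_ctx \<sigma> \<Gamma>) (subst (Var \<circ> \<sigma>) T)"
  shows "ctx_all Pr (permute_ctx \<sigma> \<Gamma>)"
  using assms(1)
proof (induction \<Gamma> rule: rev_induct)
  case (snoc v \<Gamma>)
  obtain y T where [simp]: "v = (y, T)" by (cases v)
  let ?p = "\<lambda>(x, T). (\<sigma> x, subst (Var \<circ> \<sigma>) T)"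
  have "\<sigma> y \<notin> fst ` set (map ?p \<Gamma>)"
    using snoc.prems bij_is_inj[OF assms(2)] by (force simp: inj_def)
  then show ?case using snoc assms(3)[of \<Gamma> T] ctx_all_snoc[of Pr "map ?p \<Gamma>" "\<sigma> y"]
    by (simp add: o_def)
qed simp

lemma ctx_all_weaken:
  assumes "ctx_all Pr (\<Gamma> @ \<Delta>)" "Pr \<Gamma> T" "y \<notin> fv_ctx \<Gamma> \<union> fv_ctx \<Delta>"
    and "\<And>\<Delta>' U. y \<notin> fv_ctx \<Delta>' \<Longrightarrow> Pr (\<Gamma> @ \<Delta>') U \<Longrightarrow> Pr (\<Gamma> @ (y, T) # \<Delta>') U"
  shows "ctx_all Pr (\<Gamma> @ (y, T) # \<Delta>)"
  using assms(1,3)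
proof (induction \<Delta> rule: rev_induct)
  case Nil
  then show ?case using assms(2) by (auto simp: fv_ctx_def)
next
  case (snoc v \<Delta>)
  obtain x U where [simp]: "v = (x, U)" by (cases v)
  have 1: "ctx_all Pr (\<Gamma> @ \<Delta>)" "x \<notin> fst ` set (\<Gamma> @ \<Delta>)" "Pr (\<Gamma> @ \<Delta>) U"
    using snoc.prems(1) ctx_all_snoc[of Pr "\<Gamma> @ \<Delta>" x U] by simp_all
  have 2: "y \<notin> fv_ctx \<Gamma> \<union> fv_ctx \<Delta>" "x \<noteq> y" using snoc.prems(2) by (auto simp: fv_ctx_def)
  show ?case
    using snoc.IH[OF 1(1) 2(1)] assms(4)[OF _ 1(3)] 1 2 ctx_all_snoc[of Pr "\<Gamma> @ (y, T) # \<Delta>" x U]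
    by auto
qed

lemma subst_ctx_simps [simp]:
  "subst_ctx \<theta> [] = []" "subst_ctx \<theta> (\<Gamma> @ \<Delta>) = subst_ctx \<theta> \<Gamma> @ subst_ctx \<theta> \<Delta>"
  "subst_ctx \<theta> ((x, T) # \<Delta>) = (x, subst \<theta> T) # subst_ctx \<theta> \<Delta>"
  "fst ` set (subst_ctx \<theta> \<Gamma>) = fst ` set \<Gamma>" "map fst (subst_ctx \<theta> \<Gamma>) = map fst \<Gamma>"
  by (auto simp: subst_ctx_def image_image case_prod_beta)

lemma ctx_all_subst:
  assumes "ctx_all Pr (\<Gamma> @ (y, T) # \<Delta>)"
    and "\<And>\<Delta>' U. ctx_all Pr (\<Gamma> @ (y, T) # \<Delta>') \<Longrightarrow> Pr (\<Gamma> @ (y, T) # \<Delta>') U \<Longrightarrow>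
      Pr (\<Gamma> @ subst_ctx \<theta> \<Delta>') (subst \<theta> U)"
  shows "ctx_all Pr (\<Gamma> @ subst_ctx \<theta> \<Delta>)"
  using assms(1)
proof (induction \<Delta> rule: rev_induct)
  case Nil
  then show ?case by simp
next
  case (snoc v \<Delta>)
  obtain x U where [simp]: "v = (x, U)" by (cases v)
  have 1: "ctx_all Pr (\<Gamma> @ (y, T) # \<Delta>)" "x \<notin> fst ` set (\<Gamma> @ (y, T) # \<Delta>)" "Pr (\<Gamma> @ (y, T) # \<Delta>) U"
    using snoc.prems ctx_all_snoc[of Pr "\<Gamma> @ (y, T) # \<Delta>" x U] by simp_all
  show ?case
    using snoc.IH[OF 1(1)] assms(2)[OF 1(1,3)] 1
      ctx_all_snoc[of Pr "\<Gamma> @ subst_ctx \<theta> \<Delta>" x "subst \<theta> U"]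
    by (auto simp: image_Un)
qed

lemma in_fst: "(y, T) \<in> set \<Gamma> \<Longrightarrow> y \<in> fst ` set \<Gamma>"
  by (metis fst_conv imageI)

text \<open>The term \<open>t\<close> is an argument of type \<open>A(es)\<close>.  A term constant can only occur applied to the very
arguments \<open>es\<close> of its type.\<close>

definition arg_ok ::
  "('a, 'b) tts \<Rightarrow> ('a, 'b) elem_sym ctx \<Rightarrow> nat \<Rightarrow> 'a \<Rightarrow> ('a, 'b) elem_sym expr list \<Rightarrow>
   ('a, 'b) elem_sym expr \<Rightarrow> bool" where
  "arg_ok X \<Gamma> n A es t \<longleftrightarrow>
     (\<exists>y. t = Var y \<and> (y, App (Inl (n, A)) es) \<in> set \<Gamma>) \<or>
     (\<exists>a\<in>tm X n. tm_bd X n a = A \<and> t = App (Inr (n, a)) es)"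

text \<open>The lists of arguments that \<open>A \<in> X(n)\<close> accepts in \<open>\<Gamma>\<close>.  They are built up along the boundary of \<open>A\<close>, since
the list without its last entry is one that \<open>\<partial>A\<close> accepts, and \<open>\<partial>A\<close> applied to it is the type of the last
entry.\<close>

inductive spine ::
  "('a, 'b) tts \<Rightarrow> ('a, 'b) elem_sym ctx \<Rightarrow> nat \<Rightarrow> 'a \<Rightarrow> ('a, 'b) elem_sym expr list \<Rightarrow> bool"
  for X :: "('a, 'b) tts" and \<Gamma> :: "('a, 'b) elem_sym ctx" where
  nil: "A \<in> ty X (Suc 0) \<Longrightarrow> spine X \<Gamma> (Suc 0) A []"
| snoc: "spine X \<Gamma> n B es \<Longrightarrow> A \<in> ty X (Suc n) \<Longrightarrow> ty_bd X n A = B \<Longrightarrow> arg_ok X \<Gamma> n B es t \<Longrightarrow>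
    spine X \<Gamma> (Suc n) A (es @ [t])"

definition ty_ok :: "('a, 'b) tts \<Rightarrow> ('a, 'b) elem_sym ctx \<Rightarrow> ('a, 'b) elem_sym expr \<Rightarrow> bool" where
  "ty_ok X \<Gamma> T \<longleftrightarrow> (\<exists>n A es. T = App (Inl (n, A)) es \<and> spine X \<Gamma> n A es)"

definition tm_ok ::
  "('a, 'b) tts \<Rightarrow> ('a, 'b) elem_sym ctx \<Rightarrow> ('a, 'b) elem_sym expr \<Rightarrow> ('a, 'b) elem_sym expr \<Rightarrow> bool"
  where
  "tm_ok X \<Gamma> t T \<longleftrightarrow> (\<exists>n A es. T = App (Inl (n, A)) es \<and> spine X \<Gamma> n A es \<and> arg_ok X \<Gamma> n A es t)"

abbreviation ok_ctx :: "structural set \<Rightarrow> ('a, 'b) tts \<Rightarrow> ('a, 'b) elem_sym ctx \<Rightarrow> bool" where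
  "ok_ctx D X \<equiv> ctx_all (\<lambda>\<Gamma> T. ty_ok X \<Gamma> T \<and> (\<Gamma>, IsTy T) \<in> der D X)"

lemma spine_props:
  "spine X \<Gamma> n A es \<Longrightarrow> A \<in> ty X n \<and> n = Suc (length es)"
  by (induction rule: spine.induct) auto

lemma arg_ok_fv:
  assumes "arg_ok X \<Gamma> n A es t" "\<Union> (fv ` set es) \<subseteq> fst ` set \<Gamma>"
  shows "fv t \<subseteq> fst ` set \<Gamma>"
  using assms(1) unfolding arg_ok_def
proof (elim disjE exE conjE bexE)
  fix y
  assume "t = Var y" "(y, App (Inl (n, A)) es) \<in> set \<Gamma>"
  then show ?thesis using in_fst by simp
qed (use assms(2) in simp)

lemma spine_fv: "spine X \<Gamma> n A es \<Longrightarrow> \<Union> (fv ` set es) \<subseteq> fst ` set \<Gamma>"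
  by (induction rule: spine.induct) (auto dest: arg_ok_fv)

lemma ty_ok_fv: "ty_ok X \<Gamma> T \<Longrightarrow> fv T \<subseteq> fst ` set \<Gamma>"
  by (auto simp: ty_ok_def dest!: spine_fv)

lemma tm_ok_fv: "tm_ok X \<Gamma> t T \<Longrightarrow> fv t \<subseteq> fst ` set \<Gamma>"
  unfolding tm_ok_def using arg_ok_fv spine_fv by metis

text \<open>It suffices to control the images of the variables, because a constant argument carries the earlier
arguments with it.  Weakening, renaming and substitution are all instances.\<close>

lemma arg_ok_subst:
  assumes "arg_ok X \<Gamma> n A es t"
    and "\<And>y k B us. (y, App (Inl (k, B)) us) \<in> set \<Gamma> \<Longrightarrow> arg_ok X \<Gamma>' k B (map (subst \<theta>) us) (\<theta> y)"
  shows "arg_ok X \<Gamma>' n A (map (subst \<theta>) es) (subst \<theta> t)"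
  using assms(1) unfolding arg_ok_def[of X \<Gamma>]
proof (elim disjE exE conjE bexE)
  fix y
  assume "t = Var y" "(y, App (Inl (n, A)) es) \<in> set \<Gamma>"
  then show ?thesis using assms(2) by simp
qed (auto simp: arg_ok_def)

lemma spine_subst:
  assumes "spine X \<Gamma> n A es"
    and "\<And>y k B us. (y, App (Inl (k, B)) us) \<in> set \<Gamma> \<Longrightarrow> arg_ok X \<Gamma>' k B (map (subst \<theta>) us) (\<theta> y)"
  shows "spine X \<Gamma>' n A (map (subst \<theta>) es)"
  using assms(1)
proof (induction rule: spine.induct)
  case (snoc n B es A t)
  then show ?case using arg_ok_subst[OF _ assms(2)] by (simp add: spine.snoc)
qed (simp add: spine.nil)

lemma ty_ok_subst:
  assumes "ty_ok X \<Gamma> T"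
    and "\<And>y k B us. (y, App (Inl (k, B)) us) \<in> set \<Gamma> \<Longrightarrow> arg_ok X \<Gamma>' k B (map (subst \<theta>) us) (\<theta> y)"
  shows "ty_ok X \<Gamma>' (subst \<theta> T)"
proof -
  obtain n A es where T: "T = App (Inl (n, A)) es" and "spine X \<Gamma> n A es"
    using assms(1) by (auto simp: ty_ok_def)
  then have "spine X \<Gamma>' n A (map (subst \<theta>) es)" using spine_subst[OF _ assms(2)] by blast
  then show ?thesis by (simp add: T ty_ok_def)
qed

lemma tm_ok_subst:
  assumes "tm_ok X \<Gamma> t T"
    and "\<And>y k B us. (y, App (Inl (k, B)) us) \<in> set \<Gamma> \<Longrightarrow> arg_ok X \<Gamma>' k B (map (subst \<theta>) us) (\<theta> y)"
  shows "tm_ok X \<Gamma>' (subst \<theta> t) (subst \<theta> T)"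
proof -
  obtain n A es where T: "T = App (Inl (n, A)) es" and "spine X \<Gamma> n A es" "arg_ok X \<Gamma> n A es t"
    using assms(1) by (auto simp: tm_ok_def)
  then have "spine X \<Gamma>' n A (map (subst \<theta>) es)" "arg_ok X \<Gamma>' n A (map (subst \<theta>) es) (subst \<theta> t)"
    using spine_subst[OF _ assms(2)] arg_ok_subst[OF _ assms(2)] by blast+
  then show ?thesis by (simp add: T tm_ok_def)
qed

lemma arg_ok_mono: "arg_ok X \<Gamma> n A es t \<Longrightarrow> set \<Gamma> \<subseteq> set \<Gamma>' \<Longrightarrow> arg_ok X \<Gamma>' n A es t"
  by (auto simp: arg_ok_def)

lemma spine_mono: "spine X \<Gamma> n A es \<Longrightarrow> set \<Gamma> \<subseteq> set \<Gamma>' \<Longrightarrow> spine X \<Gamma>' n A es"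
  by (induction rule: spine.induct) (auto intro: spine.intros arg_ok_mono)

lemma ty_ok_mono: "ty_ok X \<Gamma> T \<Longrightarrow> set \<Gamma> \<subseteq> set \<Gamma>' \<Longrightarrow> ty_ok X \<Gamma>' T"
  by (auto simp: ty_ok_def intro: spine_mono)

lemma tm_ok_mono: "tm_ok X \<Gamma> t T \<Longrightarrow> set \<Gamma> \<subseteq> set \<Gamma>' \<Longrightarrow> tm_ok X \<Gamma>' t T"
  by (auto simp: tm_ok_def intro: spine_mono arg_ok_mono)

lemma arg_ok_permute:
  "(y, App (Inl (k, B)) us) \<in> set \<Gamma> \<Longrightarrow>
   arg_ok X (permute_ctx \<sigma> \<Gamma>) k B (map (subst (Var \<circ> \<sigma>)) us) ((Var \<circ> \<sigma>) y)"
  by (force simp: arg_ok_def)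

text \<open>The types in \<open>\<Gamma>\<close> and the type of \<open>y\<close> do not mention \<open>y\<close>, so the substitution changes only \<open>\<Delta>\<close>.\<close>

lemma arg_ok_single:
  assumes ctx: "ctx_all (ty_ok X) (\<Gamma> @ (y, T) # \<Delta>)" and t: "tm_ok X \<Gamma> t T"
    and x: "(x, App (Inl (k, B)) us) \<in> set (\<Gamma> @ (y, T) # \<Delta>)"
  shows "arg_ok X (\<Gamma> @ subst_ctx (single t y) \<Delta>) k B (map (subst (single t y)) us) (single t y x)"
proof -
  have y: "y \<notin> fst ` set \<Gamma>" "y \<notin> fst ` set \<Delta>"
    using ctx_all_distinct[OF ctx] by auto
  have fresh: "map (subst (single t y)) us = us" if "\<Union> (fv ` set us) \<subseteq> fst ` set \<Gamma>"
    using that y by (intro map_idI subst_single_fresh) auto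
  consider "(x, App (Inl (k, B)) us) \<in> set \<Gamma>" | "x = y" "T = App (Inl (k, B)) us"
    | "(x, App (Inl (k, B)) us) \<in> set \<Delta>"
    using x by auto
  then show ?thesis
  proof cases
    case 1
    obtain \<Gamma>1 \<Gamma>2 where "\<Gamma> = \<Gamma>1 @ (x, App (Inl (k, B)) us) # \<Gamma>2" "ty_ok X \<Gamma>1 (App (Inl (k, B)) us)"
      using ctx_all_mem[OF ctx_all_prefix[OF ctx] 1] by blast
    then have "\<Union> (fv ` set us) \<subseteq> fst ` set \<Gamma>" using ty_ok_fv[of X \<Gamma>1 "App (Inl (k, B)) us"] by auto
    moreover have "single t y x = Var x" using y in_fst[OF 1] by (auto simp: single_def)
    ultimately show ?thesis using 1 by (simp add: fresh arg_ok_def)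
  next
    case 2
    then have "\<Union> (fv ` set us) \<subseteq> fst ` set \<Gamma>" "arg_ok X \<Gamma> k B us t"
      using t by (auto simp: tm_ok_def dest!: spine_fv)
    moreover have "single t y x = t" using 2 by (simp add: single_def)
    ultimately show ?thesis by (auto simp: fresh intro: arg_ok_mono)
  next
    case 3
    then have "single t y x = Var x" using y in_fst[OF 3] by (auto simp: single_def)
    moreover have "(x, subst (single t y) (App (Inl (k, B)) us)) \<in> set (subst_ctx (single t y) \<Delta>)"
      using imageI[OF 3, of "\<lambda>(x, T). (x, subst (single t y) T)"] by (simp add: subst_ctx_def)
    ultimately show ?thesis by (simp add: arg_ok_def)
  qed
qed

lemma tts_ty_bd: "is_tts X \<Longrightarrow> n \<ge> 1 \<Longrightarrow> A \<in> ty X (Suc n) \<Longrightarrow> ty_bd X n A \<in> ty X n"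
  by (simp add: is_tts_def image_subset_iff)

lemma tts_tm_bd: "is_tts X \<Longrightarrow> n \<ge> 1 \<Longrightarrow> a \<in> tm X n \<Longrightarrow> tm_bd X n a \<in> ty X n"
  by (simp add: is_tts_def image_subset_iff)

lemma bd_iter_shift: "bd_iter X (Suc n) (Suc k) A = bd_iter X n k (ty_bd X n A)"
  by (induction k) auto

lemma elem_ctx_1 [simp]: "elem_ctx X (Suc 0) A = []"
  by (simp add: elem_ctx_def)

text \<open>The context of the basic judgement of \<open>A\<close> extends that of \<open>\<partial>A\<close>, which makes induction along the
boundary possible.\<close>

lemma elem_ctx_Suc:
  assumes "n \<ge> 1"
  shows "elem_ctx X (Suc n) A = elem_ctx X n (ty_bd X n A) @ [(n, ty_elem_expr n (ty_bd X n A))]"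
proof -
  have "bd_iter X (Suc n) (Suc n - i) A = bd_iter X n (n - i) (ty_bd X n A)" if "i < n" for i
    using that bd_iter_shift[of X n "n - i" A] by (simp add: Suc_diff_le)
  then show ?thesis using assms bd_iter_shift[of X n 0 A] by (simp add: elem_ctx_def)
qed

lemma map_fst_elem_ctx [simp]: "map fst (elem_ctx X n A) = [1..<n]"
  by (simp add: elem_ctx_def o_def)

lemma fst_set_elem_ctx [simp]: "fst ` set (elem_ctx X n A) = {1..<n}"
  by (metis list.set_map map_fst_elem_ctx set_upt)

lemma length_elem_ctx [simp]: "length (elem_ctx X n A) = n - 1"
  by (simp add: elem_ctx_def)

lemma spine_elem_ctx:
  assumes "is_tts X" "n \<ge> 1" "A \<in> ty X n"
  shows "spine X (elem_ctx X n A) n A (map Var [1..<n])"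
  using assms(2,3)
proof (induction n arbitrary: A rule: nat_induct_at_least)
  case base
  then show ?case by (auto intro: spine.nil)
next
  case (Suc n)
  have "spine X (elem_ctx X n (ty_bd X n A)) n (ty_bd X n A) (map Var [1..<n])"
    using Suc.IH tts_ty_bd[OF assms(1) Suc.hyps Suc.prems] .
  then have "spine X (elem_ctx X (Suc n) A) n (ty_bd X n A) (map Var [1..<n])"
    by (rule spine_mono) (simp add: elem_ctx_Suc[OF Suc.hyps] subset_iff)
  moreover have "arg_ok X (elem_ctx X (Suc n) A) n (ty_bd X n A) (map Var [1..<n]) (Var n)"
    by (simp add: arg_ok_def elem_ctx_Suc[OF Suc.hyps] ty_elem_expr_def)
  ultimately show ?case
    using spine.snoc[OF _ Suc.prems refl] Suc.hyps by simp
qed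

lemma boundary_ty_basic:
  "n \<ge> 1 \<Longrightarrow> boundary (ty_basic X (Suc n) A) = [ty_basic X n (ty_bd X n A)]"
  by (simp add: ty_basic_def elem_ctx_Suc)

lemma boundary_ty_basic_1: "boundary (ty_basic X (Suc 0) A) = []"
  by (simp add: ty_basic_def)

lemma boundary_tm_basic: "boundary (tm_basic X n a) = [ty_basic X n (tm_bd X n a)]"
  by (simp add: ty_basic_def tm_basic_def)

lemma ty_basic_derived:
  assumes "is_tts X" "n \<ge> 1" "A \<in> ty X n"
  shows "ty_basic X n A \<in> der D X"
  using assms(2,3)
proof (induction n arbitrary: A rule: nat_induct_at_least)
  case base
  then have "ty_basic X 1 A \<in> basics (free_gat X)" by (auto simp: free_gat_def)
  then show ?case by (rule derived.basic) (simp add: boundary_ty_basic_1)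
next
  case (Suc n)
  show ?case
  proof (rule derived.basic)
    show "ty_basic X (Suc n) A \<in> basics (free_gat X)"
      using Suc by (auto simp: free_gat_def)
    show "B \<in> der D X" if "B \<in> set (boundary (ty_basic X (Suc n) A))" for B
      using that Suc.IH[OF tts_ty_bd[OF assms(1) Suc.hyps Suc.prems]] Suc.hyps
      by (simp add: boundary_ty_basic)
  qed
qed

lemma tm_basic_derived:
  assumes "is_tts X" "n \<ge> 1" "a \<in> tm X n"
  shows "tm_basic X n a \<in> der D X"
proof (rule derived.basic)
  show "tm_basic X n a \<in> basics (free_gat X)"
    using assms by (auto simp: free_gat_def)
  show "B \<in> der D X" if "B \<in> set (boundary (tm_basic X n a))" for B
    using that ty_basic_derived[OF assms(1,2) tts_tm_bd[OF assms]] by (simp add: boundary_tm_basic)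
qed

text \<open>Derivability of the boundaries is part of the invariant, so that one induction gives both the
normal form of derived judgements and their closure under boundaries.\<close>

definition judg_ok :: "structural set \<Rightarrow> ('a, 'b) tts \<Rightarrow> ('a, 'b) elem_sym judgement \<Rightarrow> bool" where
  "judg_ok D X J \<longleftrightarrow>
     ok_ctx D X (fst J) \<and>
     (\<forall>T. snd J = IsTy T \<longrightarrow> ty_ok X (fst J) T) \<and>
     (\<forall>t T. snd J = HasTy t T \<longrightarrow> tm_ok X (fst J) t T \<and> (fst J, IsTy T) \<in> der D X)"

lemma derived_ok_lhs:
  assumes "is_tts X" and WP: "gat_rules D" and "J \<in> der D X"
  shows "trivial_eq (snd J) \<and> (fst J, lhs_typing (snd J)) \<in> der D X \<and> judg_ok D X (fst J, lhs_typing (snd J))"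
  using assms(3)
proof (rule free_derived_induct)
  fix n A
  assume n: "n \<ge> 1" "A \<in> ty X n" and
    IH: "\<And>B. B \<in> set (boundary (ty_basic X n A)) \<Longrightarrow> judg_ok D X B \<and> B \<in> der D X"
  have "ok_ctx D X (elem_ctx X n A)"
  proof (cases "n = 1")
    case False
    then obtain m where m: "n = Suc m" "m \<ge> 1" using n by (cases n) auto
    then have "judg_ok D X (ty_basic X m (ty_bd X m A))" "ty_basic X m (ty_bd X m A) \<in> der D X"
      using IH by (simp_all add: boundary_ty_basic)
    then show ?thesis using m by (auto simp: judg_ok_def ty_basic_def elem_ctx_Suc)
  qed simp
  then show "judg_ok D X (ty_basic X n A)"
    using spine_elem_ctx[OF assms(1) n]
    by (auto simp: judg_ok_def ty_basic_def ty_elem_expr_def ty_ok_def)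
next
  fix n a
  assume n: "n \<ge> 1" "a \<in> tm X n" and
    IH: "\<And>B. B \<in> set (boundary (tm_basic X n a)) \<Longrightarrow> judg_ok D X B \<and> B \<in> der D X"
  then have B: "judg_ok D X (ty_basic X n (tm_bd X n a))" "ty_basic X n (tm_bd X n a) \<in> der D X"
    by (simp_all add: boundary_tm_basic)
  have "tm_ok X (elem_ctx X n (tm_bd X n a)) (tm_elem_expr n a) (ty_elem_expr n (tm_bd X n a))"
    using spine_elem_ctx[OF assms(1) n(1) tts_tm_bd[OF assms(1) n]] n
    by (simp add: tm_ok_def ty_elem_expr_def tm_elem_expr_def arg_ok_def)
  then show "judg_ok D X (tm_basic X n a)"
    using B by (simp add: judg_ok_def ty_basic_def tm_basic_def)
next
  fix \<sigma> :: "var \<Rightarrow> var" and \<Gamma> and R :: "('a, 'b) elem_sym expr rhs"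
  let ?p = "permute_ctx \<sigma>"
  assume \<sigma>: "bij \<sigma>" and R: "typing R" "(\<Gamma>, R) \<in> der D X" "judg_ok D X (\<Gamma>, R)"
  have ty: "ty_ok X (?p \<Delta>) (subst (Var \<circ> \<sigma>) T)" if "ty_ok X \<Delta> T" for \<Delta> T
    by (rule ty_ok_subst[OF that arg_ok_permute])
  have tm: "tm_ok X (?p \<Delta>) (subst (Var \<circ> \<sigma>) t) (subst (Var \<circ> \<sigma>) T)" if "tm_ok X \<Delta> t T" for \<Delta> t T
    by (rule tm_ok_subst[OF that arg_ok_permute])
  have der: "(?p \<Delta>, IsTy (subst (Var \<circ> \<sigma>) T)) \<in> der D X" if "(\<Delta>, IsTy T) \<in> der D X" for \<Delta> T
    using derived_perm[OF that \<sigma>] by (simp add: permute_pair)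
  have "ok_ctx D X (?p \<Gamma>)"
    using R(3) \<sigma> ty der by (intro ctx_all_permute) (auto simp: judg_ok_def)
  then show "judg_ok D X (permute \<sigma> (\<Gamma>, R))"
    using R(1,3) ty tm der by (auto simp: judg_ok_def permute_pair typing_def)
next
  fix y \<Gamma> \<Delta> T and R :: "('a, 'b) elem_sym expr rhs"
  assume W: "W \<in> D" and y: "y \<notin> fv_ctx \<Gamma> \<union> fv_ctx \<Delta>" and "typing R"
    and T: "(\<Gamma>, IsTy T) \<in> der D X" "judg_ok D X (\<Gamma>, IsTy T)"
    and R: "(\<Gamma> @ \<Delta>, R) \<in> der D X" "judg_ok D X (\<Gamma> @ \<Delta>, R)"
  have "ok_ctx D X (\<Gamma> @ (y, T) # \<Delta>)"
  proof (rule ctx_all_weaken[OF _ _ y])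
    show "ty_ok X (\<Gamma> @ (y, T) # \<Delta>') U \<and> (\<Gamma> @ (y, T) # \<Delta>', IsTy U) \<in> der D X"
      if "y \<notin> fv_ctx \<Delta>'" "ty_ok X (\<Gamma> @ \<Delta>') U \<and> (\<Gamma> @ \<Delta>', IsTy U) \<in> der D X" for \<Delta>' U
      using that y derived_weaken[OF W _ T(1)] by (auto intro: ty_ok_mono)
  qed (use T R in \<open>simp_all add: judg_ok_def\<close>)
  then show "judg_ok D X (\<Gamma> @ (y, T) # \<Delta>, R)"
    using R T derived_weaken[OF W y T(1)] by (auto simp: judg_ok_def intro: ty_ok_mono tm_ok_mono)
next
  fix y \<Gamma> T
  assume D: "P \<in> D" and y: "y \<notin> fv_ctx \<Gamma>" and T: "(\<Gamma>, IsTy T) \<in> der D X" "judg_ok D X (\<Gamma>, IsTy T)"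
  have y': "y \<notin> fst ` set \<Gamma>" using y by (auto simp: fv_ctx_def)
  \<comment> \<open>the boundary of a projection is a weakening\<close>
  have "(\<Gamma> @ [(y, T)], IsTy T) \<in> der D X"
    using derived_weaken[of D y \<Gamma> "[]" T] T D WP y by (simp add: fv_ctx_def)
  moreover have "ty_ok X (\<Gamma> @ [(y, T)]) T" using T(2) by (auto simp: judg_ok_def intro: ty_ok_mono)
  then have "tm_ok X (\<Gamma> @ [(y, T)]) (Var y) T" by (auto simp: tm_ok_def ty_ok_def arg_ok_def)
  ultimately show "judg_ok D X (\<Gamma> @ [(y, T)], HasTy (Var y) T)"
    using T y' by (simp add: judg_ok_def)
next
  fix y \<Gamma> \<Delta> t T and R :: "('a, 'b) elem_sym expr rhs"
  assume S: "S \<in> D" and "typing R"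
    and t: "(\<Gamma>, HasTy t T) \<in> der D X" "judg_ok D X (\<Gamma>, HasTy t T)"
    and R: "(\<Gamma> @ (y, T) # \<Delta>, R) \<in> der D X" "judg_ok D X (\<Gamma> @ (y, T) # \<Delta>, R)"
  let ?s = "single t y"
  have tT: "tm_ok X \<Gamma> t T" using t(2) by (simp add: judg_ok_def)
  have ctx: "ok_ctx D X (\<Gamma> @ (y, T) # \<Delta>)"
    using R(2) by (simp add: judg_ok_def)
  have arg: "arg_ok X (\<Gamma> @ subst_ctx ?s \<Delta>') k B (map (subst ?s) us) (?s x)"
    if "ok_ctx D X (\<Gamma> @ (y, T) # \<Delta>')"
      "(x, App (Inl (k, B)) us) \<in> set (\<Gamma> @ (y, T) # \<Delta>')" for \<Delta>' k B us x
    using arg_ok_single[OF ctx_all_mono[OF that(1)] tT that(2)] by blast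
  have der: "(\<Gamma> @ subst_ctx ?s \<Delta>', IsTy (subst ?s U)) \<in> der D X"
    if "(\<Gamma> @ (y, T) # \<Delta>', IsTy U) \<in> der D X" for \<Delta>' U
    using derived_subst[OF S t(1) that] by simp
  have "ok_ctx D X (\<Gamma> @ subst_ctx ?s \<Delta>)"
    by (rule ctx_all_subst[OF ctx]) (use ty_ok_subst[OF _ arg] der in blast)
  moreover have "ty_ok X (\<Gamma> @ subst_ctx ?s \<Delta>) (subst ?s U)" if "ty_ok X (\<Gamma> @ (y, T) # \<Delta>) U" for U
    by (rule ty_ok_subst[OF that arg[OF ctx]])
  moreover have "tm_ok X (\<Gamma> @ subst_ctx ?s \<Delta>) (subst ?s u) (subst ?s U)"
    if "tm_ok X (\<Gamma> @ (y, T) # \<Delta>) u U" for u U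
    by (rule tm_ok_subst[OF that arg[OF ctx]])
  ultimately show "judg_ok D X (\<Gamma> @ subst_ctx ?s \<Delta>, map_rhs (subst ?s) R)"
    using R(2) \<open>typing R\<close> der by (auto simp: judg_ok_def typing_def)
qed

lemma derived_ok:
  assumes "is_tts X" "gat_rules D" "J \<in> der D X" "typing (snd J)"
  shows "judg_ok D X J"
  using derived_ok_lhs[OF assms(1-3)] assms(4) by simp

lemma derived_IsTy_ok:
  assumes "is_tts X" "gat_rules D" "(\<Gamma>, IsTy T) \<in> der D X"
  shows "ty_ok X \<Gamma> T"
  using derived_ok[OF assms] by (simp add: judg_ok_def)

lemma derived_TyEq:
  assumes "is_tts X" "gat_rules D" "(\<Gamma>, TyEq T T') \<in> der D X"
  shows "T = T'"
  using derived_ok_lhs[OF assms] by simp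

lemma derived_TmEq:
  assumes "is_tts X" "gat_rules D" "(\<Gamma>, TmEq t t' T) \<in> der D X"
  shows "t = t'"
  using derived_ok_lhs[OF assms] by simp

lemma derived_HasTy:
  assumes "is_tts X" "gat_rules D" "(\<Gamma>, HasTy t T) \<in> der D X"
  shows "(\<Gamma>, IsTy T) \<in> der D X"
  using derived_ok[OF assms] by (simp add: judg_ok_def)

lemma derived_ctx_all:
  assumes "is_tts X" "gat_rules D" "J \<in> der D X" "typing (snd J)"
  shows "ok_ctx D X (fst J)"
  using derived_ok[OF assms] by (simp add: judg_ok_def)

lemma derived_ctx_ok:
  assumes "is_tts X" "gat_rules D" "J \<in> der D X" "typing (snd J)"
  shows "ctx_all (ty_ok X) (fst J)"
  by (rule ctx_all_mono[OF derived_ctx_all[OF assms]]) blast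

lemma derived_ctx_derived:
  assumes "is_tts X" "gat_rules D" "J \<in> der D X" "typing (snd J)"
  shows "derived_ctx D X (fst J)"
  by (rule ctx_all_mono[OF derived_ctx_all[OF assms]]) blast

lemma derived_IsTy_fv:
  assumes "is_tts X" "gat_rules D" "(\<Gamma>, IsTy T) \<in> der D X"
  shows "fv T \<subseteq> fst ` set \<Gamma>"
  using derived_ok[OF assms] ty_ok_fv[of X \<Gamma> T] by (simp add: judg_ok_def)

lemma derived_HasTy_fv:
  assumes "is_tts X" "gat_rules D" "(\<Gamma>, HasTy t T) \<in> der D X"
  shows "fv t \<subseteq> fst ` set \<Gamma>" "fv T \<subseteq> fst ` set \<Gamma>"
  using derived_ok[OF assms] derived_IsTy_fv[OF assms(1,2) derived_HasTy[OF assms]]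
    tm_ok_fv[of X \<Gamma> t T]
  by (simp_all add: judg_ok_def)

lemma derived_nth:
  assumes "is_tts X" "gat_rules D" "(\<Gamma>, IsTy U) \<in> der D X" "i \<le> length \<Gamma>"
  shows "(take i \<Gamma>, IsTy ((map snd \<Gamma> @ [U]) ! i)) \<in> der D X"
proof (cases "i = length \<Gamma>")
  case False
  then have "i < length \<Gamma>" using assms(4) by simp
  then have "\<Gamma> = take i \<Gamma> @ (fst (\<Gamma> ! i), snd (\<Gamma> ! i)) # drop (Suc i) \<Gamma>"
    by (simp add: id_take_nth_drop)
  then show ?thesis
    using derived_ctx_all[OF assms(1-3)] \<open>i < length \<Gamma>\<close>
    unfolding ctx_all_def by (auto simp: nth_append simp del: prod.collapse)
qed (use assms(3) in \<open>simp add: nth_append\<close>)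

section \<open>Equivalence classes as orbits\<close>

lemma map_of_zip_inj:
  "inj \<pi> \<Longrightarrow> x \<in> set xs \<Longrightarrow> map_of (zip (map \<pi> xs) xs) (\<pi> x) = Some x"
  by (induction xs) (auto simp: inj_def)

lemma rename_perm: "inj \<pi> \<Longrightarrow> x \<in> set xs \<Longrightarrow> rename xs (map \<pi> xs) (\<pi> x) = Var x"
  by (simp add: rename_def map_of_zip_inj)

text \<open>Equivalence of judgements is stated with \<open>rename\<close>, which acts only on listed variables; together with
the next lemma this makes it inverse to a bijection on the variables that occur.\<close>

lemma rename_of_permuted:
  assumes "inj \<pi>" "fv T \<subseteq> set xs"
  shows "subst (rename xs (map \<pi> xs)) (subst (Var \<circ> \<pi>) T) = T"
proof -
  have "subst (rename xs (map \<pi> xs)) (subst (Var \<circ> \<pi>) T) = subst Var T"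
    unfolding subst_subst using assms rename_perm by (intro subst_cong) auto
  then show ?thesis by simp
qed

lemma permuted_of_rename:
  assumes "inj \<pi>" "fv T \<subseteq> \<pi> ` set xs"
  shows "subst (Var \<circ> \<pi>) (subst (rename xs (map \<pi> xs)) T) = T"
proof -
  have "subst (Var \<circ> \<pi>) (subst (rename xs (map \<pi> xs)) T) = subst Var T"
    unfolding subst_subst
  proof (rule subst_cong)
    fix z
    assume "z \<in> fv T"
    then obtain x where "x \<in> set xs" "z = \<pi> x" using assms(2) by auto
    then show "subst (Var \<circ> \<pi>) (rename xs (map \<pi> xs) z) = Var z"
      by (simp add: rename_perm[OF assms(1)])
  qed
  then show ?thesis by simp
qed

lemma type_equiv_permute:
  assumes "is_tts X" "gat_rules D" "(\<Gamma>, IsTy U) \<in> der D X" "bij \<pi>"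
    "permute \<pi> (\<Gamma>, IsTy U) = (\<Delta>, IsTy V)"
  shows "type_equiv D (free_gat X) \<Gamma> U \<Delta> V"
  unfolding type_equiv_def
proof (intro conjI allI impI)
  have \<Delta>: "\<Delta> = permute_ctx \<pi> \<Gamma>" and V: "V = subst (Var \<circ> \<pi>) U"
    using assms(5) by (simp_all add: permute_pair)
  show "length \<Gamma> = length \<Delta>" by (simp add: \<Delta>)
  fix i
  assume i: "i \<le> length \<Gamma>"
  let ?T = "(map snd \<Gamma> @ [U]) ! i"
  have der: "(take i \<Gamma>, IsTy ?T) \<in> der D X" by (rule derived_nth[OF assms(1-3) i])
  have "(map snd \<Delta> @ [V]) ! i = subst (Var \<circ> \<pi>) ?T"
    using i by (cases "i = length \<Gamma>") (auto simp: \<Delta> V nth_append case_prod_beta)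
  moreover have "map fst (take i \<Delta>) = map \<pi> (map fst (take i \<Gamma>))"
    by (auto simp: \<Delta> take_map)
  moreover have "fv ?T \<subseteq> set (map fst (take i \<Gamma>))"
    using derived_IsTy_fv[OF assms(1,2) der] by simp
  ultimately have "subst (rename (map fst (take i \<Gamma>)) (map fst (take i \<Delta>))) ((map snd \<Delta> @ [V]) ! i) = ?T"
    using rename_of_permuted[OF bij_is_inj[OF assms(4)], of ?T "map fst (take i \<Gamma>)"] by metis
  then show "(take i \<Gamma>, TyEq ?T (subst (rename (map fst (take i \<Gamma>)) (map fst (take i \<Delta>)))
      ((map snd \<Delta> @ [V]) ! i))) \<in> der D X"
    using derived_tyrefl[OF der] by metis
qed

lemma permute_type_equiv:
  assumes "is_tts X" "gat_rules D" "(\<Gamma>, IsTy U) \<in> der D X" "(\<Delta>, IsTy V) \<in> der D X"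
    "type_equiv D (free_gat X) \<Gamma> U \<Delta> V"
  shows "\<exists>\<pi>. bij \<pi> \<and> map fst \<Delta> = map \<pi> (map fst \<Gamma>) \<and> permute \<pi> (\<Gamma>, IsTy U) = (\<Delta>, IsTy V)"
proof -
  have len: "length \<Gamma> = length \<Delta>" using assms(5) by (simp add: type_equiv_def)
  have "distinct (map fst \<Gamma>)" "distinct (map fst \<Delta>)"
    using derived_ctx_all[OF assms(1-3)] derived_ctx_all[OF assms(1,2,4)] ctx_all_distinct by auto
  then obtain \<pi> where \<pi>: "bij \<pi>" "map \<pi> (map fst \<Gamma>) = map fst \<Delta>"
    using bij_extending[of "map fst \<Gamma>" "map fst \<Delta>"] len by auto
  have key: "subst (Var \<circ> \<pi>) ((map snd \<Gamma> @ [U]) ! i) = (map snd \<Delta> @ [V]) ! i" if i: "i \<le> length \<Gamma>" for i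
  proof -
    let ?T = "(map snd \<Gamma> @ [U]) ! i" and ?T' = "(map snd \<Delta> @ [V]) ! i"
    have fst: "map fst (take i \<Delta>) = map \<pi> (map fst (take i \<Gamma>))"
      using \<pi>(2) by (metis take_map)
    have "(take i \<Gamma>, TyEq ?T (subst (rename (map fst (take i \<Gamma>)) (map fst (take i \<Delta>))) ?T')) \<in> der D X"
      using assms(5) i by (simp add: type_equiv_def)
    then have T: "?T = subst (rename (map fst (take i \<Gamma>)) (map fst (take i \<Delta>))) ?T'"
      by (rule derived_TyEq[OF assms(1,2)])
    have "fv ?T' \<subseteq> fst ` set (take i \<Delta>)"
      using derived_IsTy_fv[OF assms(1,2) derived_nth[OF assms(1,2,4)]] i len by simp
    also have "\<dots> = \<pi> ` set (map fst (take i \<Gamma>))"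
      using fst by (metis list.set_map)
    finally show ?thesis
      unfolding T fst by (rule permuted_of_rename[OF bij_is_inj[OF \<pi>(1)]])
  qed
  have "permute_ctx \<pi> \<Gamma> = \<Delta>"
  proof (rule nth_equalityI)
    fix i
    assume "i < length (permute_ctx \<pi> \<Gamma>)"
    then have i: "i < length \<Gamma>" by simp
    have "\<pi> (fst (\<Gamma> ! i)) = fst (\<Delta> ! i)"
      using i len arg_cong[OF \<pi>(2), of "\<lambda>l. l ! i"] by simp
    moreover have "subst (Var \<circ> \<pi>) (snd (\<Gamma> ! i)) = snd (\<Delta> ! i)"
      using i len key[of i] by (simp add: nth_append)
    ultimately show "permute_ctx \<pi> \<Gamma> ! i = \<Delta> ! i"
      using i by (simp add: case_prod_beta prod_eq_iff)
  qed (simp add: len)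
  moreover have "subst (Var \<circ> \<pi>) U = V"
    using key[of "length \<Gamma>"] len by (simp add: nth_append)
  ultimately show ?thesis using \<pi> by (auto simp: permute_pair)
qed

text \<open>As derived equations are identities, equivalent judgements differ by a correspondence between the
variables of their contexts, which extends to a bijection of all variables.  Conversely the identities
that equivalence asks for are instances of reflexivity.\<close>

lemma judg_equiv_iff:
  assumes "is_tts X" "gat_rules D" "J \<in> der D X" "J' \<in> der D X" "typing (snd J)"
  shows "judg_equiv D (free_gat X) J J' \<longleftrightarrow> J' \<in> orbit J"
proof
  assume eq: "judg_equiv D (free_gat X) J J'"
  from assms(5) show "J' \<in> orbit J"
  proof (cases rule: typingE)
    case (ty \<Gamma> U)
    then obtain \<Delta> V where J': "J' = (\<Delta>, IsTy V)" and "type_equiv D (free_gat X) \<Gamma> U \<Delta> V"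
      using eq by (cases "(D, free_gat X, J, J')" rule: judg_equiv.cases) auto
    obtain \<pi> where "bij \<pi>" "permute \<pi> (\<Gamma>, IsTy U) = (\<Delta>, IsTy V)"
      using permute_type_equiv[OF assms(1,2) _ _ \<open>type_equiv D (free_gat X) \<Gamma> U \<Delta> V\<close>] assms(3,4) ty J'
      by auto
    then show ?thesis unfolding ty J' orbit_def by (auto intro!: exI[of _ \<pi>])
  next
    case (tm \<Gamma> u U)
    then obtain \<Delta> v V where J': "J' = (\<Delta>, HasTy v V)" and te: "type_equiv D (free_gat X) \<Gamma> U \<Delta> V"
      and "(\<Gamma>, TmEq u (subst (rename (map fst \<Gamma>) (map fst \<Delta>)) v) U) \<in> der D X"
      using eq by (cases "(D, free_gat X, J, J')" rule: judg_equiv.cases) auto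
    then have u: "u = subst (rename (map fst \<Gamma>) (map fst \<Delta>)) v"
      using derived_TmEq[OF assms(1,2)] by blast
    have der: "(\<Gamma>, IsTy U) \<in> der D X" "(\<Delta>, IsTy V) \<in> der D X"
      using derived_HasTy[OF assms(1,2)] assms(3,4) tm J' by auto
    obtain \<pi> where \<pi>: "bij \<pi>" "map fst \<Delta> = map \<pi> (map fst \<Gamma>)"
      "permute \<pi> (\<Gamma>, IsTy U) = (\<Delta>, IsTy V)"
      using permute_type_equiv[OF assms(1,2) der te] by blast
    have "fv v \<subseteq> fst ` set \<Delta>" using derived_HasTy_fv[OF assms(1,2)] assms(4) J' by blast
    also have "\<dots> = \<pi> ` set (map fst \<Gamma>)" using \<pi>(2) by (metis list.set_map)
    finally have "subst (Var \<circ> \<pi>) u = v"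
      unfolding u \<pi>(2) by (rule permuted_of_rename[OF bij_is_inj[OF \<pi>(1)]])
    then have "J' = permute \<pi> J" using \<pi>(3) tm J' by (simp add: permute_pair)
    then show ?thesis using \<pi>(1) by (auto simp: orbit_def)
  qed
next
  assume "J' \<in> orbit J"
  then obtain \<pi> where \<pi>: "bij \<pi>" "J' = permute \<pi> J" by (auto simp: orbit_def)
  from assms(5) show "judg_equiv D (free_gat X) J J'"
  proof (cases rule: typingE)
    case (ty \<Gamma> U)
    then show ?thesis
      using type_equiv_permute[OF assms(1,2) _ \<pi>(1)] assms(3) \<pi>(2) by (simp add: permute_pair)
  next
    case (tm \<Gamma> u U)
    have "(\<Gamma>, IsTy U) \<in> der D X" using derived_HasTy[OF assms(1,2)] assms(3) tm by blast
    then have te: "type_equiv D (free_gat X) \<Gamma> U (permute_ctx \<pi> \<Gamma>)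
        (subst (Var \<circ> \<pi>) U)"
      by (rule type_equiv_permute[OF assms(1,2) _ \<pi>(1)]) (simp add: permute_pair)
    have "map fst (permute_ctx \<pi> \<Gamma>) = map \<pi> (map fst \<Gamma>)" by auto
    moreover have "fv u \<subseteq> set (map fst \<Gamma>)"
      using derived_HasTy_fv(1)[OF assms(1,2)] assms(3) tm by fastforce
    ultimately have "subst (rename (map fst \<Gamma>)
        (map fst (permute_ctx \<pi> \<Gamma>))) (subst (Var \<circ> \<pi>) u) = u"
      using rename_of_permuted[OF bij_is_inj[OF \<pi>(1)], of u "map fst \<Gamma>"] by metis
    moreover have "(\<Gamma>, TmEq u u U) \<in> der D X" using assms(3) tm by (auto intro: derived_tmrefl)
    ultimately show ?thesis
      using te unfolding tm \<pi>(2) permute_pair by (simp del: map_map)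
  qed
qed

lemma derived_orbit: "J' \<in> orbit J \<Longrightarrow> J \<in> derived D \<T> \<Longrightarrow> J' \<in> derived D \<T>"
  by (auto simp: orbit_def intro: derived_perm)

lemma judg_class_eq_orbit:
  assumes "is_tts X" "gat_rules D" "J \<in> der D X" "typing (snd J)"
  shows "judg_class D (free_gat X) J = orbit J"
proof -
  have "J' \<in> der D X \<and> judg_equiv D (free_gat X) J J' \<longleftrightarrow> J' \<in> orbit J" for J'
    using judg_equiv_iff[OF assms(1-3) _ assms(4)] derived_orbit[of J' J D "free_gat X"] assms(3) by blast
  then show ?thesis using assms(3) unfolding judg_rel_def by blast
qed

text \<open>Evaluates the unions over representatives by which operations on classes are defined.\<close>

lemma UN_orbit:
  assumes "\<And>\<pi>. bij \<pi> \<Longrightarrow> F (permute \<pi> J) = c"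
  shows "(\<Union>J'\<in>orbit J. F J') = c"
  using assms orbit_self[of J] by (fastforce simp: orbit_def)

lemma typing_orbit: "J' \<in> orbit J \<Longrightarrow> typing (snd J') = typing (snd J)"
  by (auto simp: orbit_def permute_def)

abbreviation free_tts ::
  "structural set \<Rightarrow> ('a, 'b) tts \<Rightarrow> (('a, 'b) free_elem, ('a, 'b) free_elem) tts" where
  "free_tts D X \<equiv> forget D (free_gat X)"

lemma free_tts_ty:
  assumes "is_tts X" "gat_rules D"
  shows "c \<in> ty (free_tts D X) n \<longleftrightarrow>
    (\<exists>J\<in>der D X. is_type J \<and> degree J = n \<and> c = orbit J)"
  using judg_class_eq_orbit[OF assms] by (auto simp: forget_def quotient_def typing_iff)

lemma free_tts_tm:
  assumes "is_tts X" "gat_rules D"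
  shows "c \<in> tm (free_tts D X) n \<longleftrightarrow>
    (\<exists>J\<in>der D X. is_term J \<and> degree J = n \<and> c = orbit J)"
  using judg_class_eq_orbit[OF assms] by (auto simp: forget_def quotient_def typing_iff)

lemma free_tts_tyI:
  assumes "is_tts X" "gat_rules D" "J \<in> der D X" "is_type J" "degree J = n"
  shows "orbit J \<in> ty (free_tts D X) n"
  unfolding free_tts_ty[OF assms(1,2)] using assms(3-5) by (intro bexI[of _ J]) simp_all

lemma free_tts_tmI:
  assumes "is_tts X" "gat_rules D" "J \<in> der D X" "is_term J" "degree J = n"
  shows "orbit J \<in> tm (free_tts D X) n"
  unfolding free_tts_tm[OF assms(1,2)] using assms(3-5) by (intro bexI[of _ J]) simp_all

lemma boundary_derived:
  assumes "is_tts X" "gat_rules D" "J \<in> der D X" "typing (snd J)" "B \<in> set (boundary J)"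
  shows "B \<in> der D X \<and> is_type B"
proof (cases J rule: boundary.cases)
  case (1 \<Gamma> T)
  then have B: "\<Gamma> \<noteq> []" "B = (butlast \<Gamma>, IsTy (snd (last \<Gamma>)))"
    using assms(5) by (auto split: if_splits)
  then obtain \<Gamma>' x U where \<Gamma>: "\<Gamma> = \<Gamma>' @ [(x, U)]" by (cases \<Gamma> rule: rev_cases) auto
  then have "(butlast \<Gamma>, IsTy (snd (last \<Gamma>))) \<in> der D X"
    using derived_ctx_all[OF assms(1-4)] 1 by simp
  then show ?thesis by (simp add: B)
next
  case (2 \<Gamma> t T)
  then show ?thesis using derived_HasTy[OF assms(1,2), of \<Gamma> t T] assms(3,5) by simp
qed (use assms(4) in simp_all)

lemma boundary_nonempty: "is_type J \<Longrightarrow> degree J = Suc n \<Longrightarrow> n \<ge> 1 \<Longrightarrow> boundary J \<noteq> []"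
  "is_term J \<Longrightarrow> boundary J \<noteq> []"
  by (cases J rule: is_type.cases; auto simp: degree_def)+

lemma hd_boundary_props:
  assumes "is_tts X" "gat_rules D" "J \<in> der D X" "typing (snd J)" "boundary J \<noteq> []"
  shows "hd (boundary J) \<in> der D X" "is_type (hd (boundary J))"
    "is_type J \<Longrightarrow> degree (hd (boundary J)) = degree J - 1"
    "is_term J \<Longrightarrow> degree (hd (boundary J)) = degree J"
proof -
  show "hd (boundary J) \<in> der D X" "is_type (hd (boundary J))"
    using boundary_derived[OF assms(1-4)] assms(5) by simp_all
  show "is_type J \<Longrightarrow> degree (hd (boundary J)) = degree J - 1"
    "is_term J \<Longrightarrow> degree (hd (boundary J)) = degree J"
    using assms(5) by (cases J rule: boundary.cases; simp add: degree_def split: if_splits)+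
qed

lemma class_hd_boundary:
  assumes "is_tts X" "gat_rules D" "J \<in> der D X" "typing (snd J)" "boundary J \<noteq> []"
  shows "(\<Union>J'\<in>orbit J. judg_class D (free_gat X) (hd (boundary J'))) = orbit (hd (boundary J))"
proof (rule UN_orbit)
  fix \<pi> :: "var \<Rightarrow> var"
  assume "bij \<pi>"
  have hd: "hd (boundary (permute \<pi> J)) = permute \<pi> (hd (boundary J))"
    using assms(5) by (simp add: boundary_permute hd_map)
  have "judg_class D (free_gat X) (permute \<pi> (hd (boundary J))) = orbit (permute \<pi> (hd (boundary J)))"
    using hd_boundary_props[OF assms] derived_perm[OF _ \<open>bij \<pi>\<close>]
    by (intro judg_class_eq_orbit[OF assms(1,2)]) (simp_all add: typing_iff)
  then show "judg_class D (free_gat X) (hd (boundary (permute \<pi> J))) = orbit (hd (boundary J))"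
    by (simp add: hd orbit_permute[OF \<open>bij \<pi>\<close>])
qed

lemma free_tts_ty_bd:
  assumes "is_tts X" "gat_rules D" "J \<in> der D X" "is_type J" "degree J = Suc n" "n \<ge> 1"
  shows "ty_bd (free_tts D X) n (orbit J) = orbit (hd (boundary J))"
  using class_hd_boundary[OF assms(1-3)] boundary_nonempty(1)[OF assms(4-6)] assms(4)
  by (simp add: forget_def typing_iff)

lemma free_tts_tm_bd:
  assumes "is_tts X" "gat_rules D" "J \<in> der D X" "is_term J"
  shows "tm_bd (free_tts D X) n (orbit J) = orbit (hd (boundary J))"
  using class_hd_boundary[OF assms(1-3)] boundary_nonempty(2)[OF assms(4)] assms(4)
  by (simp add: forget_def typing_iff)

lemma free_tts_is_tts:
  assumes "is_tts X" "gat_rules D"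
  shows "is_tts (free_tts D X)"
  unfolding is_tts_def
proof (intro allI impI conjI subsetI)
  fix n :: nat and c
  assume n: "n \<ge> 1" and "c \<in> ty_bd (free_tts D X) n ` ty (free_tts D X) (Suc n)"
  then obtain J where J: "J \<in> der D X" "is_type J" "degree J = Suc n"
    and c: "c = ty_bd (free_tts D X) n (orbit J)"
    using free_tts_ty[OF assms] by auto
  show "c \<in> ty (free_tts D X) n"
    using hd_boundary_props[OF assms J(1) _ boundary_nonempty(1)[OF J(2,3) n]] J
    by (auto simp: c free_tts_ty_bd[OF assms J n] free_tts_ty[OF assms] typing_iff)
next
  fix n :: nat and c
  assume n: "n \<ge> 1" and "c \<in> tm_bd (free_tts D X) n ` tm (free_tts D X) n"
  then obtain J where J: "J \<in> der D X" "is_term J" "degree J = n"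
    and c: "c = tm_bd (free_tts D X) n (orbit J)"
    using free_tts_tm[OF assms] by auto
  show "c \<in> ty (free_tts D X) n"
    using hd_boundary_props[OF assms J(1) _ boundary_nonempty(2)[OF J(2)]] J
    by (auto simp: c free_tts_tm_bd[OF assms J(1,2)] free_tts_ty[OF assms] typing_iff)
qed

lemma fv_judgement:
  assumes "is_tts X" "gat_rules D" "J \<in> der D X" "typing (snd J)"
  shows "e \<in> snd ` set (fst J) \<union> exprs (snd J) \<Longrightarrow> fv e \<subseteq> fst ` set (fst J)"
proof -
  assume e: "e \<in> snd ` set (fst J) \<union> exprs (snd J)"
  show ?thesis
  proof (cases "e \<in> exprs (snd J)")
    case True
    from assms(4) show ?thesis
    proof (cases rule: typingE)
      case (ty \<Gamma> U)
      then show ?thesis using True derived_IsTy_fv[OF assms(1,2)] assms(3) by simp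
    next
      case (tm \<Gamma> u U)
      then show ?thesis using True derived_HasTy_fv[OF assms(1,2), of \<Gamma> u U] assms(3) by auto
    qed
  next
    case False
    then obtain x where "(x, e) \<in> set (fst J)" using e by auto
    then obtain \<Gamma>1 \<Gamma>2 where "fst J = \<Gamma>1 @ (x, e) # \<Gamma>2" "ty_ok X \<Gamma>1 e"
      using ctx_all_mem[OF derived_ctx_all[OF assms]] by blast
    then show ?thesis using ty_ok_fv[of X \<Gamma>1 e] by auto
  qed
qed

lemma permute_agree:
  assumes "is_tts X" "gat_rules D" "J \<in> der D X" "typing (snd J)"
    and "\<And>x. x \<in> fst ` set (fst J) \<Longrightarrow> \<pi> x = \<pi>' x"
  shows "permute \<pi> J = permute \<pi>' J"
proof -
  have e: "subst (Var \<circ> \<pi>) e = subst (Var \<circ> \<pi>') e" if "e \<in> snd ` set (fst J) \<union> exprs (snd J)" for e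
    using fv_judgement[OF assms(1-4) that] assms(5) by (intro subst_cong) auto
  have "map_rhs (subst (Var \<circ> \<pi>)) (snd J) = map_rhs (subst (Var \<circ> \<pi>')) (snd J)"
    using e by (intro rhs.map_cong) auto
  moreover have "permute_ctx \<pi> (fst J) =
      map (\<lambda>(x, T). (\<pi>' x, subst (Var \<circ> \<pi>') T)) (fst J)"
  proof (rule map_cong[OF refl])
    fix v
    assume "v \<in> set (fst J)"
    then have "\<pi> (fst v) = \<pi>' (fst v)" "subst (Var \<circ> \<pi>) (snd v) = subst (Var \<circ> \<pi>') (snd v)"
      using assms(5) e by auto
    then show "(case v of (x, T) \<Rightarrow> (\<pi> x, subst (Var \<circ> \<pi>) T)) =
        (case v of (x, T) \<Rightarrow> (\<pi>' x, subst (Var \<circ> \<pi>') T))"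
      by (simp add: case_prod_beta)
  qed
  ultimately show ?thesis by (simp add: permute_def)
qed

text \<open>A renaming that fixes the variables of the context fixes the judgement, because no other variables
occur in a derived judgement.\<close>

lemma canonical_unique:
  assumes "is_tts X" "gat_rules D" "J \<in> der D X" "typing (snd J)"
    and "J' \<in> orbit J" "map fst (fst J') = map fst (fst J)"
  shows "J' = J"
proof -
  obtain \<pi> where \<pi>: "bij \<pi>" "J' = permute \<pi> J" using assms(5) by (auto simp: orbit_def)
  then have "map \<pi> (map fst (fst J)) = map id (map fst (fst J))" using assms(6) by simp
  then have "\<pi> x = id x" if "x \<in> fst ` set (fst J)" for x
    using that unfolding map_eq_conv by auto
  then have "permute \<pi> J = permute id J" by (rule permute_agree[OF assms(1-4)])
  then show ?thesis by (simp add: \<pi>(2) permute_id)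
qed

lemma canonical_exists:
  assumes "is_tts X" "gat_rules D" "J \<in> der D X" "typing (snd J)"
    and "distinct xs" "length xs = length (fst J)"
  shows "\<exists>\<pi>. bij \<pi> \<and> map fst (fst (permute \<pi> J)) = xs"
  using bij_extending[OF ctx_all_distinct[OF derived_ctx_all[OF assms(1-4)]] assms(5)] assms(6) by auto

section \<open>Translations and transposes\<close>

text \<open>The substitution of \<open>es\<close> for the variables \<open>1, 2, \<dots>\<close> of a template.  All other variables go to a closed
expression; so translation commutes with every substitution, whatever the arities, and introduces
no variables.\<close>

definition inst_args :: "'c expr list \<Rightarrow> var \<Rightarrow> 'c expr" where
  "inst_args es i = (if 1 \<le> i \<and> i \<le> length es then es ! (i - 1) else App undefined [])"

text \<open>A constant is replaced by its template, in which the variable \<open>i\<close> stands for the \<open>i\<close>-th argument.\<close>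

primrec translate :: "('c \<Rightarrow> 'd expr) \<Rightarrow> 'c expr \<Rightarrow> 'd expr" where
  "translate \<tau> (Var x) = Var x"
| "translate \<tau> (App c es) = subst (inst_args (map (translate \<tau>) es)) (\<tau> c)"

definition translate_judg :: "('c \<Rightarrow> 'd expr) \<Rightarrow> 'c judgement \<Rightarrow> 'd judgement" where
  "translate_judg \<tau> J = (map (\<lambda>(x, T). (x, translate \<tau> T)) (fst J), map_rhs (translate \<tau>) (snd J))"

lemma subst_inst_args: "subst \<theta> (inst_args es i) = inst_args (map (subst \<theta>) es) i"
  by (cases i) (auto simp: inst_args_def)

lemma fv_inst_args: "fv (inst_args es i) \<subseteq> \<Union> (fv ` set es)"
  by (cases i) (auto simp: inst_args_def intro!: bexI[OF _ nth_mem])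

lemma translate_subst: "translate \<tau> (subst \<theta> e) = subst (\<lambda>x. translate \<tau> (\<theta> x)) (translate \<tau> e)"
proof (induction e)
  case (App c es)
  then have eq: "map (translate \<tau>) (map (subst \<theta>) es) = map (subst (\<lambda>x. translate \<tau> (\<theta> x))) (map (translate \<tau>) es)"
    by simp
  show ?case by (simp only: translate.simps subst.simps subst_subst subst_inst_args eq)
qed simp

lemma fv_translate: "fv (translate \<tau> e) \<subseteq> fv e"
proof (induction e)
  case (App c es)
  have "fv (translate \<tau> (App c es)) \<subseteq> \<Union> (fv ` set (map (translate \<tau>) es))"
    using fv_inst_args[of "map (translate \<tau>) es"] by (auto simp: fv_subst)
  then show ?case using App by fastforce
qed simp

lemma translate_rename: "translate \<tau> (subst (Var \<circ> \<sigma>) e) = subst (Var \<circ> \<sigma>) (translate \<tau> e)"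
  by (simp add: translate_subst o_def)

lemma translate_single: "translate \<tau> (subst (single t y) e) = subst (single (translate \<tau> t) y) (translate \<tau> e)"
  unfolding translate_subst by (intro subst_cong) (simp add: single_def)

lemma translate_judg_pair: "translate_judg \<tau> (\<Gamma>, R) = (map (\<lambda>(x, T). (x, translate \<tau> T)) \<Gamma>, map_rhs (translate \<tau>) R)"
  by (simp add: translate_judg_def)

lemma translate_judg_permute: "translate_judg \<tau> (permute \<sigma> J) = permute \<sigma> (translate_judg \<tau> J)"
  by (cases J) (auto simp: translate_judg_pair permute_pair rhs.map_comp translate_rename simp del: comp_apply
      intro!: rhs.map_cong, simp_all add: translate_rename)

lemma map_fst_translate_judg [simp]: "map fst (fst (translate_judg \<tau> J)) = map fst (fst J)"
  by (auto simp: translate_judg_def)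

lemma boundary_translate_judg: "boundary (translate_judg \<tau> J) = map (translate_judg \<tau>) (boundary J)"
  by (cases J rule: boundary.cases) (auto simp: translate_judg_pair map_butlast last_map case_prod_beta)

lemma is_type_translate_judg [simp]: "is_type (translate_judg \<tau> J) = is_type J"
  by (cases J rule: is_type.cases) (auto simp: translate_judg_pair)

lemma is_term_translate_judg [simp]: "is_term (translate_judg \<tau> J) = is_term J"
  by (cases J rule: is_term.cases) (auto simp: translate_judg_pair)

lemma degree_translate_judg [simp]: "degree (translate_judg \<tau> J) = degree J"
  by (simp add: translate_judg_def degree_def)

lemma typing_translate_judg [simp]: "typing (snd (translate_judg \<tau> J)) = typing (snd J)"
  by (simp add: translate_judg_def)

lemma same_form_translate_judg: "same_form J (translate_judg \<tau> J)"
  by (cases J; cases "snd J") (auto simp: translate_judg_pair)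

lemma fv_ctx_translate: "fv_ctx (map (\<lambda>(x, T). (x, translate \<tau> T)) \<Gamma>) \<subseteq> fv_ctx \<Gamma>"
  using fv_translate by (fastforce simp: fv_ctx_def)

lemma translate_ctx_single:
  "map (\<lambda>(x, T). (x, translate \<tau> T)) (subst_ctx (single t y) \<Delta>) =
   subst_ctx (single (translate \<tau> t) y) (map (\<lambda>(x, T). (x, translate \<tau> T)) \<Delta>)"
  by (simp add: subst_ctx_def translate_single case_prod_beta)

lemma translate_rhs_single:
  "map_rhs (translate \<tau>) (map_rhs (subst (single t y)) R) =
   map_rhs (subst (single (translate \<tau> t) y)) (map_rhs (translate \<tau>) R)"
  by (simp add: rhs.map_comp o_def translate_single)

text \<open>Translation fixes variables and commutes with substitution, hence with each deduction rule.\<close>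

lemma rule_app_translate_judg:
  assumes "rule_app r Js J"
  shows "rule_app r (map (translate_judg \<tau>) Js) (translate_judg \<tau> J)"
  using assms
proof cases
  case (9 \<sigma> J0)
  then show ?thesis using rule_app.intros(9) by (simp add: translate_judg_permute)
next
  case (10 y \<Gamma> \<Delta> T R)
  then show ?thesis
    using rule_app.intros(10)[of y "map (\<lambda>(x, T). (x, translate \<tau> T)) \<Gamma>" "map (\<lambda>(x, T). (x, translate \<tau> T)) \<Delta>"]
      fv_ctx_translate[of \<tau> \<Gamma>] fv_ctx_translate[of \<tau> \<Delta>]
    by (auto simp: translate_judg_pair)
next
  case (11 y \<Gamma> T)
  then show ?thesis
    using rule_app.intros(11)[of y "map (\<lambda>(x, T). (x, translate \<tau> T)) \<Gamma>"] fv_ctx_translate[of \<tau> \<Gamma>]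
    by (auto simp: translate_judg_pair)
next
  case (12 y \<Gamma> t T \<Delta> R)
  then show ?thesis
    using rule_app.intros(12) by (simp add: translate_judg_pair translate_ctx_single translate_rhs_single)
next
  case (13 y \<Gamma> t1 t2 T \<Delta> T')
  then show ?thesis
    using rule_app.intros(13) by (simp add: translate_judg_pair translate_ctx_single translate_single)
next
  case (14 y \<Gamma> t1 t2 T \<Delta> t' T')
  then show ?thesis
    using rule_app.intros(14) by (simp add: translate_judg_pair translate_ctx_single translate_single)
qed (simp_all add: translate_judg_pair rule_app.intros)

lemma rule_app_deterministic:
  assumes "rule_app r Js J" "rule_app r Js J'"
  shows "J = J'"
  using assms by cases (auto elim: rule_app.cases)

lemma translate_judg_derived:
  assumes "\<And>J. J \<in> basics \<T> \<Longrightarrow> translate_judg \<tau> J \<in> derived D \<U>" "J \<in> derived D \<T>"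
  shows "translate_judg \<tau> J \<in> derived D \<U>"
  using assms(2)
proof (induction rule: derived.induct)
  case (basic J)
  then show ?case using assms(1) by blast
next
  case (deduce r Js J)
  show ?case
    by (rule derived.deduce[OF deduce.hyps(1) rule_app_translate_judg[OF deduce.hyps(2)]])
       (use deduce.IH in auto)
qed

lemma bd_iter_in:
  "is_tts X \<Longrightarrow> A \<in> ty X n \<Longrightarrow> k < n \<Longrightarrow> bd_iter X n k A \<in> ty X (n - k)"
proof (induction k)
  case (Suc k)
  then have "bd_iter X n k A \<in> ty X (Suc (n - Suc k))" by (simp add: Suc_diff_Suc)
  then show ?case using Suc.prems tts_ty_bd[of X "n - Suc k"] by simp
qed simp

lemma ty_elem_syms: "syms (ty_elem_expr n A) = {Inl (n, A)}"
  by (auto simp: ty_elem_expr_def)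

lemma tm_elem_syms: "syms (tm_elem_expr n A) = {Inr (n, A)}"
  by (auto simp: tm_elem_expr_def)

lemma map_Var_fst_elem_ctx: "map (Var \<circ> fst) (elem_ctx X n A) = map Var [1..<n]"
  by (simp add: elem_ctx_def)

lemma introduces_ty_basic: "introduces_ty c (ty_basic X n A) \<longleftrightarrow> c = (n, A)"
  by (auto simp: introduces_ty_def ty_basic_def ty_elem_expr_def map_Var_fst_elem_ctx)

lemma introduces_tm_basic: "introduces_tm c (tm_basic X n a) \<longleftrightarrow> c = (n, a)"
  by (auto simp: introduces_tm_def tm_basic_def tm_elem_expr_def map_Var_fst_elem_ctx)

lemma not_introduces: "\<not> introduces_ty c (tm_basic X n a)" "\<not> introduces_tm d (ty_basic X m A)"
  by (auto simp: introduces_ty_def introduces_tm_def ty_basic_def tm_basic_def)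

lemma basics_free:
  "J \<in> basics (free_gat X) \<longleftrightarrow>
   (\<exists>n A. n \<ge> 1 \<and> A \<in> ty X n \<and> J = ty_basic X n A) \<or> (\<exists>n a. n \<ge> 1 \<and> a \<in> tm X n \<and> J = tm_basic X n a)"
  by (auto simp: free_gat_def)

lemma free_gat_dgat:
  assumes "is_tts X" "gat_rules D"
  shows "dgat D (free_gat X)"
proof -
  have ctx: "syms e \<subseteq> ty_consts (free_gat X) <+> tm_consts (free_gat X)"
    if "e \<in> snd ` set (elem_ctx X n A)" "A \<in> ty X n" for e n A
  proof -
    obtain i where i: "1 \<le> i" "i < n" "e = ty_elem_expr i (bd_iter X n (n - i) A)"
      using \<open>e \<in> snd ` set (elem_ctx X n A)\<close> by (auto simp: elem_ctx_def)
    then show ?thesis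
      using bd_iter_in[OF assms(1) \<open>A \<in> ty X n\<close>, of "n - i"] by (simp add: ty_elem_syms free_gat_def InlI)
  qed
  have "judgement_over (ty_consts (free_gat X) <+> tm_consts (free_gat X)) J"
    if "J \<in> basics (free_gat X)" for J
    using that unfolding basics_free
  proof (elim disjE exE conjE)
    fix n A
    assume n: "n \<ge> 1" "A \<in> ty X n" and J: "J = ty_basic X n A"
    show ?thesis
      using ctx[OF _ n(2)] n
      by (auto simp: judgement_over_def J ty_basic_def ty_elem_syms free_gat_def)
  next
    fix n a
    assume n: "n \<ge> 1" "a \<in> tm X n" and J: "J = tm_basic X n a"
    show ?thesis
      using ctx[OF _ tts_tm_bd[OF assms(1) n]] n tts_tm_bd[OF assms(1) n]
      by (auto simp: judgement_over_def J tm_basic_def ty_elem_syms tm_elem_syms free_gat_def)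
  qed
  moreover have "\<exists>!J. J \<in> basics (free_gat X) \<and> introduces_ty c J" if c: "c \<in> ty_consts (free_gat X)" for c
  proof (rule ex1I[of _ "ty_basic X (fst c) (snd c)"])
    show "ty_basic X (fst c) (snd c) \<in> basics (free_gat X) \<and> introduces_ty c (ty_basic X (fst c) (snd c))"
      using c by (auto simp: free_gat_def introduces_ty_basic)
    show "J = ty_basic X (fst c) (snd c)" if "J \<in> basics (free_gat X) \<and> introduces_ty c J" for J
      using that by (auto simp: basics_free introduces_ty_basic not_introduces)
  qed
  moreover have "\<exists>!J. J \<in> basics (free_gat X) \<and> introduces_tm c J" if c: "c \<in> tm_consts (free_gat X)" for c
  proof (rule ex1I[of _ "tm_basic X (fst c) (snd c)"])
    show "tm_basic X (fst c) (snd c) \<in> basics (free_gat X) \<and> introduces_tm c (tm_basic X (fst c) (snd c))"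
      using c by (auto simp: free_gat_def introduces_tm_basic)
    show "J = tm_basic X (fst c) (snd c)" if "J \<in> basics (free_gat X) \<and> introduces_tm c J" for J
      using that by (auto simp: basics_free introduces_tm_basic not_introduces)
  qed
  moreover have "\<exists>A\<in>ty_consts (free_gat X). introduces_ty A J"
    if "J \<in> basics (free_gat X)" "is_type J" for J
    using that unfolding basics_free
    by (auto simp: introduces_ty_basic free_gat_def tm_basic_def)
  moreover have "\<exists>A\<in>tm_consts (free_gat X). introduces_tm A J"
    if "J \<in> basics (free_gat X)" "is_term J" for J
    using that unfolding basics_free
    by (auto simp: introduces_tm_basic free_gat_def ty_basic_def)
  moreover have "J \<in> der D X" if "J \<in> basics (free_gat X)" for J
    using that ty_basic_derived[OF assms(1)] tm_basic_derived[OF assms(1)] unfolding basics_free by blast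
  ultimately show ?thesis using assms(2) unfolding dgat_def by blast
qed

text \<open>The templates are read off from representatives of the values of \<open>f\<close> whose contexts have the
variables \<open>1, \<dots>, n - 1\<close>, as the basic judgements do.\<close>

definition template ::
  "('a, 'b) tts \<Rightarrow> ('a, 'b, ('c, 'd) free_elem, ('c, 'd) free_elem) tts_map \<Rightarrow>
   (('a, 'b) elem_sym \<Rightarrow> ('c, 'd) elem_sym expr) \<Rightarrow> bool" where
  "template X f \<tau> \<longleftrightarrow>
     (\<forall>n\<ge>1. \<forall>A\<in>ty X n. \<exists>\<Gamma>. (\<Gamma>, IsTy (\<tau> (Inl (n, A)))) \<in> on_ty f n A \<and> map fst \<Gamma> = [1..<n]) \<and>
     (\<forall>n\<ge>1. \<forall>a\<in>tm X n. \<exists>\<Gamma> T. (\<Gamma>, HasTy (\<tau> (Inr (n, a))) T) \<in> on_tm f n a \<and> map fst \<Gamma> = [1..<n])"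

lemma subst_inst_args_Var:
  assumes "fv e \<subseteq> {1..<n}"
  shows "subst (inst_args (map Var [1..<n])) e = e"
proof -
  have "subst (inst_args (map Var [1..<n])) e = subst Var e"
  proof (rule subst_cong)
    fix x
    assume "x \<in> fv e"
    then have "1 \<le> x" "x < n" using assms by auto
    then show "inst_args (map Var [1..<n]) x = Var x" by (simp add: inst_args_def)
  qed
  then show ?thesis by simp
qed

lemma translate_ty_elem: "fv (\<tau> (Inl (n, A))) \<subseteq> {1..<n} \<Longrightarrow> translate \<tau> (ty_elem_expr n A) = \<tau> (Inl (n, A))"
  using subst_inst_args_Var[of "\<tau> (Inl (n, A))" n] by (simp add: ty_elem_expr_def o_def)

lemma translate_tm_elem: "fv (\<tau> (Inr (n, a))) \<subseteq> {1..<n} \<Longrightarrow> translate \<tau> (tm_elem_expr n a) = \<tau> (Inr (n, a))"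
  using subst_inst_args_Var[of "\<tau> (Inr (n, a))" n] by (simp add: tm_elem_expr_def o_def)

lemma fst_set_of_map: "map fst \<Gamma> = [1..<n] \<Longrightarrow> fst ` set \<Gamma> = {1..<n}"
  by (metis list.set_map set_upt)

text \<open>By induction along the boundary: the translated context of \<open>\<partial>A\<close> and the context of the chosen
representative of \<open>f A\<close> belong to the same class and have the same variables, so they are equal.\<close>

lemma translate_judg_ty_basic:
  assumes "is_tts Z" "gat_rules D" "is_tts_map X (free_tts D Z) f" "template X f \<tau>"
    and "n \<ge> 1" "A \<in> ty X n"
  shows "translate_judg \<tau> (ty_basic X n A) \<in> on_ty f n A \<and> translate_judg \<tau> (ty_basic X n A) \<in> der D Z \<and>
    on_ty f n A = orbit (translate_judg \<tau> (ty_basic X n A))"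
  using assms(5,6)
proof (induction n arbitrary: A rule: nat_induct_at_least)
  case base
  obtain \<Gamma> where \<Gamma>: "(\<Gamma>, IsTy (\<tau> (Inl (1, A)))) \<in> on_ty f 1 A" "map fst \<Gamma> = [1..<1]"
    using assms(4) base unfolding template_def by blast
  have "on_ty f 1 A \<in> ty (free_tts D Z) 1" using assms(3) base by (simp add: is_tts_map_def)
  then obtain J where J: "J \<in> der D Z" "on_ty f 1 A = orbit J"
    using free_tts_ty[OF assms(1,2)] by blast
  then have der: "([], IsTy (\<tau> (Inl (1, A)))) \<in> der D Z"
    using \<Gamma> derived_orbit by fastforce
  then have "fv (\<tau> (Inl (1, A))) \<subseteq> {1..<1}" using derived_IsTy_fv[OF assms(1,2)] by fastforce
  then have "translate_judg \<tau> (ty_basic X 1 A) = ([], IsTy (\<tau> (Inl (1, A))))"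
    using translate_ty_elem[of \<tau> 1 A] by (simp add: ty_basic_def translate_judg_pair)
  then show ?case using \<Gamma> der J orbit_eq[of "translate_judg \<tau> (ty_basic X 1 A)" J] by simp
next
  case (Suc n)
  let ?B = "ty_bd X n A"
  have X: "is_tts X" using assms(3) by (simp add: is_tts_map_def)
  obtain \<Gamma> where \<Gamma>: "(\<Gamma>, IsTy (\<tau> (Inl (Suc n, A)))) \<in> on_ty f (Suc n) A" "map fst \<Gamma> = [1..<Suc n]"
    using assms(4) Suc.prems unfolding template_def by (metis le_add1 plus_1_eq_Suc)
  have "on_ty f (Suc n) A \<in> ty (free_tts D Z) (Suc n)"
    using assms(3) Suc.prems by (simp add: is_tts_map_def)
  then obtain J where J: "J \<in> der D Z" "on_ty f (Suc n) A = orbit J"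
    using free_tts_ty[OF assms(1,2)] by blast
  define K where "K = (\<Gamma>, IsTy (\<tau> (Inl (Suc n, A))))"
  have K: "K \<in> der D Z" "on_ty f (Suc n) A = orbit K" "is_type K" "degree K = Suc n"
    using \<Gamma>(1) J derived_orbit[of K J] orbit_eq[of K J] arg_cong[OF \<Gamma>(2), of length]
    by (simp_all add: K_def degree_def)
  obtain \<Gamma>' U where \<Gamma>': "\<Gamma> = \<Gamma>' @ [(n, U)]" "map fst \<Gamma>' = [1..<n]"
    using \<Gamma>(2) Suc.hyps by (cases \<Gamma> rule: rev_cases) auto
  have B: "translate_judg \<tau> (ty_basic X n ?B) \<in> on_ty f n ?B"
    using Suc.IH[OF tts_ty_bd[OF X Suc.hyps Suc.prems]] by blast
  have "on_ty f n ?B = ty_bd (free_tts D Z) n (on_ty f (Suc n) A)"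
    using assms(3) Suc.prems Suc.hyps by (simp add: is_tts_map_def)
  also have "\<dots> = orbit (\<Gamma>', IsTy U)"
    using free_tts_ty_bd[OF assms(1,2) K(1,3,4) Suc.hyps] K(2) by (simp add: K_def \<Gamma>')
  finally have "translate_judg \<tau> (ty_basic X n ?B) \<in> orbit (\<Gamma>', IsTy U)" using B by simp
  moreover have "(\<Gamma>', IsTy U) \<in> der D Z"
    using boundary_derived[OF assms(1,2) K(1), of "(\<Gamma>', IsTy U)"] by (simp add: K_def \<Gamma>')
  moreover have "map fst (fst (translate_judg \<tau> (ty_basic X n ?B))) = map fst (fst (\<Gamma>', IsTy U))"
    unfolding map_fst_translate_judg by (simp add: ty_basic_def \<Gamma>')
  ultimately have "translate_judg \<tau> (ty_basic X n ?B) = (\<Gamma>', IsTy U)"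
    using canonical_unique[OF assms(1,2)] by (metis typing_simps(1) snd_conv)
  moreover have "fv (\<tau> (Inl (Suc n, A))) \<subseteq> {1..<Suc n}"
    using derived_IsTy_fv[OF assms(1,2)] K(1) fst_set_of_map[OF \<Gamma>(2)] unfolding K_def by blast
  ultimately have "translate_judg \<tau> (ty_basic X (Suc n) A) = K"
    using translate_ty_elem[of \<tau> "Suc n" A] by (simp add: ty_basic_def translate_judg_pair elem_ctx_Suc[OF Suc.hyps] K_def \<Gamma>')
  then show ?case using K orbit_self by metis
qed

lemma translate_judg_tm_basic:
  assumes "is_tts Z" "gat_rules D" "is_tts_map X (free_tts D Z) f" "template X f \<tau>"
    and "n \<ge> 1" "a \<in> tm X n"
  shows "translate_judg \<tau> (tm_basic X n a) \<in> on_tm f n a \<and> translate_judg \<tau> (tm_basic X n a) \<in> der D Z \<and>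
    on_tm f n a = orbit (translate_judg \<tau> (tm_basic X n a))"
proof -
  let ?B = "tm_bd X n a"
  have X: "is_tts X" using assms(3) by (simp add: is_tts_map_def)
  obtain \<Gamma> T where \<Gamma>: "(\<Gamma>, HasTy (\<tau> (Inr (n, a))) T) \<in> on_tm f n a" "map fst \<Gamma> = [1..<n]"
    using assms(4-6) unfolding template_def by blast
  have "on_tm f n a \<in> tm (free_tts D Z) n"
    using assms(3,5,6) by (simp add: is_tts_map_def)
  then obtain J where J: "J \<in> der D Z" "on_tm f n a = orbit J"
    using free_tts_tm[OF assms(1,2)] by blast
  define K where "K = (\<Gamma>, HasTy (\<tau> (Inr (n, a))) T)"
  have K: "K \<in> der D Z" "on_tm f n a = orbit K" "is_term K"
    using \<Gamma>(1) J derived_orbit[of K J] orbit_eq[of K J] by (simp_all add: K_def)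
  have B: "translate_judg \<tau> (ty_basic X n ?B) \<in> on_ty f n ?B"
    using translate_judg_ty_basic[OF assms(1-5) tts_tm_bd[OF X assms(5,6)]] by blast
  have "on_ty f n ?B = tm_bd (free_tts D Z) n (on_tm f n a)"
    using assms(3,5,6) by (simp add: is_tts_map_def)
  also have "\<dots> = orbit (\<Gamma>, IsTy T)"
    using free_tts_tm_bd[OF assms(1,2) K(1,3)] K(2) by (simp add: K_def)
  finally have "translate_judg \<tau> (ty_basic X n ?B) \<in> orbit (\<Gamma>, IsTy T)" using B by simp
  moreover have "(\<Gamma>, IsTy T) \<in> der D Z"
    using boundary_derived[OF assms(1,2) K(1), of "(\<Gamma>, IsTy T)"] by (simp add: K_def)
  moreover have "map fst (fst (translate_judg \<tau> (ty_basic X n ?B))) = map fst (fst (\<Gamma>, IsTy T))"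
    unfolding map_fst_translate_judg by (simp add: ty_basic_def \<Gamma>)
  ultimately have "translate_judg \<tau> (ty_basic X n ?B) = (\<Gamma>, IsTy T)"
    using canonical_unique[OF assms(1,2)] by (metis typing_simps(1) snd_conv)
  moreover have "fv (\<tau> (Inr (n, a))) \<subseteq> {1..<n}"
    using derived_HasTy_fv(1)[OF assms(1,2)] K(1) fst_set_of_map[OF \<Gamma>(2)] unfolding K_def by blast
  ultimately have "translate_judg \<tau> (tm_basic X n a) = K"
    using translate_tm_elem[of \<tau> n a] by (simp add: ty_basic_def tm_basic_def translate_judg_pair K_def)
  then show ?thesis using K orbit_self by metis
qed

lemma translate_judg_interp:
  assumes "is_tts Z" "gat_rules D" "is_tts_map X (free_tts D Z) f" "template X f \<tau>"
  shows "interp D (free_gat X) (free_gat Z) (translate_judg \<tau>)"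
proof -
  have X: "is_tts X" using assms(3) by (simp add: is_tts_map_def)
  have "translate_judg \<tau> J \<in> der D Z" if "J \<in> basics (free_gat X)" for J
    using that translate_judg_ty_basic[OF assms] translate_judg_tm_basic[OF assms] unfolding basics_free by blast
  then have "translate_judg \<tau> J \<in> der D Z" if "J \<in> der D X" for J using translate_judg_derived that by blast
  moreover have "translate_judg \<tau> J = J'" if "rule_app r Js J" "rule_app r (map (translate_judg \<tau>) Js) J'" for r Js J J'
    using rule_app_deterministic[OF rule_app_translate_judg[OF that(1)] that(2)] .
  ultimately show ?thesis
    using free_gat_dgat[OF X assms(2)] free_gat_dgat[OF assms(1,2)] same_form_translate_judg boundary_translate_judg
    unfolding interp_def by blast
qed

text \<open>Renaming is a rule that applies to every judgement, so an interpretation has to commute with it.\<close>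

lemma interp_permute:
  assumes "interp D \<T> \<U> \<psi>" "J \<in> derived D \<T>" "bij \<sigma>"
  shows "\<psi> (permute \<sigma> J) = permute \<sigma> (\<psi> J)"
proof -
  have "rule_app (Perm \<sigma>) [J] (permute \<sigma> J)" "rule_app (Perm \<sigma>) (map \<psi> [J]) (permute \<sigma> (\<psi> J))"
    using assms(3) by (simp_all add: rule_app.intros)
  then show ?thesis using assms(1,2) unfolding interp_def by (metis available.simps(14) empty_set
      empty_subsetI insert_subset list.simps(15))
qed

lemma interpD:
  assumes "interp D \<T> \<U> \<psi>" "J \<in> derived D \<T>"
  shows "\<psi> J \<in> derived D \<U>" "same_form J (\<psi> J)" "boundary (\<psi> J) = map \<psi> (boundary J)"
  using assms by (simp_all add: interp_def)

lemma is_typeE: "is_type J \<Longrightarrow> (\<And>\<Gamma> T. J = (\<Gamma>, IsTy T) \<Longrightarrow> R) \<Longrightarrow> R"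
  by (cases J rule: is_type.cases) auto

lemma is_termE: "is_term J \<Longrightarrow> (\<And>\<Gamma> t T. J = (\<Gamma>, HasTy t T) \<Longrightarrow> R) \<Longrightarrow> R"
  by (cases J rule: is_term.cases) auto

lemma same_form_type: "same_form J J' \<Longrightarrow> is_type J \<Longrightarrow> is_type J'"
  by (cases "(J, J')" rule: same_form.cases) auto

lemma same_form_term: "same_form J J' \<Longrightarrow> is_term J \<Longrightarrow> is_term J'"
  by (cases "(J, J')" rule: same_form.cases) auto

text \<open>An interpretation keeps the length of the context, and by equivariance it cannot introduce a variable:
swapping such a variable with a fresh one would fix the basic judgement but not its image.\<close>

lemma interp_ty_basic_vars:
  assumes "is_tts X" "is_tts Z" "gat_rules D" "interp D (free_gat X) (free_gat Z) \<psi>"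
    and "n \<ge> 1" "A \<in> ty X n"
  shows "map fst (fst (\<psi> (ty_basic X n A))) = [1..<n]"
  using assms(5,6)
proof (induction n arbitrary: A rule: nat_induct_at_least)
  case base
  have "ty_basic X 1 A \<in> der D X" using ty_basic_derived[OF assms(1)] base by blast
  then have "is_type (\<psi> (ty_basic X 1 A))" "boundary (\<psi> (ty_basic X 1 A)) = []"
    using interpD[OF assms(4)] same_form_type[of "ty_basic X 1 A" "\<psi> (ty_basic X 1 A)"]
    by (simp_all add: boundary_ty_basic_1) (simp add: ty_basic_def)
  then show ?case by (auto elim!: is_typeE split: if_splits)
next
  case (Suc n)
  let ?B = "ty_basic X n (ty_bd X n A)" and ?J = "ty_basic X (Suc n) A"
  have J: "?J \<in> der D X" using ty_basic_derived[OF assms(1), of "Suc n" A] Suc by simp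
  then have \<psi>J: "\<psi> ?J \<in> der D Z" "is_type (\<psi> ?J)" "boundary (\<psi> ?J) = [\<psi> ?B]"
    using interpD[OF assms(4) J] same_form_type[of ?J "\<psi> ?J"] boundary_ty_basic[OF Suc.hyps, of X A]
    by (simp_all add: ty_basic_def)
  have B: "map fst (fst (\<psi> ?B)) = [1..<n]"
    using Suc.IH tts_ty_bd[OF assms(1) Suc.hyps Suc.prems] by blast
  obtain \<Gamma> V where 1: "\<psi> ?J = (\<Gamma>, IsTy V)" using \<psi>J(2) by (auto elim: is_typeE)
  then obtain \<Gamma>' z U where 2: "\<psi> ?J = (\<Gamma>' @ [(z, U)], IsTy V)" "\<psi> ?B = (\<Gamma>', IsTy U)"
    using \<psi>J(3) by (cases \<Gamma> rule: rev_cases) auto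
  have "z \<notin> fst ` set \<Gamma>'"
    using derived_ctx_all[OF assms(2,3) \<psi>J(1)] 2 by simp
  then have z: "z \<notin> {1..<n}" using B fst_set_of_map[of \<Gamma>' n] 2 by simp
  have "z = n"
  proof (rule ccontr)
    assume "z \<noteq> n"
    \<comment> \<open>\<open>w\<close> is fresh, so swapping \<open>z\<close> and \<open>w\<close> fixes the basic judgement\<close>
    define w where "w = Suc (n + z)"
    define s where "s = (\<lambda>x. if x = z then w else if x = w then z else x)"
    have "s \<circ> s = id" by (auto simp: s_def fun_eq_iff)
    then have "bij s" using o_bij by blast
    have "permute s ?J = permute id ?J"
    proof (rule permute_agree[OF assms(1,3) J])
      show "s x = id x" if "x \<in> fst ` set (fst ?J)" for x
        using that z \<open>z \<noteq> n\<close> by (auto simp: ty_basic_def s_def w_def)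
    qed (simp add: ty_basic_def)
    then have "permute s (\<psi> ?J) = \<psi> ?J"
      using interp_permute[OF assms(4) J \<open>bij s\<close>] by (simp add: permute_id)
    then have "s z = z" by (simp add: 2 permute_pair)
    then show False by (simp add: s_def w_def)
  qed
  then show ?case using B 2 Suc.hyps by simp
qed

lemma interp_tm_basic_vars:
  assumes "is_tts X" "is_tts Z" "gat_rules D" "interp D (free_gat X) (free_gat Z) \<psi>"
    and "n \<ge> 1" "a \<in> tm X n"
  shows "map fst (fst (\<psi> (tm_basic X n a))) = [1..<n]"
proof -
  let ?J = "tm_basic X n a"
  have "?J \<in> der D X" using tm_basic_derived[OF assms(1,5,6)] .
  then have "is_term (\<psi> ?J)" "boundary (\<psi> ?J) = [\<psi> (ty_basic X n (tm_bd X n a))]"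
    using interpD[OF assms(4)] same_form_term[of ?J "\<psi> ?J"]
    by (simp_all add: boundary_tm_basic) (simp add: tm_basic_def)
  then have "fst (\<psi> ?J) = fst (\<psi> (ty_basic X n (tm_bd X n a)))"
    by (auto elim!: is_termE) (metis fst_conv)
  then show ?thesis
    using interp_ty_basic_vars[OF assms(1-5) tts_tm_bd[OF assms(1,5,6)]] by simp
qed

text \<open>The image of a basic judgement is given only up to renaming, but its variables are known, so it is
determined.  The rest follows by induction over derivations.\<close>

lemma interp_unique:
  assumes "is_tts Z" "gat_rules D" "is_tts_map X (free_tts D Z) f" "template X f \<tau>"
    and "interp D (free_gat X) (free_gat Z) \<psi>"
    and "\<And>n A. n \<ge> 1 \<Longrightarrow> A \<in> ty X n \<Longrightarrow> \<psi> (ty_basic X n A) \<in> on_ty f n A"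
    and "\<And>n a. n \<ge> 1 \<Longrightarrow> a \<in> tm X n \<Longrightarrow> \<psi> (tm_basic X n a) \<in> on_tm f n a"
    and "J \<in> der D X"
  shows "\<psi> J = translate_judg \<tau> J"
  using assms(8)
proof (induction rule: derived.induct)
  case (basic J)
  have X: "is_tts X" using assms(3) by (simp add: is_tts_map_def)
  from basic.hyps(1) show ?case unfolding basics_free
  proof (elim disjE exE conjE)
    fix n A
    assume n: "n \<ge> 1" "A \<in> ty X n" and J: "J = ty_basic X n A"
    have *: "translate_judg \<tau> J \<in> der D Z" "\<psi> J \<in> orbit (translate_judg \<tau> J)"
      using translate_judg_ty_basic[OF assms(1-4) n] assms(6)[OF n] by (simp_all add: J)
    show ?thesis
    proof (rule canonical_unique[OF assms(1,2) *(1) _ *(2)])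
      show "map fst (fst (\<psi> J)) = map fst (fst (translate_judg \<tau> J))"
        unfolding map_fst_translate_judg unfolding J interp_ty_basic_vars[OF X assms(1,2,5) n]
        by (simp add: ty_basic_def)
    qed (simp add: J ty_basic_def)
  next
    fix n a
    assume n: "n \<ge> 1" "a \<in> tm X n" and J: "J = tm_basic X n a"
    have *: "translate_judg \<tau> J \<in> der D Z" "\<psi> J \<in> orbit (translate_judg \<tau> J)"
      using translate_judg_tm_basic[OF assms(1-4) n] assms(7)[OF n] by (simp_all add: J)
    show ?thesis
    proof (rule canonical_unique[OF assms(1,2) *(1) _ *(2)])
      show "map fst (fst (\<psi> J)) = map fst (fst (translate_judg \<tau> J))"
        unfolding map_fst_translate_judg unfolding J interp_tm_basic_vars[OF X assms(1,2,5) n]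
        by (simp add: tm_basic_def)
    qed (simp add: J tm_basic_def)
  qed
next
  case (deduce r Js J)
  have "map \<psi> Js = map (translate_judg \<tau>) Js" using deduce.IH by simp
  then have "rule_app r (map \<psi> Js) (translate_judg \<tau> J)"
    using rule_app_translate_judg[OF deduce.hyps(2), of \<tau>] by (simp only:)
  moreover have "set Js \<subseteq> der D X" using deduce.hyps(3) by blast
  ultimately show ?case using assms(5) deduce.hyps(1,2) unfolding interp_def by blast
qed

text \<open>All members of the class of an interpretation send \<open>J\<close> to the same class, and translation
commutes with renaming, so the choice of representatives is immaterial.\<close>

lemma forget_map_translate_judg:
  assumes "is_tts Z" "gat_rules D" "interp D (free_gat X) (free_gat Z) (translate_judg \<tau>)"
    and "J \<in> der D X" "typing (snd J)"
  shows "(\<Union>\<phi>\<in>interp_rel D (free_gat X) (free_gat Z) `` {translate_judg \<tau>}. \<Union>J'\<in>orbit J.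
    judg_class D (free_gat Z) (\<phi> J')) = orbit (translate_judg \<tau> J)"
proof -
  let ?\<Phi> = "interp_rel D (free_gat X) (free_gat Z) `` {translate_judg \<tau>}"
  have "judg_equiv D (free_gat Z) (translate_judg \<tau> K) (translate_judg \<tau> K)" if "K \<in> der D X" "is_type K \<or> is_term K" for K
  proof -
    have "translate_judg \<tau> K \<in> der D Z" using assms(3) that(1) by (simp add: interp_def)
    then show ?thesis
      using judg_equiv_iff[OF assms(1,2)] that(2) orbit_self by (simp add: typing_iff)
  qed
  then have "translate_judg \<tau> \<in> ?\<Phi>" using assms(3) by (simp add: interp_rel_def)
  moreover have "(\<Union>J'\<in>orbit J. judg_class D (free_gat Z) (\<phi> J')) = orbit (translate_judg \<tau> J)" if "\<phi> \<in> ?\<Phi>" for \<phi>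
  proof (rule UN_orbit)
    fix \<pi> :: "var \<Rightarrow> var"
    assume "bij \<pi>"
    let ?K = "permute \<pi> J"
    have K: "?K \<in> der D X" "typing (snd ?K)"
      using derived_perm[OF assms(4) \<open>bij \<pi>\<close>] assms(5) by (simp_all add: typing_iff)
    then have der: "translate_judg \<tau> ?K \<in> der D Z" "\<phi> ?K \<in> der D Z"
      and eq: "judg_equiv D (free_gat Z) (translate_judg \<tau> ?K) (\<phi> ?K)"
      using that interpD[OF _ K(1)] unfolding interp_rel_def typing_iff by blast+
    have "typing (snd (translate_judg \<tau> ?K))" using K(2) by simp
    then have \<phi>: "\<phi> ?K \<in> orbit (translate_judg \<tau> ?K)"
      using judg_equiv_iff[OF assms(1,2) der] eq by blast
    then have "typing (snd (\<phi> ?K))" using typing_orbit K(2) by (metis typing_translate_judg)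
    then have "judg_class D (free_gat Z) (\<phi> ?K) = orbit (\<phi> ?K)"
      by (rule judg_class_eq_orbit[OF assms(1,2) der(2)])
    also have "\<dots> = orbit (translate_judg \<tau> ?K)" using \<phi> by (rule orbit_eq)
    also have "\<dots> = orbit (translate_judg \<tau> J)" by (simp add: translate_judg_permute orbit_permute[OF \<open>bij \<pi>\<close>])
    finally show "judg_class D (free_gat Z) (\<phi> ?K) = orbit (translate_judg \<tau> J)" .
  qed
  ultimately show ?thesis by blast
qed

text \<open>The universal property of the free theory: the translation along the templates is an interpretation
with the required values, and every other one agrees with it on derived judgements.\<close>

lemma transpose_eq:
  assumes "is_tts Z" "gat_rules D" "is_tts_map X (free_tts D Z) f" "template X f \<tau>"
  shows "transpose D X (free_gat Z) f = interp_rel D (free_gat X) (free_gat Z) `` {translate_judg \<tau>}"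
  unfolding transpose_def
proof (rule the_equality)
  let ?\<Phi> = "interp_rel D (free_gat X) (free_gat Z) `` {translate_judg \<tau>}"
  have X: "is_tts X" using assms(3) by (simp add: is_tts_map_def)
  have int: "interp D (free_gat X) (free_gat Z) (translate_judg \<tau>)" by (rule translate_judg_interp[OF assms])
  have ty_class: "judg_class D (free_gat X) (ty_basic X n A) = orbit (ty_basic X n A)"
    "ty_basic X n A \<in> der D X" if "n \<ge> 1" "A \<in> ty X n" for n A
    using judg_class_eq_orbit[OF X assms(2)] ty_basic_derived[OF X that] by (simp_all add: ty_basic_def)
  have tm_class: "judg_class D (free_gat X) (tm_basic X n a) = orbit (tm_basic X n a)"
    "tm_basic X n a \<in> der D X" if "n \<ge> 1" "a \<in> tm X n" for n a
    using judg_class_eq_orbit[OF X assms(2)] tm_basic_derived[OF X that] by (simp_all add: tm_basic_def)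
  have "?\<Phi> \<in> gat_hom D (free_gat X) (free_gat Z)"
    using int by (auto simp: gat_hom_def quotient_def)
  moreover have "tts_map_eq X (tts_comp (forget_map D (free_gat Z) ?\<Phi>) (adj_unit D X)) f"
    unfolding tts_map_eq_def
  proof (intro allI impI conjI ballI)
    fix n :: nat and A
    assume n: "n \<ge> 1" "A \<in> ty X n"
    have "on_ty (tts_comp (forget_map D (free_gat Z) ?\<Phi>) (adj_unit D X)) n A = orbit (translate_judg \<tau> (ty_basic X n A))"
      using forget_map_translate_judg[OF assms(1,2) int ty_class(2)[OF n]] ty_class(1)[OF n]
      by (simp add: tts_comp_def forget_map_def adj_unit_def ty_basic_def)
    then show "on_ty (tts_comp (forget_map D (free_gat Z) ?\<Phi>) (adj_unit D X)) n A = on_ty f n A"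
      using translate_judg_ty_basic[OF assms n] by simp
  next
    fix n :: nat and a
    assume n: "n \<ge> 1" "a \<in> tm X n"
    have "on_tm (tts_comp (forget_map D (free_gat Z) ?\<Phi>) (adj_unit D X)) n a = orbit (translate_judg \<tau> (tm_basic X n a))"
      using forget_map_translate_judg[OF assms(1,2) int tm_class(2)[OF n]] tm_class(1)[OF n]
      by (simp add: tts_comp_def forget_map_def adj_unit_def tm_basic_def)
    then show "on_tm (tts_comp (forget_map D (free_gat Z) ?\<Phi>) (adj_unit D X)) n a = on_tm f n a"
      using translate_judg_tm_basic[OF assms n] by simp
  qed
  ultimately show "?\<Phi> \<in> gat_hom D (free_gat X) (free_gat Z) \<and>
    tts_map_eq X (tts_comp (forget_map D (free_gat Z) ?\<Phi>) (adj_unit D X)) f" by blast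
  fix \<Psi>
  assume \<Psi>: "\<Psi> \<in> gat_hom D (free_gat X) (free_gat Z) \<and>
    tts_map_eq X (tts_comp (forget_map D (free_gat Z) \<Psi>) (adj_unit D X)) f"
  then obtain \<psi> where \<psi>: "interp D (free_gat X) (free_gat Z) \<psi>"
    "\<Psi> = interp_rel D (free_gat X) (free_gat Z) `` {\<psi>}"
    by (auto simp: gat_hom_def quotient_def)
  have refl: "judg_equiv D (free_gat Z) (\<psi> K) (\<psi> K)" "\<psi> K \<in> judg_class D (free_gat Z) (\<psi> K)"
    if "K \<in> der D X" "is_type K \<or> is_term K" for K
  proof -
    have K: "\<psi> K \<in> der D Z" "same_form K (\<psi> K)" using \<psi>(1) that(1) by (simp_all add: interp_def)
    then have "typing (snd (\<psi> K))"
      using that(2) same_form_type same_form_term by (metis typing_iff)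
    then show "judg_equiv D (free_gat Z) (\<psi> K) (\<psi> K)" "\<psi> K \<in> judg_class D (free_gat Z) (\<psi> K)"
      using judg_equiv_iff[OF assms(1,2) K(1) K(1)] judg_class_eq_orbit[OF assms(1,2) K(1)] orbit_self
      by blast+
  qed
  then have "\<psi> \<in> \<Psi>" using \<psi> by (simp add: interp_rel_def)
  have "\<psi> J = translate_judg \<tau> J" if "J \<in> der D X" for J
  proof (rule interp_unique[OF assms \<psi>(1) _ _ that])
    fix n A
    assume n: "n \<ge> (1::nat)" "A \<in> ty X n"
    have "is_type (ty_basic X n A)" by (simp add: ty_basic_def)
    then have "\<psi> (ty_basic X n A) \<in> judg_class D (free_gat Z) (\<psi> (ty_basic X n A))"
      using refl(2)[OF ty_class(2)[OF n]] by blast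
    then have "\<psi> (ty_basic X n A) \<in> on_ty (tts_comp (forget_map D (free_gat Z) \<Psi>) (adj_unit D X)) n A"
      using \<open>\<psi> \<in> \<Psi>\<close> orbit_self[of "ty_basic X n A"]
      unfolding tts_comp_def forget_map_def adj_unit_def by (auto simp: ty_class(1)[OF n])
    then show "\<psi> (ty_basic X n A) \<in> on_ty f n A" using \<Psi> n by (simp add: tts_map_eq_def)
  next
    fix n a
    assume n: "n \<ge> (1::nat)" "a \<in> tm X n"
    have "is_term (tm_basic X n a)" by (simp add: tm_basic_def)
    then have "\<psi> (tm_basic X n a) \<in> judg_class D (free_gat Z) (\<psi> (tm_basic X n a))"
      using refl(2)[OF tm_class(2)[OF n]] by blast
    then have "\<psi> (tm_basic X n a) \<in> on_tm (tts_comp (forget_map D (free_gat Z) \<Psi>) (adj_unit D X)) n a"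
      using \<open>\<psi> \<in> \<Psi>\<close> orbit_self[of "tm_basic X n a"]
      unfolding tts_comp_def forget_map_def adj_unit_def by (auto simp: tm_class(1)[OF n])
    then show "\<psi> (tm_basic X n a) \<in> on_tm f n a" using \<Psi> n by (simp add: tts_map_eq_def)
  qed
  then show "\<Psi> = ?\<Phi>" using \<psi> int by (auto simp: interp_rel_def)
qed

lemma forget_map_transpose:
  assumes "is_tts Z" "gat_rules D" "is_tts_map X (free_tts D Z) f" "template X f \<tau>"
    and "J \<in> der D X" "typing (snd J)"
  shows "on_ty (forget_map D (free_gat Z) (transpose D X (free_gat Z) f)) n (orbit J) = orbit (translate_judg \<tau> J)"
    "on_tm (forget_map D (free_gat Z) (transpose D X (free_gat Z) f)) n (orbit J) = orbit (translate_judg \<tau> J)"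
  using forget_map_translate_judg[OF assms(1,2) translate_judg_interp[OF assms(1-4)] assms(5,6)]
  by (simp_all add: transpose_eq[OF assms(1-4)] forget_map_def)

section \<open>Judgements derived by substitution\<close>

text \<open>Here the context is part of the data: each variable argument adds itself to the context.  So every
variable of the context is an argument, and the arguments that are variables occur in the order of
the context.\<close>

inductive linear_spine ::
  "('a, 'b) tts \<Rightarrow> ('a, 'b) elem_sym ctx \<Rightarrow> nat \<Rightarrow> 'a \<Rightarrow> ('a, 'b) elem_sym expr list \<Rightarrow> bool"
  for X :: "('a, 'b) tts" where
  nil: "A \<in> ty X (Suc 0) \<Longrightarrow> linear_spine X [] (Suc 0) A []"
| var: "linear_spine X \<Gamma> n B es \<Longrightarrow> A \<in> ty X (Suc n) \<Longrightarrow> ty_bd X n A = B \<Longrightarrow> y \<notin> fst ` set \<Gamma> \<Longrightarrow>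
    linear_spine X (\<Gamma> @ [(y, App (Inl (n, B)) es)]) (Suc n) A (es @ [Var y])"
| app: "linear_spine X \<Gamma> n B es \<Longrightarrow> A \<in> ty X (Suc n) \<Longrightarrow> ty_bd X n A = B \<Longrightarrow> a \<in> tm X n \<Longrightarrow> tm_bd X n a = B \<Longrightarrow>
    linear_spine X \<Gamma> (Suc n) A (es @ [App (Inr (n, a)) es])"

lemma linear_spine_spine: "linear_spine X \<Gamma> n A es \<Longrightarrow> spine X \<Gamma> n A es"
proof (induction rule: linear_spine.induct)
  case (var \<Gamma> n B es A y)
  show ?case
  proof (rule spine.snoc[OF _ var.hyps(2,3)])
    show "spine X (\<Gamma> @ [(y, App (Inl (n, B)) es)]) n B es" by (rule spine_mono[OF var.IH]) auto
  qed (simp add: arg_ok_def)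
next
  case (app \<Gamma> n B es A a)
  then show ?case by (intro spine.snoc) (auto simp: arg_ok_def)
qed (rule spine.nil)

lemma linear_spine_fv: "linear_spine X \<Gamma> n A es \<Longrightarrow> \<Union> (fv ` set es) = fst ` set \<Gamma>"
  by (induction rule: linear_spine.induct) auto

lemma linear_spine_props: "linear_spine X \<Gamma> n A es \<Longrightarrow> A \<in> ty X n \<and> n = Suc (length es)"
  by (rule spine_props[OF linear_spine_spine])

text \<open>This is what distinguishes the contexts of the fragment with substitution only: each type depends on
all earlier variables.\<close>

lemma linear_spine_full: "linear_spine X \<Gamma> n A es \<Longrightarrow> ctx_all (\<lambda>\<Delta> T. fv T = fst ` set \<Delta>) \<Gamma>"
  by (induction rule: linear_spine.induct) (simp_all add: linear_spine_fv)

text \<open>The context can be read off from the arguments that are variables, since their types are determined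
by the arguments before them.\<close>

lemma linear_spine_unique: "linear_spine X \<Gamma> n A es \<Longrightarrow> linear_spine X \<Gamma>' n A es \<Longrightarrow> \<Gamma> = \<Gamma>'"
proof (induction arbitrary: \<Gamma>' rule: linear_spine.induct)
  case (nil A)
  from nil.prems show ?case by cases auto
next
  case (var \<Gamma> n B es A y)
  from var.prems show ?case by cases (use var.IH var.hyps(3) in auto)
next
  case (app \<Gamma> n B es A a)
  from app.prems show ?case by cases (use app.IH app.hyps(3) in auto)
qed

lemma linear_spine_permute:
  assumes "bij \<sigma>" "linear_spine X \<Gamma> n A es"
  shows "linear_spine X (permute_ctx \<sigma> \<Gamma>) n A (map (subst (Var \<circ> \<sigma>)) es)"
  using assms(2)
proof (induction rule: linear_spine.induct)
  case (nil A)
  then show ?case by (simp add: linear_spine.nil)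
next
  case (var \<Gamma> n B es A y)
  let ?p = "\<lambda>(x, T). (\<sigma> x, subst (Var \<circ> \<sigma>) T)"
  have "\<sigma> y \<notin> fst ` set (map ?p \<Gamma>)"
  proof
    assume "\<sigma> y \<in> fst ` set (map ?p \<Gamma>)"
    then obtain x T where "(x, T) \<in> set \<Gamma>" "\<sigma> y = \<sigma> x" by auto
    then show False using bij_is_inj[OF assms(1)] in_fst[of x T \<Gamma>] var.hyps(4) by (auto simp: inj_def)
  qed
  from linear_spine.var[OF var.IH var.hyps(2,3) this] show ?case by (simp add: o_def)
next
  case (app \<Gamma> n B es A a)
  then show ?case using linear_spine.app[OF app.IH app.hyps(2-5)] by simp
qed

text \<open>Substituting for a variable of the context turns the argument that introduced it into a constant
argument, and the later arguments follow along.\<close>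

lemma linear_spine_subst:
  assumes "linear_spine X \<Gamma> k B us" "a \<in> tm X k" "tm_bd X k a = B"
    and "linear_spine X \<Gamma>0 n A es" "\<Gamma>0 = \<Gamma> @ (y, App (Inl (k, B)) us) # \<Delta>"
    and "s = single (App (Inr (k, a)) us) y"
  shows "linear_spine X (\<Gamma> @ subst_ctx s \<Delta>) n A (map (subst s) es)"
  using assms(4,5)
proof (induction arbitrary: \<Delta> rule: linear_spine.induct)
  case (nil A)
  then show ?case by simp
next
  case (var \<Gamma>1 n B' es A z)
  show ?case
  proof (cases \<Delta> rule: rev_cases)
    case Nil
    then have eq: "\<Gamma>1 = \<Gamma>" "z = y" "n = k" "B' = B" "us = es" using var.prems by auto
    then have "y \<notin> \<Union> (fv ` set es)" using var.hyps(4) linear_spine_fv[OF assms(1)] by simp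
    then have "map (subst s) es = es"
      unfolding assms(6) by (intro map_idI subst_single_fresh) auto
    moreover have "s y = App (Inr (k, a)) us" by (simp add: assms(6) single_def)
    ultimately show ?thesis
      using linear_spine.app[OF var.hyps(1-3), of a] assms(2,3) Nil by (simp add: eq)
  next
    case (snoc \<Delta>' v)
    then have eq: "v = (z, App (Inl (n, B')) es)" "\<Gamma>1 = \<Gamma> @ (y, App (Inl (k, B)) us) # \<Delta>'"
      using var.prems by auto
    then have z: "z \<noteq> y" "z \<notin> fst ` set (\<Gamma> @ subst_ctx s \<Delta>')" using var.hyps(4) by (auto simp: image_Un)
    moreover from z(1) have "s z = Var z" by (simp add: assms(6) single_def)
    ultimately show ?thesis
      using linear_spine.var[OF var.IH[OF eq(2)] var.hyps(2,3) z(2)] by (simp add: snoc eq(1))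
  qed
next
  case (app \<Gamma>1 n B' es A b)
  then show ?case using linear_spine.app[OF app.IH[OF app.prems] app.hyps(2-5)] by simp
qed

lemma linear_spine_elem_ctx:
  assumes "is_tts X" "n \<ge> 1" "A \<in> ty X n"
  shows "linear_spine X (elem_ctx X n A) n A (map Var [1..<n])"
  using assms(2,3)
proof (induction n arbitrary: A rule: nat_induct_at_least)
  case base
  then show ?case by (simp add: linear_spine.nil)
next
  case (Suc n)
  have "linear_spine X (elem_ctx X n (ty_bd X n A)) n (ty_bd X n A) (map Var [1..<n])"
    using Suc.IH tts_ty_bd[OF assms(1) Suc.hyps Suc.prems] .
  from linear_spine.var[OF this Suc.prems refl, of n] show ?case
    using Suc.hyps by (simp add: elem_ctx_Suc[OF Suc.hyps] ty_elem_expr_def)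
qed

definition linear_judg :: "('a, 'b) tts \<Rightarrow> ('a, 'b) elem_sym judgement \<Rightarrow> bool" where
  "linear_judg X J \<longleftrightarrow> (\<exists>n A es. linear_spine X (fst J) n A es \<and>
     (snd J = IsTy (App (Inl (n, A)) es) \<or>
      (\<exists>a\<in>tm X n. tm_bd X n a = A \<and> snd J = HasTy (App (Inr (n, a)) es) (App (Inl (n, A)) es))))"

lemma S_derived_linear_judg:
  assumes "is_tts X" "J \<in> der {S} X" "typing (snd J)"
  shows "linear_judg X J"
proof -
  have "trivial_eq (snd J) \<and> (fst J, lhs_typing (snd J)) \<in> der {S} X \<and> linear_judg X (fst J, lhs_typing (snd J))"
    using assms(2)
  proof (rule free_derived_induct)
    fix n A
    assume "n \<ge> 1" "A \<in> ty X n"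
    then show "linear_judg X (ty_basic X n A)"
      using linear_spine_elem_ctx[OF assms(1), of n A]
      by (auto simp: linear_judg_def ty_basic_def ty_elem_expr_def)
  next
    fix n a
    assume n: "n \<ge> 1" "a \<in> tm X n"
    then show "linear_judg X (tm_basic X n a)"
      using linear_spine_elem_ctx[OF assms(1) n(1) tts_tm_bd[OF assms(1) n]]
      by (auto simp: linear_judg_def tm_basic_def ty_elem_expr_def tm_elem_expr_def)
  next
    fix \<sigma> :: "var \<Rightarrow> var" and \<Gamma> and R :: "('a, 'b) elem_sym expr rhs"
    assume \<sigma>: "bij \<sigma>" and "linear_judg X (\<Gamma>, R)"
    then obtain n A es where sp: "linear_spine X \<Gamma> n A es" and
      R: "R = IsTy (App (Inl (n, A)) es) \<or>
        (\<exists>a\<in>tm X n. tm_bd X n a = A \<and> R = HasTy (App (Inr (n, a)) es) (App (Inl (n, A)) es))"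
      by (auto simp: linear_judg_def)
    show "linear_judg X (permute \<sigma> (\<Gamma>, R))"
      unfolding linear_judg_def permute_pair fst_conv snd_conv
      using linear_spine_permute[OF \<sigma> sp] R
      by (intro exI[of _ n] exI[of _ A] exI[of _ "map (subst (Var \<circ> \<sigma>)) es"]) auto
  next
    fix y \<Gamma> \<Delta> t T and R :: "('a, 'b) elem_sym expr rhs"
    assume t: "linear_judg X (\<Gamma>, HasTy t T)" and "linear_judg X (\<Gamma> @ (y, T) # \<Delta>, R)"
    then obtain n A es where sp: "linear_spine X (\<Gamma> @ (y, T) # \<Delta>) n A es" and
      R: "R = IsTy (App (Inl (n, A)) es) \<or>
        (\<exists>a\<in>tm X n. tm_bd X n a = A \<and> R = HasTy (App (Inr (n, a)) es) (App (Inl (n, A)) es))"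
      by (auto simp: linear_judg_def)
    obtain k B us a where u: "linear_spine X \<Gamma> k B us" "a \<in> tm X k" "tm_bd X k a = B"
      "t = App (Inr (k, a)) us" "T = App (Inl (k, B)) us"
      using t by (auto simp: linear_judg_def)
    have "linear_spine X (\<Gamma> @ subst_ctx (single t y) \<Delta>) n A (map (subst (single t y)) es)"
      using linear_spine_subst[OF u(1-3) sp] u(4,5) by simp
    then show "linear_judg X (\<Gamma> @ subst_ctx (single t y) \<Delta>, map_rhs (subst (single t y)) R)"
      unfolding linear_judg_def fst_conv snd_conv
      using R by (intro exI[of _ n] exI[of _ A] exI[of _ "map (subst (single t y)) es"]) auto
  qed simp_all
  then show ?thesis using assms(3) by simp
qed

definition basic_rhs :: "('a, 'b) tts \<Rightarrow> nat \<Rightarrow> 'a \<Rightarrow> ('a, 'b) elem_sym expr rhs \<Rightarrow> bool" where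
  "basic_rhs X n A R \<longleftrightarrow> (A \<in> ty X n \<and> R = IsTy (ty_elem_expr n A)) \<or>
     (\<exists>a\<in>tm X n. tm_bd X n a = A \<and> R = HasTy (tm_elem_expr n a) (ty_elem_expr n A))"

text \<open>The part from position \<open>k\<close> on of the context of the basic judgement of \<open>A\<close>, with variables named by
\<open>\<xi>\<close> and with \<open>\<theta>\<close> in the place of the variables of the types.\<close>

definition telescope ::
  "('a, 'b) tts \<Rightarrow> nat \<Rightarrow> 'a \<Rightarrow> (var \<Rightarrow> ('a, 'b) elem_sym expr) \<Rightarrow> (nat \<Rightarrow> var) \<Rightarrow> nat \<Rightarrow>
   ('a, 'b) elem_sym ctx" where
  "telescope X n A \<theta> \<xi> k = map (\<lambda>i. (\<xi> i, subst \<theta> (ty_elem_expr i (bd_iter X n (n - i) A)))) [k..<n]"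

lemma subst_ty_elem [simp]: "subst \<theta> (ty_elem_expr n A) = App (Inl (n, A)) (map \<theta> [1..<n])"
  by (simp add: ty_elem_expr_def)

lemma subst_tm_elem [simp]: "subst \<theta> (tm_elem_expr n a) = App (Inr (n, a)) (map \<theta> [1..<n])"
  by (simp add: tm_elem_expr_def)

lemma fv_elem [simp]: "fv (ty_elem_expr n A) = {1..<n}" "fv (tm_elem_expr n a) = {1..<n}"
  by (auto simp: ty_elem_expr_def tm_elem_expr_def)

lemma basic_rhs_fv: "basic_rhs X n A R \<Longrightarrow> e \<in> exprs R \<Longrightarrow> fv e \<subseteq> {1..<n}"
  by (auto simp: basic_rhs_def)

lemma basic_rhs_derived:
  assumes "is_tts X" "n \<ge> 1" "basic_rhs X n A R"
  shows "(elem_ctx X n A, R) \<in> der D X"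
  using assms ty_basic_derived[of X n A D] tm_basic_derived[of X n _ D]
  by (auto simp: basic_rhs_def ty_basic_def tm_basic_def)

lemma telescope_basic:
  assumes "is_tts X" "n \<ge> 1" "basic_rhs X n A R" "inj_on \<xi> {1..<n}"
    and "\<And>i. i \<in> {1..<n} \<Longrightarrow> \<theta> i = Var (\<xi> i)"
  shows "(telescope X n A \<theta> \<xi> 1, map_rhs (subst \<theta>) R) \<in> der D X"
proof -
  obtain \<pi> where \<pi>: "bij \<pi>" "map \<pi> [1..<n] = map \<xi> [1..<n]"
    using bij_extending[of "[1..<n]" "map \<xi> [1..<n]"] assms(4) by (auto simp: distinct_map)
  have \<pi>i: "\<pi> i = \<xi> i" if "i \<in> {1..<n}" for i
    using that \<pi>(2) unfolding map_eq_conv by simp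
  have e: "subst (Var \<circ> \<pi>) e = subst \<theta> e" if "fv e \<subseteq> {1..<n}" for e
    using that assms(5) \<pi>i by (intro subst_cong) (auto simp del: One_nat_def)
  have "map_rhs (subst (Var \<circ> \<pi>)) R = map_rhs (subst \<theta>) R"
    using e basic_rhs_fv[OF assms(3)] by (intro rhs.map_cong) auto
  moreover have "permute_ctx \<pi> (elem_ctx X n A) = telescope X n A \<theta> \<xi> 1"
    unfolding elem_ctx_def telescope_def map_map
  proof (rule map_cong[OF refl])
    fix i
    assume "i \<in> set [1..<n]"
    then have i: "i \<in> {1..<n}" by simp
    then have "fv (ty_elem_expr i (bd_iter X n (n - i) A)) \<subseteq> {1..<n}" by auto
    from e[OF this] \<pi>i[OF i]
    show "((\<lambda>(x, T). (\<pi> x, subst (Var \<circ> \<pi>) T)) \<circ> (\<lambda>i. (i, ty_elem_expr i (bd_iter X n (n - i) A)))) i =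
        (\<xi> i, subst \<theta> (ty_elem_expr i (bd_iter X n (n - i) A)))"
      by (simp only: comp_apply case_prod_conv)
  qed
  ultimately show ?thesis
    using derived_perm[OF basic_rhs_derived[OF assms(1-3)] \<pi>(1)] by (simp only: permute_pair)
qed

lemma telescope_Cons:
  "k < n \<Longrightarrow> telescope X n A \<theta> \<xi> k =
    (\<xi> k, App (Inl (k, bd_iter X n (n - k) A)) (map \<theta> [1..<k])) # telescope X n A \<theta> \<xi> (Suc k)"
  by (simp add: telescope_def upt_conv_Cons)

lemma telescope_cong:
  assumes "\<And>i. i \<in> {k..<n} \<Longrightarrow> \<xi> i = \<xi>' i"
  shows "telescope X n A \<theta> \<xi> k = telescope X n A \<theta> \<xi>' k"
  unfolding telescope_def using assms by (intro map_cong) auto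

lemma bd_iter_pred: "k < n \<Longrightarrow> bd_iter X n (n - k) A = ty_bd X k (bd_iter X n (n - Suc k) A)"
  by (cases "n - k") (auto simp: Suc_diff_Suc[symmetric])

lemma fun_upd_fresh:
  assumes "inj_on \<xi> {Suc k..<n}" "z \<notin> \<xi> ` {Suc k..<n}" "k < n"
  shows "inj_on (\<xi>(k := z)) {k..<n}" "(\<xi>(k := z)) ` {k..<n} = insert z (\<xi> ` {Suc k..<n})"
proof -
  have 1: "{k..<n} = insert k {Suc k..<n}" using assms(3) by auto
  have 2: "(\<xi>(k := z)) ` {Suc k..<n} = \<xi> ` {Suc k..<n}" by (intro image_cong) auto
  have 3: "inj_on (\<xi>(k := z)) {Suc k..<n}"
    using assms(1) inj_on_cong[of "{Suc k..<n}" "\<xi>(k := z)" \<xi>] by simp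
  show "inj_on (\<xi>(k := z)) {k..<n}" unfolding 1 inj_on_insert using 2 3 assms(2) by auto
  show "(\<xi>(k := z)) ` {k..<n} = insert z (\<xi> ` {Suc k..<n})" unfolding 1 image_insert 2 by simp
qed

text \<open>The first \<open>k - 1\<close> arguments of \<open>A\<close> are instantiated, and the others are still variables.  One more
argument is dealt with at a time: a variable argument only has to be renamed in the telescope, and a
constant argument is substituted for the next variable.  The typing of the constant argument is the
induction hypothesis again, applied to the type \<open>B\<close> itself with an empty telescope.\<close>

lemma linear_spine_telescope:
  assumes "is_tts X" "S \<in> D" and "linear_spine X \<Gamma> k B es"
  shows "k \<le> n \<Longrightarrow> bd_iter X n (n - k) A = B \<Longrightarrow> basic_rhs X n A R \<Longrightarrow> map \<theta> [1..<k] = es \<Longrightarrow>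
    (\<And>i. i \<in> {k..<n} \<Longrightarrow> \<theta> i = Var (\<xi> i)) \<Longrightarrow> inj_on \<xi> {k..<n} \<Longrightarrow> \<xi> ` {k..<n} \<inter> fst ` set \<Gamma> = {} \<Longrightarrow>
    (\<Gamma> @ telescope X n A \<theta> \<xi> k, map_rhs (subst \<theta>) R) \<in> der D X"
  using assms(3)
proof (induction arbitrary: n A R \<theta> \<xi> rule: linear_spine.induct)
  case (nil B)
  then show ?case using telescope_basic[OF assms(1), of n A R \<xi> \<theta> D] by simp
next
  case (var \<Gamma> k B es A' y)
  have \<theta>: "\<theta> k = Var y" "map \<theta> [1..<k] = es"
    using var.prems(4) linear_spine_props[OF var.hyps(1)] by simp_all
  have B: "bd_iter X n (n - k) A = B"
    using bd_iter_pred[of k n X A] var.prems(1,2) var.hyps(3) by simp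
  have "(\<Gamma> @ telescope X n A \<theta> (\<xi>(k := y)) k, map_rhs (subst \<theta>) R) \<in> der D X"
  proof (rule var.IH[OF _ B var.prems(3) \<theta>(2)])
    show "\<theta> i = Var ((\<xi>(k := y)) i)" if "i \<in> {k..<n}" for i
      using that \<theta>(1) var.prems(5)[of i] by (cases "i = k") auto
    have "y \<notin> \<xi> ` {Suc k..<n}" "k < n" using var.prems(1,7) by auto
    note fresh = fun_upd_fresh[OF var.prems(6) this]
    show "inj_on (\<xi>(k := y)) {k..<n}" by (rule fresh(1))
    show "(\<xi>(k := y)) ` {k..<n} \<inter> fst ` set \<Gamma> = {}"
      unfolding fresh(2) using var.prems(7) var.hyps(4) by auto
  qed (use var.prems(1) in simp)
  also have "telescope X n A \<theta> (\<xi>(k := y)) k = (y, App (Inl (k, B)) es) # telescope X n A \<theta> \<xi> (Suc k)"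
    using var.prems(1) B \<theta>(2) telescope_cong[of "Suc k" n "\<xi>(k := y)" \<xi> X A \<theta>] by (simp add: telescope_Cons)
  finally show ?case by simp
next
  case (app \<Gamma> k B es A' a)
  have k: "k = Suc (length es)" using linear_spine_props[OF app.hyps(1)] by simp
  have \<theta>: "\<theta> k = App (Inr (k, a)) es" "map \<theta> [1..<k] = es"
    using app.prems(4) k by simp_all
  have B: "bd_iter X n (n - k) A = B"
    using bd_iter_pred[of k n X A] app.prems(1,2) app.hyps(3) by simp
  have "finite (fst ` set \<Gamma> \<union> \<xi> ` {Suc k..<n})" by simp
  \<comment> \<open>a temporary name for the \<open>k\<close>-th variable, for which the constant argument is then substituted\<close>
  then obtain z where z: "z \<notin> fst ` set \<Gamma> \<union> \<xi> ` {Suc k..<n}"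
    using ex_new_if_finite[OF infinite_UNIV_nat] by blast
  let ?\<theta> = "\<theta>(k := Var z)" and ?\<xi> = "\<xi>(k := z)" and ?s = "single (App (Inr (k, a)) es) z"
  have es: "map ?\<theta> [1..<k] = es" using \<theta>(2) by (auto cong: map_cong)
  have "(\<Gamma> @ telescope X n A ?\<theta> ?\<xi> k, map_rhs (subst ?\<theta>) R) \<in> der D X"
  proof (rule app.IH[OF _ B app.prems(3) es])
    show "?\<theta> i = Var (?\<xi> i)" if "i \<in> {k..<n}" for i
      using that app.prems(5)[of i] by (cases "i = k") auto
    have "z \<notin> \<xi> ` {Suc k..<n}" "k < n" using app.prems(1) z by auto
    note fresh = fun_upd_fresh[OF app.prems(6) this]
    show "inj_on ?\<xi> {k..<n}" by (rule fresh(1))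
    show "?\<xi> ` {k..<n} \<inter> fst ` set \<Gamma> = {}"
      unfolding fresh(2) using app.prems(7) z by auto
  qed (use app.prems(1) in simp)
  also have "telescope X n A ?\<theta> ?\<xi> k = (z, App (Inl (k, B)) es) # telescope X n A ?\<theta> \<xi> (Suc k)"
    using app.prems(1) B es telescope_cong[of "Suc k" n ?\<xi> \<xi> X A ?\<theta>] by (simp add: telescope_Cons)
  finally have der: "(\<Gamma> @ (z, App (Inl (k, B)) es) # telescope X n A ?\<theta> \<xi> (Suc k), map_rhs (subst ?\<theta>) R) \<in> der D X" .
  have "(\<Gamma> @ telescope X k B \<theta> \<xi> k, map_rhs (subst \<theta>) (HasTy (tm_elem_expr k a) (ty_elem_expr k B))) \<in> der D X"
    using app.hyps(4,5) by (intro app.IH[OF _ _ _ \<theta>(2)]) (auto simp: basic_rhs_def)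
  then have "(\<Gamma>, HasTy (App (Inr (k, a)) es) (App (Inl (k, B)) es)) \<in> der D X"
    using \<theta>(2) by (simp add: telescope_def)
  from derived_subst[OF assms(2) this der]
  have res: "(\<Gamma> @ subst_ctx ?s (telescope X n A ?\<theta> \<xi> (Suc k)), map_rhs (subst ?s) (map_rhs (subst ?\<theta>) R)) \<in> der D X" .
  have \<theta>i: "subst ?s (?\<theta> i) = \<theta> i" if i: "i \<in> {1..<n}" for i
  proof (cases "i < k")
    case True
    then have "\<theta> i \<in> set (map \<theta> [1..<k])" using i by auto
    then have "\<theta> i \<in> set es" unfolding \<theta>(2) .
    then have "z \<notin> fv (\<theta> i)" using linear_spine_fv[OF app.hyps(1)] z by auto
    then show ?thesis using True by (simp add: subst_single_fresh)
  next
    case False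
    then show ?thesis
      using i z app.prems(5)[of i] \<theta>(1) by (cases "i = k") (auto simp: single_def)
  qed
  have e: "subst ?s (subst ?\<theta> e) = subst \<theta> e" if "fv e \<subseteq> {1..<n}" for e
    unfolding subst_subst using that \<theta>i by (intro subst_cong) blast
  have "map_rhs (subst ?s) (map_rhs (subst ?\<theta>) R) = map_rhs (subst \<theta>) R"
    unfolding rhs.map_comp comp_def using e basic_rhs_fv[OF app.prems(3)] by (intro rhs.map_cong) auto
  moreover have "subst_ctx ?s (telescope X n A ?\<theta> \<xi> (Suc k)) = telescope X n A \<theta> \<xi> (Suc k)"
    unfolding subst_ctx_def telescope_def map_map
  proof (rule map_cong[OF refl])
    fix i
    assume "i \<in> set [Suc k..<n]"
    then have "fv (ty_elem_expr i (bd_iter X n (n - i) A)) \<subseteq> {1..<n}" by auto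
    from e[OF this] show "((\<lambda>(x, T). (x, subst ?s T)) \<circ>
        (\<lambda>i. (\<xi> i, subst ?\<theta> (ty_elem_expr i (bd_iter X n (n - i) A))))) i =
        (\<xi> i, subst \<theta> (ty_elem_expr i (bd_iter X n (n - i) A)))"
      by (simp only: comp_apply case_prod_conv)
  qed
  ultimately show ?case using res by (simp only:)
qed

lemma linear_spine_derived:
  assumes "is_tts X" "S \<in> D" "linear_spine X \<Gamma> n A es"
  shows "(\<Gamma>, IsTy (App (Inl (n, A)) es)) \<in> der D X"
    "\<And>a. a \<in> tm X n \<Longrightarrow> tm_bd X n a = A \<Longrightarrow>
      (\<Gamma>, HasTy (App (Inr (n, a)) es) (App (Inl (n, A)) es)) \<in> der D X"
proof -
  define \<theta> where "\<theta> i = es ! (i - 1)" for i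
  have es: "map \<theta> [1..<n] = es"
    using linear_spine_props[OF assms(3)] by (intro nth_equalityI) (simp_all add: \<theta>_def del: upt_Suc)
  have *: "(\<Gamma>, map_rhs (subst \<theta>) R) \<in> der D X" if "basic_rhs X n A R" for R
    using linear_spine_telescope[OF assms, of n A R \<theta> id] that es by (simp add: telescope_def)
  show "(\<Gamma>, IsTy (App (Inl (n, A)) es)) \<in> der D X"
    using *[of "IsTy (ty_elem_expr n A)"] linear_spine_props[OF assms(3), THEN conjunct1] es
    by (simp add: basic_rhs_def)
  show "(\<Gamma>, HasTy (App (Inr (n, a)) es) (App (Inl (n, A)) es)) \<in> der D X"
    if "a \<in> tm X n" "tm_bd X n a = A" for a
  proof -
    have "basic_rhs X n A (HasTy (tm_elem_expr n a) (ty_elem_expr n A))"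
      using that by (auto simp: basic_rhs_def)
    from *[OF this] show ?thesis using es by simp
  qed
qed

text \<open>The variables among the arguments of a type, with their types in \<open>\<Gamma>\<close>, form a linear context.  They do
not repeat: the type of the next variable argument mentions all the earlier ones, and no variable
occurs in its own type.\<close>

lemma spine_to_linear_spine:
  assumes "ctx_all (ty_ok X) \<Gamma>" "spine X \<Gamma> n A es"
  shows "\<exists>\<Gamma>s. linear_spine X \<Gamma>s n A es \<and> set \<Gamma>s \<subseteq> set \<Gamma>"
  using assms(2)
proof (induction rule: spine.induct)
  case (nil A)
  then show ?case by (auto intro!: exI[of _ "[]"] linear_spine.nil)
next
  case (snoc n B es A t)
  then obtain \<Gamma>s where \<Gamma>s: "linear_spine X \<Gamma>s n B es" "set \<Gamma>s \<subseteq> set \<Gamma>" by blast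
  from snoc.hyps(4) consider (var) y where "t = Var y" "(y, App (Inl (n, B)) es) \<in> set \<Gamma>"
    | (app) a where "a \<in> tm X n" "tm_bd X n a = B" "t = App (Inr (n, a)) es"
    unfolding arg_ok_def by blast
  then show ?case
  proof cases
    case var
    obtain \<Gamma>1 where "y \<notin> fst ` set \<Gamma>1" "ty_ok X \<Gamma>1 (App (Inl (n, B)) es)"
      using ctx_all_mem[OF assms(1) var(2)] by blast
    then have "y \<notin> fst ` set \<Gamma>s"
      using ty_ok_fv[of X \<Gamma>1 "App (Inl (n, B)) es"] linear_spine_fv[OF \<Gamma>s(1)] by auto
    from linear_spine.var[OF \<Gamma>s(1) snoc.hyps(2,3) this] show ?thesis
      using \<Gamma>s(2) var by (intro exI[of _ "\<Gamma>s @ [(y, App (Inl (n, B)) es)]"]) simp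
  next
    case app
    from linear_spine.app[OF \<Gamma>s(1) snoc.hyps(2,3) app(1,2)] show ?thesis using \<Gamma>s(2) app(3) by blast
  qed
qed

section \<open>Judgements derived by weakening and projection\<close>

text \<open>Without substitution a constant is never applied to anything but variables.\<close>

definition var_app :: "'c expr \<Rightarrow> bool" where
  "var_app e \<longleftrightarrow> (\<exists>c ys. e = App c (map Var ys))"

definition var_judg :: "'c judgement \<Rightarrow> bool" where
  "var_judg J \<longleftrightarrow> (\<forall>T\<in>snd ` set (fst J). var_app T) \<and>
     (\<forall>T. snd J = IsTy T \<longrightarrow> var_app T) \<and>
     (\<forall>t T. snd J = HasTy t T \<longrightarrow> var_app T \<and> (var_app t \<or> (\<exists>y. t = Var y)))"

lemma var_app_rename: "var_app e \<Longrightarrow> var_app (subst (Var \<circ> \<sigma>) e)"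
proof -
  assume "var_app e"
  then obtain c ys where "e = App c (map Var ys)" by (auto simp: var_app_def)
  then have "subst (Var \<circ> \<sigma>) e = App c (map Var (map \<sigma> ys))" by simp
  then show ?thesis unfolding var_app_def by blast
qed

lemma var_app_elem: "var_app (ty_elem_expr n A)" "var_app (tm_elem_expr n a)"
  unfolding var_app_def ty_elem_expr_def tm_elem_expr_def by blast+

lemma P_derived_var_judg:
  assumes "J \<in> der {W, P} X" "typing (snd J)"
  shows "var_judg J"
proof -
  have "trivial_eq (snd J) \<and> (fst J, lhs_typing (snd J)) \<in> der {W, P} X \<and> var_judg (fst J, lhs_typing (snd J))"
    using assms(1)
  proof (rule free_derived_induct)
    show "var_judg (ty_basic X n A)" for n A
      by (auto simp: var_judg_def ty_basic_def elem_ctx_def var_app_elem)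
    show "var_judg (tm_basic X n a)" for n a
      by (auto simp: var_judg_def tm_basic_def elem_ctx_def var_app_elem)
  next
    fix \<sigma> :: "var \<Rightarrow> var" and \<Gamma> and R :: "('a, 'b) elem_sym expr rhs"
    assume R: "typing R" "var_judg (\<Gamma>, R)"
    have "\<forall>T\<in>snd ` set (permute_ctx \<sigma> \<Gamma>). var_app T"
      using R(2) var_app_rename by (fastforce simp: var_judg_def)
    then show "var_judg (permute \<sigma> (\<Gamma>, R))"
      using R var_app_rename[of _ \<sigma>]
      unfolding var_judg_def permute_pair typing_def by auto
  qed (auto simp: var_judg_def)
  then show ?thesis using assms(2) by simp
qed

lemma linear_spine_vars: "linear_spine X \<Gamma> n A es \<Longrightarrow> es = map Var ys \<Longrightarrow> map fst \<Gamma> = ys"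
proof (induction arbitrary: ys rule: linear_spine.induct)
  case (var \<Gamma> n B es A y)
  then show ?case by (cases ys rule: rev_cases) auto
next
  case (app \<Gamma> n B es A a)
  then show ?case by (cases ys rule: rev_cases) auto
qed simp

lemma fv_ctx_derived:
  assumes "is_tts X" "gat_rules D" "(\<Gamma>, IsTy U) \<in> der D X"
  shows "fv_ctx \<Gamma> = fst ` set \<Gamma>"
proof -
  have "fv T \<subseteq> fst ` set \<Gamma>" if "(x, T) \<in> set \<Gamma>" for x T
    using fv_judgement[OF assms, of T] that by force
  then show ?thesis unfolding fv_ctx_def using in_fst by (auto simp: image_iff Bex_def)
qed

text \<open>Induction on \<open>\<Gamma>\<close> from its end.  If the last entry of \<open>\<Gamma>\<close> is not in \<open>\<Gamma>\<^sub>s\<close>, it is added by weakening.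
Otherwise it must also be the last entry of \<open>\<Gamma>\<^sub>s\<close>, since each type of \<open>\<Gamma>\<^sub>s\<close> depends on all earlier
variables; then it is moved to \<open>\<Delta>\<close>.\<close>

lemma thinning:
  assumes "is_tts X" "W \<in> D"
    and "derived_ctx D X \<Gamma>"
    and "ctx_all (\<lambda>\<Delta> T. fv T = fst ` set \<Delta>) \<Gamma>s" "set \<Gamma>s \<subseteq> set \<Gamma>"
    and "(\<Gamma>s @ \<Delta>, R) \<in> der D X" "fv_ctx \<Delta> \<inter> fst ` set \<Gamma> \<subseteq> fst ` set \<Gamma>s"
  shows "(\<Gamma> @ \<Delta>, R) \<in> der D X"
  using assms(3-)
proof (induction \<Gamma> arbitrary: \<Gamma>s \<Delta> rule: rev_induct)
  case Nil
  then show ?case by simp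
next
  case (snoc v \<Gamma>)
  obtain z U where v: "v = (z, U)" by (cases v)
  have ctx: "derived_ctx D X \<Gamma>" "z \<notin> fst ` set \<Gamma>" "(\<Gamma>, IsTy U) \<in> der D X"
    using snoc.prems(1) by (simp_all add: v)
  have fv: "fv_ctx \<Gamma> = fst ` set \<Gamma>" using fv_ctx_derived[OF assms(1) _ ctx(3)] assms(2) by blast
  show ?case
  proof (cases "(z, U) \<in> set \<Gamma>s")
    case True
    then obtain \<Gamma>1 \<Gamma>2 where \<Gamma>s: "\<Gamma>s = \<Gamma>1 @ (z, U) # \<Gamma>2" by (auto dest: split_list)
    have dist: "distinct (map fst \<Gamma>s)" using snoc.prems(2) by (rule ctx_all_distinct)
    \<comment> \<open>a later entry of \<open>\<Gamma>\<^sub>s\<close> would have a type mentioning \<open>z\<close>, but all other entries lie in \<open>\<Gamma>\<close>\<close>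
    have "\<Gamma>2 = []"
    proof (cases \<Gamma>2)
      case (Cons w \<Gamma>3)
      obtain x V where w: "w = (x, V)" by (cases w)
      have "\<Gamma>s = (\<Gamma>1 @ [(z, U)]) @ (x, V) # \<Gamma>3" by (simp add: \<Gamma>s Cons w)
      then have "fv V = fst ` set (\<Gamma>1 @ [(z, U)])" using snoc.prems(2) unfolding ctx_all_def by blast
      then have "z \<in> fv V" by simp
      moreover have "x \<noteq> z" using dist by (auto simp: \<Gamma>s Cons w)
      then have "(x, V) \<in> set \<Gamma>" using snoc.prems(3) by (auto simp: \<Gamma>s Cons w v)
      then have "fv V \<subseteq> fv_ctx \<Gamma>" by (auto simp: fv_ctx_def)
      ultimately show ?thesis using fv ctx(2) by blast
    qed
    then have \<Gamma>s: "\<Gamma>s = \<Gamma>1 @ [(z, U)]" using \<Gamma>s by simp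
    have U: "fv U = fst ` set \<Gamma>1" "ctx_all (\<lambda>\<Delta> T. fv T = fst ` set \<Delta>) \<Gamma>1" "z \<notin> fst ` set \<Gamma>1"
      using snoc.prems(2) by (simp_all add: \<Gamma>s)
    have "(\<Gamma> @ ((z, U) # \<Delta>), R) \<in> der D X"
    proof (rule snoc.IH[OF ctx(1) U(2)])
      show "set \<Gamma>1 \<subseteq> set \<Gamma>"
      proof
        fix p
        assume p: "p \<in> set \<Gamma>1"
        then have "fst p \<noteq> z" using U(3) by (metis imageI)
        then show "p \<in> set \<Gamma>" using p snoc.prems(3) by (auto simp: \<Gamma>s v)
      qed
      show "(\<Gamma>1 @ (z, U) # \<Delta>, R) \<in> der D X" using snoc.prems(4) by (simp add: \<Gamma>s)
      have "fv_ctx ((z, U) # \<Delta>) = insert z (fv U \<union> fv_ctx \<Delta>)" by (auto simp: fv_ctx_def)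
      then show "fv_ctx ((z, U) # \<Delta>) \<inter> fst ` set \<Gamma> \<subseteq> fst ` set \<Gamma>1"
        using U(1) ctx(2) snoc.prems(5) by (auto simp: \<Gamma>s v)
    qed
    then show ?thesis by (simp add: v)
  next
    case False
    then have sub: "set \<Gamma>s \<subseteq> set \<Gamma>" using snoc.prems(3) by (auto simp: v)
    then have "z \<notin> fst ` set \<Gamma>s" using ctx(2) by auto
    then have "z \<notin> fv_ctx \<Delta>" using snoc.prems(5) by (auto simp: v)
    moreover have "(\<Gamma> @ \<Delta>, R) \<in> der D X"
      by (rule snoc.IH[OF ctx(1) snoc.prems(2) sub snoc.prems(4)]) (use snoc.prems(5) in auto)
    ultimately have "(\<Gamma> @ (z, U) # \<Delta>, R) \<in> der D X"
      using derived_weaken[OF assms(2) _ ctx(3), of z \<Delta> R] fv ctx(2) by simp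
    then show ?thesis by (simp add: v)
  qed
qed

text \<open>The variables \<open>ys\<close> form a part of \<open>\<Gamma>\<close> over which the judgement is a renamed basic judgement; the rest of
\<open>\<Gamma>\<close> comes from weakening.\<close>

lemma var_spine_derived:
  assumes "is_tts X" "W \<in> D" "derived_ctx D X \<Gamma>"
    and "spine X \<Gamma> n A (map Var ys)" "basic_rhs X n A R" "map \<theta> [1..<n] = map Var ys"
  shows "(\<Gamma>, map_rhs (subst \<theta>) R) \<in> der D X"
proof -
  have WP: "gat_rules D" using assms(2) by blast
  have n: "n = Suc (length ys)" "A \<in> ty X n" 
    using spine_props[OF assms(4)] unfolding length_map by blast+
  have "ctx_all (ty_ok X) \<Gamma>"
    by (rule ctx_all_mono[OF assms(3)]) (rule derived_IsTy_ok[OF assms(1) WP])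
  from spine_to_linear_spine[OF this assms(4)]
  obtain \<Gamma>s where \<Gamma>s: "linear_spine X \<Gamma>s n A (map Var ys)" "set \<Gamma>s \<subseteq> set \<Gamma>" by blast
  have "map fst \<Gamma>s = ys" by (rule linear_spine_vars[OF \<Gamma>s(1) refl])
  then have "distinct ys" using ctx_all_distinct[OF linear_spine_full[OF \<Gamma>s(1)]] by simp
  define \<xi> where "\<xi> i = ys ! (i - 1)" for i
  have inj: "inj_on \<xi> {1..<n}"
  proof (rule inj_onI)
    fix i j
    assume ij: "i \<in> {1..<n}" "j \<in> {1..<n}" "\<xi> i = \<xi> j"
    then have "i - 1 < length ys" "j - 1 < length ys" "ys ! (i - 1) = ys ! (j - 1)"
      using n by (auto simp: \<xi>_def)
    then have "i - 1 = j - 1" using \<open>distinct ys\<close> nth_eq_iff_index_eq by blast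
    then show "i = j" using ij(1,2) unfolding atLeastLessThan_iff by linarith
  qed
  have \<theta>: "\<theta> i = Var (\<xi> i)" if "i \<in> {1..<n}" for i
  proof -
    have "map \<theta> [1..<n] ! (i - 1) = map Var ys ! (i - 1)" by (simp only: assms(6))
    then show ?thesis using that n by (auto simp: \<xi>_def simp del: upt_Suc)
  qed
  \<comment> \<open>\<open>\<Gamma>\<^sub>s\<close> is the renamed context of the basic judgement of \<open>A\<close>: both belong to the same linear spine\<close>
  have "basic_rhs X n A (IsTy (ty_elem_expr n A))" using n by (simp add: basic_rhs_def)
  then have "(telescope X n A \<theta> \<xi> 1, map_rhs (subst \<theta>) (IsTy (ty_elem_expr n A))) \<in> der {S} X"
    using n(1) by (intro telescope_basic[OF assms(1) _ _ inj \<theta>]) simp_all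
  then have "(telescope X n A \<theta> \<xi> 1, IsTy (App (Inl (n, A)) (map Var ys))) \<in> der {S} X"
    using assms(6) by simp
  then have "linear_spine X (telescope X n A \<theta> \<xi> 1) n A (map Var ys)"
    using S_derived_linear_judg[OF assms(1)] by (fastforce simp: linear_judg_def)
  then have "telescope X n A \<theta> \<xi> 1 = \<Gamma>s" using linear_spine_unique[OF _ \<Gamma>s(1)] by blast
  then have "(\<Gamma>s @ [], map_rhs (subst \<theta>) R) \<in> der D X"
    using telescope_basic[OF assms(1) _ assms(5) inj, of \<theta> D] \<theta> n(1) by simp
  from thinning[OF assms(1-3) linear_spine_full[OF \<Gamma>s(1)] \<Gamma>s(2) this]
  show ?thesis by (simp add: fv_ctx_def)
qed

lemma inst_ex: "length es = n - 1 \<Longrightarrow> \<exists>\<theta>. map \<theta> [1..<n] = es"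
  by (intro exI[of _ "\<lambda>i. es ! (i - 1)"] nth_equalityI) (simp_all del: upt_Suc)

lemma var_spine_type:
  assumes "is_tts X" "W \<in> D" "derived_ctx D X \<Gamma>"
    and "spine X \<Gamma> n A (map Var ys)"
  shows "(\<Gamma>, IsTy (App (Inl (n, A)) (map Var ys))) \<in> der D X"
proof -
  have n: "A \<in> ty X n" using spine_props[OF assms(4)] by blast
  have "length ys = n - 1" using spine_props[OF assms(4)] by simp
  then obtain \<theta> where \<theta>: "map \<theta> [1..<n] = (map Var ys :: ('a, 'b) elem_sym expr list)"
    using inst_ex[of "map Var ys" n] by auto
  have "basic_rhs X n A (IsTy (ty_elem_expr n A))" using n by (simp add: basic_rhs_def)
  from var_spine_derived[OF assms this \<theta>] \<theta> show ?thesis by simp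
qed

lemma var_spine_term:
  assumes "is_tts X" "W \<in> D" "derived_ctx D X \<Gamma>"
    and "spine X \<Gamma> n A (map Var ys)" "a \<in> tm X n" "tm_bd X n a = A"
  shows "(\<Gamma>, HasTy (App (Inr (n, a)) (map Var ys)) (App (Inl (n, A)) (map Var ys))) \<in> der D X"
proof -
  have n: "length ys = n - 1" using spine_props[OF assms(4)] by simp
  then obtain \<theta> where \<theta>: "map \<theta> [1..<n] = (map Var ys :: ('a, 'b) elem_sym expr list)"
    using inst_ex[of "map Var ys" n] by auto
  have "basic_rhs X n A (HasTy (tm_elem_expr n a) (ty_elem_expr n A))"
    using assms(5,6) by (auto simp: basic_rhs_def)
  from var_spine_derived[OF assms(1-4) this \<theta>] \<theta> show ?thesis by simp
qed

lemma weaken_end: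
  assumes "is_tts X" "W \<in> D" "(\<Gamma>, R) \<in> der D X"
  shows "derived_ctx D X (\<Gamma> @ \<Delta>) \<Longrightarrow> (\<Gamma> @ \<Delta>, R) \<in> der D X"
proof (induction \<Delta> rule: rev_induct)
  case Nil
  then show ?case using assms(3) by simp
next
  case (snoc v \<Delta>)
  obtain z U where v: "v = (z, U)" by (cases v)
  have ctx: "derived_ctx D X (\<Gamma> @ \<Delta>)" "z \<notin> fst ` set (\<Gamma> @ \<Delta>)"
    "(\<Gamma> @ \<Delta>, IsTy U) \<in> der D X"
    using snoc.prems ctx_all_snoc[of _ "\<Gamma> @ \<Delta>" z U] by (simp_all add: v)
  have "fv_ctx (\<Gamma> @ \<Delta>) = fst ` set (\<Gamma> @ \<Delta>)"
    using fv_ctx_derived[OF assms(1) _ ctx(3)] assms(2) by blast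
  then show ?case
    using derived_weaken[OF assms(2) _ ctx(3), of z "[]" R] snoc.IH[OF ctx(1)] ctx(2)
    by (simp add: v fv_ctx_def)
qed

lemma var_derived:
  assumes "is_tts X" "W \<in> D" "P \<in> D" "derived_ctx D X \<Gamma>" "(y, T) \<in> set \<Gamma>"
  shows "(\<Gamma>, HasTy (Var y) T) \<in> der D X"
proof -
  obtain \<Gamma>1 \<Gamma>2 where \<Gamma>: "\<Gamma> = \<Gamma>1 @ (y, T) # \<Gamma>2" "y \<notin> fst ` set \<Gamma>1" "(\<Gamma>1, IsTy T) \<in> der D X"
    using ctx_all_mem[OF assms(4,5)] by blast
  have "y \<notin> fv_ctx \<Gamma>1" using fv_ctx_derived[OF assms(1) _ \<Gamma>(3)] assms(2) \<Gamma>(2) by blast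
  then have "(\<Gamma>1 @ [(y, T)], HasTy (Var y) T) \<in> der D X" by (rule derived_project[OF assms(3) _ \<Gamma>(3)])
  from weaken_end[OF assms(1,2) this, of \<Gamma>2] show ?thesis using assms(4) by (simp add: \<Gamma>(1))
qed

section \<open>Collapsing and expanding\<close>

text \<open>The expression that carries the whole information of a judgement derived by substitution alone:
see \<open>S_derived_unique\<close>.\<close>

fun subject :: "'e rhs \<Rightarrow> 'e" where
  "subject (IsTy T) = T"
| "subject (HasTy t T) = t"
| "subject (TyEq T T') = T"
| "subject (TmEq t t' T) = t"

lemma subject_map: "subject (map_rhs f R) = f (subject R)"
  by (cases R) auto

lemma subject_exprs: "subject R \<in> exprs R"
  by (cases R) auto

text \<open>Reduces statements about all expressions in a derived judgement to statements about subjects.\<close>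

lemma derived_expr_subject:
  assumes "is_tts X" "gat_rules D" "J \<in> der D X" "typing (snd J)"
    and "e \<in> snd ` set (fst J) \<union> exprs (snd J)"
  shows "\<exists>\<Gamma> R. (\<Gamma>, R) \<in> der D X \<and> typing R \<and> subject R = e"
proof (cases "e \<in> exprs (snd J)")
  case True
  from assms(4) show ?thesis
  proof (cases rule: typingE)
    case (ty \<Gamma> U)
    then show ?thesis using True assms(3) by (intro exI[of _ \<Gamma>] exI[of _ "IsTy U"]) simp
  next
    case (tm \<Gamma> u U)
    then have "(\<Gamma>, HasTy u U) \<in> der D X" "(\<Gamma>, IsTy U) \<in> der D X"
      using assms(3) derived_HasTy[OF assms(1,2), of \<Gamma> u U] by simp_all
    moreover have "e = u \<or> e = U" using True tm by simp
    ultimately show ?thesis by (metis typing_simps(1,2) subject.simps(1,2))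
  qed
next
  case False
  then obtain x where "(x, e) \<in> set (fst J)" using assms(5) by auto
  then obtain \<Gamma>1 where "(\<Gamma>1, IsTy e) \<in> der D X"
    using ctx_all_mem[OF derived_ctx_derived[OF assms(1-4)]] by blast
  then show ?thesis by (metis typing_simps(1) subject.simps(1))
qed

lemma map_judgement_id:
  assumes "\<And>e. e \<in> snd ` set (fst J) \<union> exprs (snd J) \<Longrightarrow> h e = e"
  shows "(map (\<lambda>(x, T). (x, h T)) (fst J), map_rhs h (snd J)) = J"
proof -
  have "map (\<lambda>(x, T). (x, h T)) (fst J) = fst J"
    by (rule map_idI) (use assms in \<open>auto simp: image_iff Bex_def\<close>)
  moreover have "map_rhs h (snd J) = snd J"
    by (rule rhs.map_ident_strong) (use assms in blast)
  ultimately show ?thesis by (simp only: prod.collapse)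
qed

text \<open>The representative whose context has the variables \<open>1, \<dots>, n - 1\<close>.\<close>

definition canonical :: "nat \<Rightarrow> ('a, 'b) free_elem \<Rightarrow> ('a, 'b) elem_sym judgement" where
  "canonical n c = (SOME J. J \<in> c \<and> map fst (fst J) = [1..<n])"

definition expand :: "(('a, 'b) free_elem, ('a, 'b) free_elem) elem_sym \<Rightarrow> ('a, 'b) elem_sym expr" where
  "expand s = subject (snd (case s of Inl (n, c) \<Rightarrow> canonical n c | Inr (n, c) \<Rightarrow> canonical n c))"

lemma canonical_orbit:
  assumes "is_tts X" "gat_rules D" "J \<in> der D X" "typing (snd J)"
    and "bij \<pi>" "map fst (fst (permute \<pi> J)) = [1..<n]"
  shows "canonical n (orbit J) = permute \<pi> J"
  unfolding canonical_def
proof (rule some_equality)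
  show "permute \<pi> J \<in> orbit J \<and> map fst (fst (permute \<pi> J)) = [1..<n]"
    using assms(5,6) unfolding orbit_def by blast
  show "K = permute \<pi> J" if K: "K \<in> orbit J \<and> map fst (fst K) = [1..<n]" for K
  proof (rule canonical_unique[OF assms(1,2) derived_perm[OF assms(3,5)]])
    show "K \<in> orbit (permute \<pi> J)" using K by (simp add: orbit_permute[OF assms(5)])
    show "map fst (fst K) = map fst (fst (permute \<pi> J))" using K assms(6) by (simp only:)
    show "typing (snd (permute \<pi> J))" using assms(4) by (simp add: typing_iff)
  qed
qed

text \<open>The class of \<open>J\<close>, as a constant of the free theory on classes, applied to the variables of the
context of \<open>J\<close>.\<close>

definition elem_app :: "('a, 'b) elem_sym judgement \<Rightarrow> (('a, 'b) free_elem, ('a, 'b) free_elem) elem_sym expr"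
  where "elem_app J =
    App (if is_type J then Inl (degree J, orbit J) else Inr (degree J, orbit J)) (map (Var \<circ> fst) (fst J))"

text \<open>Renaming the variables \<open>xs\<close> to \<open>1, 2, \<dots>\<close> and then instantiating these by \<open>xs\<close> is the identity.\<close>

lemma subst_inst_args_inverse:
  assumes "map \<pi> xs = [1..<Suc (length xs)]" "fv e \<subseteq> set xs"
  shows "subst (inst_args (map Var xs)) (subst (Var \<circ> \<pi>) e) = e"
proof -
  have "subst (inst_args (map Var xs)) (subst (Var \<circ> \<pi>) e) = subst Var e"
    unfolding subst_subst
  proof (rule subst_cong)
    fix x
    assume "x \<in> fv e"
    then obtain i where i: "i < length xs" "x = xs ! i" using assms(2) by (metis in_set_conv_nth subsetD)
    have "\<pi> (xs ! i) = map \<pi> xs ! i" using i by simp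
    then have "\<pi> x = Suc i" unfolding assms(1) using i by (simp del: upt_Suc)
    then show "subst (inst_args (map Var xs)) ((Var \<circ> \<pi>) x) = Var x"
      using i by (simp add: inst_args_def)
  qed
  then show ?thesis by simp
qed

lemma translate_expand_elem_app:
  assumes "is_tts X" "gat_rules D" "J \<in> der D X" "typing (snd J)"
  shows "translate expand (elem_app J) = subject (snd J)"
proof -
  let ?xs = "map fst (fst J)"
  obtain \<pi> where \<pi>: "bij \<pi>" "map fst (fst (permute \<pi> J)) = [1..<degree J]"
    using canonical_exists[OF assms, of "[1..<degree J]"] by (auto simp: degree_def simp del: upt_Suc)
  have "subject (snd (canonical (degree J) (orbit J))) = subst (Var \<circ> \<pi>) (subject (snd J))"
    unfolding canonical_orbit[OF assms \<pi>] by (simp add: permute_def subject_map)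
  moreover have "subst (inst_args (map Var ?xs)) (subst (Var \<circ> \<pi>) (subject (snd J))) = subject (snd J)"
  proof (rule subst_inst_args_inverse)
    show "map \<pi> ?xs = [1..<Suc (length ?xs)]"
      using \<pi>(2) unfolding map_fst_permute degree_def length_map .
    show "fv (subject (snd J)) \<subseteq> set ?xs"
      using fv_judgement[OF assms, of "subject (snd J)"] subject_exprs[of "snd J"] by simp
  qed
  ultimately show ?thesis by (simp add: elem_app_def expand_def o_def)
qed

text \<open>The choice is harmless, since by \<open>S_derived_unique\<close> at most one judgement qualifies.  Arguments are not
collapsed recursively: the whole constant expression becomes one constant of the new theory.\<close>

primrec collapse :: "('a, 'b) tts \<Rightarrow> ('a, 'b) elem_sym expr \<Rightarrow>
    (('a, 'b) free_elem, ('a, 'b) free_elem) elem_sym expr" where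
  "collapse X (Var y) = Var y"
| "collapse X (App c es) =
     elem_app (SOME J. J \<in> der {S} X \<and> typing (snd J) \<and> subject (snd J) = App c es)"

definition collapse_ctx :: "('a, 'b) tts \<Rightarrow> ('a, 'b) elem_sym ctx \<Rightarrow>
    (('a, 'b) free_elem, ('a, 'b) free_elem) elem_sym ctx" where
  "collapse_ctx X \<Gamma> = map (\<lambda>(x, T). (x, collapse X T)) \<Gamma>"

definition collapse_judg :: "('a, 'b) tts \<Rightarrow> ('a, 'b) elem_sym judgement \<Rightarrow>
    (('a, 'b) free_elem, ('a, 'b) free_elem) elem_sym judgement" where
  "collapse_judg X J = (collapse_ctx X (fst J), map_rhs (collapse X) (snd J))"

lemma S_derived_subject:
  assumes "is_tts X" "J \<in> der {S} X" "typing (snd J)"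
  obtains n A es where "linear_spine X (fst J) n A es" "snd J = IsTy (App (Inl (n, A)) es)"
  | n a es where "linear_spine X (fst J) n (tm_bd X n a) es"
    "snd J = HasTy (App (Inr (n, a)) es) (App (Inl (n, tm_bd X n a)) es)"
  using S_derived_linear_judg[OF assms] unfolding linear_judg_def by blast

lemma S_derived_unique:
  assumes "is_tts X" "J \<in> der {S} X" "typing (snd J)" "J' \<in> der {S} X" "typing (snd J')"
    and "subject (snd J) = subject (snd J')"
  shows "J = J'"
  using S_derived_subject[OF assms(1-3)]
proof cases
  case (1 n A es)
  from S_derived_subject[OF assms(1,4,5)] show ?thesis
  proof cases
    case (1 n' A' es')
    then show ?thesis
      using linear_spine_unique[of X "fst J" n A es "fst J'"] \<open>linear_spine X (fst J) n A es\<close>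
        \<open>snd J = IsTy (App (Inl (n, A)) es)\<close> assms(6) by (simp add: prod_eq_iff)
  qed (use 1 assms(6) in simp)
next
  case (2 n a es)
  from S_derived_subject[OF assms(1,4,5)] show ?thesis
  proof cases
    case (2 n' a' es')
    then show ?thesis
      using linear_spine_unique[of X "fst J" n "tm_bd X n a" es "fst J'"] \<open>linear_spine X (fst J) n (tm_bd X n a) es\<close>
        \<open>snd J = HasTy (App (Inr (n, a)) es) (App (Inl (n, tm_bd X n a)) es)\<close> assms(6)
      by (simp add: prod_eq_iff)
  qed (use 2 assms(6) in simp)
qed

lemma collapse_subject:
  assumes "is_tts X" "J \<in> der {S} X" "typing (snd J)"
  shows "collapse X (subject (snd J)) = elem_app J"
proof -
  obtain c es where app: "subject (snd J) = App c es"
    using S_derived_subject[OF assms] by (cases; simp)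
  have "(SOME J. J \<in> der {S} X \<and> typing (snd J) \<and> subject (snd J) = App c es) = J"
  proof (rule some_equality)
    show "J \<in> der {S} X \<and> typing (snd J) \<and> subject (snd J) = App c es" using assms(2,3) app by simp
    show "K = J" if "K \<in> der {S} X \<and> typing (snd K) \<and> subject (snd K) = App c es" for K
      by (rule S_derived_unique[OF assms(1) _ _ assms(2,3)]) (use that app in simp_all)
  qed
  then show ?thesis by (simp add: app)
qed

lemma derived_S_part:
  assumes "is_tts X" "gat_rules D" "(\<Gamma>, R) \<in> der D X" "typing R"
  shows "(\<exists>y T. R = HasTy (Var y) T \<and> (y, T) \<in> set \<Gamma>) \<or>
    (\<exists>\<Gamma>s. (\<Gamma>s, R) \<in> der {S} X \<and> set \<Gamma>s \<subseteq> set \<Gamma>)"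
proof -
  have ok: "judg_ok D X (\<Gamma>, R)" using derived_ok[OF assms(1-3)] assms(4) by simp
  have ctx: "ctx_all (ty_ok X) \<Gamma>" using derived_ctx_ok[OF assms(1-3)] assms(4) by simp
  have "typing (snd (\<Gamma>, R))" using assms(4) by simp
  then show ?thesis
  proof (cases rule: typingE)
    case (ty \<Gamma>' U)
    then obtain n A es where U: "U = App (Inl (n, A)) es" "spine X \<Gamma> n A es"
      using ok by (auto simp: judg_ok_def ty_ok_def)
    from spine_to_linear_spine[OF ctx U(2)] obtain \<Gamma>s where "linear_spine X \<Gamma>s n A es" "set \<Gamma>s \<subseteq> set \<Gamma>" by blast
    then show ?thesis using linear_spine_derived(1)[OF assms(1), of "{S}" \<Gamma>s n A es] U(1) ty by auto
  next
    case (tm \<Gamma>' u U)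
    then obtain n A es where U: "U = App (Inl (n, A)) es" "spine X \<Gamma> n A es" "arg_ok X \<Gamma> n A es u"
      using ok by (auto simp: judg_ok_def tm_ok_def)
    from spine_to_linear_spine[OF ctx U(2)] obtain \<Gamma>s where \<Gamma>s: "linear_spine X \<Gamma>s n A es" "set \<Gamma>s \<subseteq> set \<Gamma>" by blast
    from U(3) consider (var) y where "u = Var y" "(y, U) \<in> set \<Gamma>"
      | (app) a where "a \<in> tm X n" "tm_bd X n a = A" "u = App (Inr (n, a)) es"
      unfolding arg_ok_def U(1) by blast
    then show ?thesis
    proof cases
      case var
      then show ?thesis using tm by simp
    next
      case app
      then have "(\<Gamma>s, R) \<in> der {S} X"
        using linear_spine_derived(2)[OF assms(1) _ \<Gamma>s(1) app(1,2), of "{S}"] U(1) tm by simp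
      then show ?thesis using \<Gamma>s(2) by blast
    qed
  qed
qed

text \<open>Along a linear context the boundaries of the class of a judgement are the classes of its initial
parts, and these are the constants to which the types in the context collapse.\<close>

lemma collapse_spine:
  assumes "is_tts X"
  shows "(\<Gamma>s, IsTy U) \<in> der {S} X \<Longrightarrow> set \<Gamma>s \<subseteq> set \<Gamma> \<Longrightarrow>
    spine (free_tts {S} X) (collapse_ctx X \<Gamma>) (Suc (length \<Gamma>s)) (orbit (\<Gamma>s, IsTy U))
      (map (Var \<circ> fst) \<Gamma>s)"
proof (induction \<Gamma>s arbitrary: U rule: rev_induct)
  case Nil
  have "orbit ([], IsTy U) \<in> ty (free_tts {S} X) (Suc 0)"
    using free_tts_tyI[OF assms _ Nil(1)] by (simp add: degree_def)
  then show ?case by (simp add: spine.nil)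
next
  case (snoc v \<Gamma>')
  obtain y V where v: "v = (y, V)" by (cases v)
  let ?n = "Suc (length \<Gamma>')" and ?J = "(\<Gamma>' @ [(y, V)], IsTy U)"
  have J: "?J \<in> der {S} X" "is_type ?J" "degree ?J = Suc ?n"
    using snoc.prems(1) by (simp_all add: v degree_def)
  have V: "(\<Gamma>', IsTy V) \<in> der {S} X"
    using boundary_derived[OF assms _ J(1), of "(\<Gamma>', IsTy V)"] by simp
  have "spine (free_tts {S} X) (collapse_ctx X \<Gamma>) ?n (orbit (\<Gamma>', IsTy V)) (map (Var \<circ> fst) \<Gamma>')"
    using snoc.IH[OF V] snoc.prems(2) by (simp add: o_def)
  moreover have "orbit ?J \<in> ty (free_tts {S} X) (Suc ?n)"
    using free_tts_tyI[OF assms _ J] by simp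
  moreover have "ty_bd (free_tts {S} X) ?n (orbit ?J) = orbit (\<Gamma>', IsTy V)"
    using free_tts_ty_bd[OF assms _ J] by simp
  moreover have "(y, collapse X V) \<in> set (collapse_ctx X \<Gamma>)"
    using snoc.prems(2) by (force simp: v collapse_ctx_def)
  then have "arg_ok (free_tts {S} X) (collapse_ctx X \<Gamma>) ?n (orbit (\<Gamma>', IsTy V))
      (map (Var \<circ> fst) \<Gamma>') (Var y)"
    using collapse_subject[OF assms V] by (simp add: arg_ok_def elem_app_def degree_def)
  ultimately have "spine (free_tts {S} X) (collapse_ctx X \<Gamma>) (Suc ?n) (orbit ?J)
      (map (Var \<circ> fst) \<Gamma>' @ [Var y])"
    by (rule spine.snoc)
  then show ?case by (simp add: v o_def)
qed

lemma collapse_S_derived: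
  assumes "is_tts X" "(\<Gamma>s, R) \<in> der {S} X" "typing R" "set \<Gamma>s \<subseteq> set \<Gamma>"
    and ctx: "derived_ctx {W, P} (free_tts {S} X) (collapse_ctx X \<Gamma>)"
  shows "(collapse_ctx X \<Gamma>, map_rhs (collapse X) R) \<in> der {W, P} (free_tts {S} X)"
proof -
  let ?Y = "free_tts {S} X" and ?n = "Suc (length \<Gamma>s)"
  have Y: "is_tts ?Y" using free_tts_is_tts[OF assms(1), of "{S}"] by simp
  have sp: "spine ?Y (collapse_ctx X \<Gamma>) ?n (orbit (\<Gamma>s, IsTy U)) (map Var (map fst \<Gamma>s))"
    if "(\<Gamma>s, IsTy U) \<in> der {S} X" for U
    using collapse_spine[OF assms(1) that assms(4)] by simp
  have hatU: "collapse X U = App (Inl (?n, orbit (\<Gamma>s, IsTy U))) (map Var (map fst \<Gamma>s))"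
    if "(\<Gamma>s, IsTy U) \<in> der {S} X" for U
    using collapse_subject[OF assms(1) that] by (simp add: elem_app_def degree_def)
  have "typing (snd (\<Gamma>s, R))" using assms(3) by simp
  then show ?thesis
  proof (cases rule: typingE)
    case (ty \<Gamma>' U)
    then have U: "(\<Gamma>s, IsTy U) \<in> der {S} X" using assms(2) by simp
    from var_spine_type[OF Y _ ctx sp[OF U]] show ?thesis using ty by (simp add: hatU[OF U])
  next
    case (tm \<Gamma>' u U)
    let ?a = "orbit (\<Gamma>s, HasTy u U)"
    have u: "(\<Gamma>s, HasTy u U) \<in> der {S} X" using assms(2) tm by simp
    have U: "(\<Gamma>s, IsTy U) \<in> der {S} X" using derived_HasTy[OF assms(1) _ u] by simp
    have "?a \<in> tm ?Y ?n" using free_tts_tmI[OF assms(1) _ u] by (simp add: degree_def)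
    moreover have "tm_bd ?Y ?n ?a = orbit (\<Gamma>s, IsTy U)" using free_tts_tm_bd[OF assms(1) _ u] by simp
    moreover have "collapse X u = App (Inr (?n, ?a)) (map Var (map fst \<Gamma>s))"
      using collapse_subject[OF assms(1) u] by (simp add: elem_app_def degree_def)
    ultimately show ?thesis
      using var_spine_term[OF Y _ ctx sp[OF U]] tm by (simp add: hatU[OF U])
  qed
qed

lemma collapse_ctx_derived:
  assumes "is_tts X" "gat_rules D" "derived_ctx D X \<Gamma>"
  shows "derived_ctx {W, P} (free_tts {S} X) (collapse_ctx X \<Gamma>)"
  using assms(3)
proof (induction \<Gamma> rule: rev_induct)
  case Nil
  then show ?case by (simp add: collapse_ctx_def)
next
  case (snoc v \<Gamma>)
  obtain x T where v: "v = (x, T)" by (cases v)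
  have ctx: "derived_ctx D X \<Gamma>" "x \<notin> fst ` set \<Gamma>" "(\<Gamma>, IsTy T) \<in> der D X"
    using snoc.prems by (simp_all add: v)
  obtain \<Gamma>s where "(\<Gamma>s, IsTy T) \<in> der {S} X" "set \<Gamma>s \<subseteq> set \<Gamma>"
    using derived_S_part[OF assms(1,2) ctx(3)] by auto
  from collapse_S_derived[OF assms(1) this(1) _ this(2) snoc.IH[OF ctx(1)]]
  have "(collapse_ctx X \<Gamma>, IsTy (collapse X T)) \<in> der {W, P} (free_tts {S} X)" by simp
  moreover have "x \<notin> fst ` set (collapse_ctx X \<Gamma>)"
    using ctx(2) by (simp add: collapse_ctx_def image_image case_prod_unfold)
  ultimately show ?case using snoc.IH[OF ctx(1)] by (simp add: v collapse_ctx_def)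
qed

lemma collapse_judg_derived:
  assumes "is_tts X" "gat_rules D" "J \<in> der D X" "typing (snd J)"
  shows "collapse_judg X J \<in> der {W, P} (free_tts {S} X)"
proof -
  have Y: "is_tts (free_tts {S} X)" using free_tts_is_tts[OF assms(1), of "{S}"] by simp
  obtain \<Gamma> R where J: "J = (\<Gamma>, R)" by (cases J)
  have ctx: "derived_ctx {W, P} (free_tts {S} X) (collapse_ctx X \<Gamma>)"
    using collapse_ctx_derived[OF assms(1,2) derived_ctx_derived[OF assms]] by (simp add: J)
  from derived_S_part[OF assms(1,2)] assms(3,4)
  consider (var) y T where "R = HasTy (Var y) T" "(y, T) \<in> set \<Gamma>"
    | (app) \<Gamma>s where "(\<Gamma>s, R) \<in> der {S} X" "set \<Gamma>s \<subseteq> set \<Gamma>"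
    unfolding J snd_conv by blast
  then show ?thesis
  proof cases
    case var
    have "(y, collapse X T) \<in> set (collapse_ctx X \<Gamma>)" using var(2) by (force simp: collapse_ctx_def)
    from var_derived[OF Y _ _ ctx this] show ?thesis by (simp add: collapse_judg_def J var(1))
  next
    case app
    from collapse_S_derived[OF assms(1) app(1) _ app(2) ctx] assms(4) show ?thesis by (simp add: collapse_judg_def J)
  qed
qed

lemma translate_judg_collapse_judg:
  assumes "is_tts X" "gat_rules D" "J \<in> der D X" "typing (snd J)"
  shows "translate_judg expand (collapse_judg X J) = J"
proof -
  have "translate expand (collapse X e) = e" if e: "e \<in> snd ` set (fst J) \<union> exprs (snd J)" for e
  proof -
    obtain \<Gamma> R where R: "(\<Gamma>, R) \<in> der D X" "typing R" "subject R = e"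
      using derived_expr_subject[OF assms e] by blast
    from derived_S_part[OF assms(1,2) R(1,2)]
    consider (var) y where "e = Var y" | (app) \<Gamma>s where "(\<Gamma>s, R) \<in> der {S} X"
      using R(3) by auto
    then show ?thesis
    proof cases
      case app
      have "translate expand (elem_app (\<Gamma>s, R)) = subject R"
        using translate_expand_elem_app[OF assms(1) _ app] R(2) by simp
      moreover have "collapse X (subject R) = elem_app (\<Gamma>s, R)"
        using collapse_subject[OF assms(1) app] R(2) by simp
      ultimately show ?thesis by (simp add: R(3)[symmetric])
    qed simp
  qed
  from map_judgement_id[of J "\<lambda>e. translate expand (collapse X e)", OF this] show ?thesis
    by (simp add: translate_judg_def collapse_judg_def collapse_ctx_def rhs.map_comp o_def case_prod_unfold)
qed

text \<open>A class applied to arbitrary distinct variables is the class of a representative applied to the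
variables of its own context.\<close>

lemma elem_app_of_orbit:
  assumes "is_tts X" "gat_rules D" "J \<in> der D X" "typing (snd J)"
    and "distinct ys" "degree J = Suc (length ys)"
  shows "\<exists>K\<in>der D X. typing (snd K) \<and> elem_app K =
    App (if is_type J then Inl (degree J, orbit J) else Inr (degree J, orbit J)) (map Var ys)"
proof -
  obtain \<pi> where \<pi>: "bij \<pi>" "map fst (fst (permute \<pi> J)) = ys"
    using canonical_exists[OF assms(1-5)] assms(6) by (auto simp: degree_def)
  then have "map (Var \<circ> fst) (fst (permute \<pi> J)) = map Var ys" by (metis map_map)
  then show ?thesis
    using derived_perm[OF assms(3) \<pi>(1)] assms(4)
    by (intro bexI[of _ "permute \<pi> J"]) (simp_all add: elem_app_def orbit_permute[OF \<pi>(1)] typing_iff)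
qed

lemma P_derived_collapsed:
  assumes "is_tts X" "(\<Gamma>, R) \<in> der {W, P} (free_tts {S} X)" "typing R"
  shows "(\<exists>y. subject R = Var y) \<or> (\<exists>K\<in>der {S} X. typing (snd K) \<and> subject R = elem_app K)"
proof -
  let ?Y = "free_tts {S} X"
  have Y: "is_tts ?Y" using free_tts_is_tts[OF assms(1), of "{S}"] by simp
  have ok: "judg_ok {W, P} ?Y (\<Gamma>, R)" using derived_ok[OF Y _ assms(2)] assms(3) by simp
  have ctx: "ctx_all (ty_ok ?Y) \<Gamma>" using derived_ctx_ok[OF Y _ assms(2)] assms(3) by simp
  have vars: "\<exists>ys. es = map Var ys \<and> distinct ys \<and> n = Suc (length ys)"
    if sp: "spine ?Y \<Gamma> n A es" and app: "var_app (App (Inl (n, A)) es)" for n A es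
  proof -
    obtain ys where ys: "es = map Var ys" using app by (auto simp: var_app_def)
    from spine_to_linear_spine[OF ctx sp] obtain \<Delta> where \<Delta>: "linear_spine ?Y \<Delta> n A es" by blast
    have "distinct ys" using ctx_all_distinct[OF linear_spine_full[OF \<Delta>]] linear_spine_vars[OF \<Delta> ys] by simp
    then show ?thesis using ys spine_props[OF sp] by auto
  qed
  have va: "var_judg (\<Gamma>, R)" using P_derived_var_judg[OF assms(2)] assms(3) by simp
  have "typing (snd (\<Gamma>, R))" using assms(3) by simp
  then show ?thesis
  proof (cases rule: typingE)
    case (ty \<Gamma>' T)
    then obtain n A es where T: "T = App (Inl (n, A)) es" "spine ?Y \<Gamma> n A es"
      using ok by (auto simp: judg_ok_def ty_ok_def)
    obtain ys where ys: "es = map Var ys" "distinct ys" "n = Suc (length ys)"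
      using vars[OF T(2)] va T(1) ty by (auto simp: var_judg_def)
    obtain J where J: "J \<in> der {S} X" "is_type J" "degree J = n" "A = orbit J"
      using free_tts_ty[OF assms(1), of "{S}" A n] spine_props[OF T(2)] by auto
    show ?thesis
      using elem_app_of_orbit[OF assms(1) _ J(1) _ ys(2)] J ys T(1) ty by (auto simp: typing_iff)
  next
    case (tm \<Gamma>' t T)
    then obtain n A es where T: "T = App (Inl (n, A)) es" "spine ?Y \<Gamma> n A es" "arg_ok ?Y \<Gamma> n A es t"
      using ok by (auto simp: judg_ok_def tm_ok_def)
    obtain ys where ys: "es = map Var ys" "distinct ys" "n = Suc (length ys)"
      using vars[OF T(2)] va T(1) tm by (auto simp: var_judg_def)
    from T(3) consider (var) y where "t = Var y" | (app) a where "a \<in> tm ?Y n" "t = App (Inr (n, a)) es"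
      unfolding arg_ok_def by blast
    then show ?thesis
    proof cases
      case var
      then show ?thesis using tm by simp
    next
      case app
      obtain J where J: "J \<in> der {S} X" "is_term J" "degree J = n" "a = orbit J"
        using free_tts_tm[OF assms(1), of "{S}" a n] app(1) by auto
      then have "\<not> is_type J" by (cases J rule: is_term.cases) auto
      then show ?thesis
        using elem_app_of_orbit[OF assms(1) _ J(1) _ ys(2)] J ys app(2) tm by (auto simp: typing_iff)
    qed
  qed
qed

lemma collapse_judg_translate_judg:
  assumes "is_tts X" "J \<in> der {W, P} (free_tts {S} X)" "typing (snd J)"
  shows "collapse_judg X (translate_judg expand J) = J"
proof -
  have Y: "is_tts (free_tts {S} X)" using free_tts_is_tts[OF assms(1), of "{S}"] by simp
  have "collapse X (translate expand e) = e" if e: "e \<in> snd ` set (fst J) \<union> exprs (snd J)" for e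
  proof -
    obtain \<Gamma> R where R: "(\<Gamma>, R) \<in> der {W, P} (free_tts {S} X)" "typing R" "subject R = e"
      using derived_expr_subject[OF Y _ assms(2,3) e] by auto
    from P_derived_collapsed[OF assms(1) R(1,2)]
    consider (var) y where "e = Var y" | (app) K where "K \<in> der {S} X" "typing (snd K)" "e = elem_app K"
      using R(3) by auto
    then show ?thesis
    proof cases
      case app
      then show ?thesis
        using translate_expand_elem_app[OF assms(1) _ app(1,2)] collapse_subject[OF assms(1) app(1,2)] by simp
    qed simp
  qed
  from map_judgement_id[of J "\<lambda>e. collapse X (translate expand e)", OF this] show ?thesis
    by (simp add: translate_judg_def collapse_judg_def collapse_ctx_def rhs.map_comp o_def case_prod_unfold)
qed

section \<open>The comparison map\<close>

text \<open>The class of a judgement does not depend on the set of rules, so \<open>\<rho>\<close> and \<open>\<sigma>\<close> act as inclusions.\<close>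

lemma to_T_orbit:
  assumes "is_tts X" "gat_rules D" "J \<in> der D X" "typing (snd J)"
  shows "on_ty (to_T D' X) n (orbit J) = orbit J" "on_tm (to_T D' X) n (orbit J) = orbit J"
proof -
  have "(\<Union>J'\<in>orbit J. judg_class T_rules (free_gat X) J') = orbit J"
  proof (rule UN_orbit)
    fix \<pi> :: "var \<Rightarrow> var"
    assume "bij \<pi>"
    have "D \<subseteq> T_rules" using structural.exhaust by auto
    then have "permute \<pi> J \<in> der T_rules X"
      using derived_mono[OF derived_perm[OF assms(3) \<open>bij \<pi>\<close>]] by blast
    moreover have "typing (snd (permute \<pi> J))" using assms(4) by (simp add: typing_iff)
    ultimately have "judg_class T_rules (free_gat X) (permute \<pi> J) = orbit (permute \<pi> J)"
      by (intro judg_class_eq_orbit[OF assms(1)]) simp_all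
    then show "judg_class T_rules (free_gat X) (permute \<pi> J) = orbit J"
      by (simp add: orbit_permute[OF \<open>bij \<pi>\<close>])
  qed
  then show "on_ty (to_T D' X) n (orbit J) = orbit J" "on_tm (to_T D' X) n (orbit J) = orbit J"
    by (simp_all add: to_T_def)
qed

lemma sigma_id:
  assumes "is_tts X"
  shows "c \<in> ty (free_tts {S} X) n \<Longrightarrow> on_ty (sigma X) n c = c"
    "d \<in> tm (free_tts {S} X) n \<Longrightarrow> on_tm (sigma X) n d = d"
proof -
  assume "c \<in> ty (free_tts {S} X) n"
  then obtain J where "J \<in> der {S} X" "is_type J" "c = orbit J"
    using free_tts_ty[OF assms, of "{S}" c n] by auto
  then show "on_ty (sigma X) n c = c"
    using to_T_orbit(1)[OF assms, of "{S}" J] by (simp add: sigma_def typing_iff)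
next
  assume "d \<in> tm (free_tts {S} X) n"
  then obtain J where "J \<in> der {S} X" "is_term J" "d = orbit J"
    using free_tts_tm[OF assms, of "{S}" d n] by auto
  then show "on_tm (sigma X) n d = d"
    using to_T_orbit(2)[OF assms, of "{S}" J] by (simp add: sigma_def typing_iff)
qed

lemma sigma_map:
  assumes "is_tts X"
  shows "is_tts_map (free_tts {S} X) (free_tts T_rules X) (sigma X)"
proof -
  let ?Y = "free_tts {S} X" and ?Z = "free_tts T_rules X"
  have Y: "is_tts ?Y" using free_tts_is_tts[OF assms, of "{S}"] by simp
  have Z: "is_tts ?Z" using free_tts_is_tts[OF assms, of T_rules] by simp
  have ty: "\<exists>J\<in>der {S} X. J \<in> der T_rules X \<and> is_type J \<and> degree J = n \<and> c = orbit J"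
    if "c \<in> ty ?Y n" for c n
    using that free_tts_ty[OF assms, of "{S}" c n] derived_mono[of _ "{S}" _ T_rules] by auto
  have tm: "\<exists>J\<in>der {S} X. J \<in> der T_rules X \<and> is_term J \<and> degree J = n \<and> c = orbit J"
    if "c \<in> tm ?Y n" for c n
    using that free_tts_tm[OF assms, of "{S}" c n] derived_mono[of _ "{S}" _ T_rules] by auto
  show ?thesis
    unfolding is_tts_map_def
  proof (intro conjI allI impI ballI Y Z)
    fix n :: nat
    assume n: "n \<ge> 1"
    show "on_ty (sigma X) n c \<in> ty ?Z n" if "c \<in> ty ?Y n" for c
      using ty[OF that] sigma_id(1)[OF assms that] free_tts_tyI[OF assms, of T_rules _ n] by auto
    show "on_tm (sigma X) n c \<in> tm ?Z n" if "c \<in> tm ?Y n" for c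
      using tm[OF that] sigma_id(2)[OF assms that] free_tts_tmI[OF assms, of T_rules _ n] by auto
    show "ty_bd ?Z n (on_ty (sigma X) (Suc n) c) = on_ty (sigma X) n (ty_bd ?Y n c)"
      if c: "c \<in> ty ?Y (Suc n)" for c
    proof -
      obtain J where J: "J \<in> der {S} X" "J \<in> der T_rules X" "is_type J" "degree J = Suc n" "c = orbit J"
        using ty[OF c] by blast
      have "ty_bd ?Z n c = ty_bd ?Y n c"
        using free_tts_ty_bd[OF assms _ J(2-4) n] free_tts_ty_bd[OF assms _ J(1,3,4) n] J(5) by simp
      then show ?thesis
        using sigma_id(1)[OF assms c] sigma_id(1)[OF assms tts_ty_bd[OF Y n c]] by simp
    qed
    show "tm_bd ?Z n (on_tm (sigma X) n c) = on_ty (sigma X) n (tm_bd ?Y n c)"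
      if c: "c \<in> tm ?Y n" for c
    proof -
      obtain J where J: "J \<in> der {S} X" "J \<in> der T_rules X" "is_term J" "c = orbit J"
        using tm[OF c] by blast
      have "tm_bd ?Z n c = tm_bd ?Y n c"
        using free_tts_tm_bd[OF assms _ J(2,3)] free_tts_tm_bd[OF assms _ J(1,3)] J(4) by simp
      then show ?thesis
        using sigma_id(2)[OF assms c] sigma_id(1)[OF assms tts_tm_bd[OF Y n c]] by simp
    qed
  qed
qed

lemma tts_comp_map: "is_tts_map X Y f \<Longrightarrow> is_tts_map Y Z g \<Longrightarrow> is_tts_map X Z (tts_comp g f)"
  by (simp add: is_tts_map_def tts_comp_def)

lemma adj_unit_orbit:
  assumes "is_tts X" "gat_rules D" "n \<ge> 1"
  shows "A \<in> ty X n \<Longrightarrow> on_ty (adj_unit D X) n A = orbit (ty_basic X n A)"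
    "a \<in> tm X n \<Longrightarrow> on_tm (adj_unit D X) n a = orbit (tm_basic X n a)"
  using judg_class_eq_orbit[OF assms(1,2) ty_basic_derived[OF assms(1,3), of A D]]
    judg_class_eq_orbit[OF assms(1,2) tm_basic_derived[OF assms(1,3), of a D]]
  by (simp_all add: adj_unit_def ty_basic_def tm_basic_def)

lemma adj_unit_map:
  assumes "is_tts X" "gat_rules D"
  shows "is_tts_map X (free_tts D X) (adj_unit D X)"
  unfolding is_tts_map_def
proof (intro conjI allI impI ballI)
  show "is_tts X" "is_tts (free_tts D X)" by (rule assms(1), rule free_tts_is_tts[OF assms])
  fix n :: nat
  assume n: "n \<ge> 1"
  have deg: "is_type (ty_basic X k A)" "degree (ty_basic X k A) = k"
    "is_term (tm_basic X k a)" "degree (tm_basic X k a) = k" if "k \<ge> 1" for k A a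
    using that by (simp_all add: ty_basic_def tm_basic_def degree_def)
  note orb = adj_unit_orbit[OF assms n]
  show "on_ty (adj_unit D X) n A \<in> ty (free_tts D X) n" if "A \<in> ty X n" for A
    unfolding orb(1)[OF that] by (rule free_tts_tyI[OF assms ty_basic_derived[OF assms(1) n that] deg(1,2)[OF n]])
  show "on_tm (adj_unit D X) n a \<in> tm (free_tts D X) n" if "a \<in> tm X n" for a
    unfolding orb(2)[OF that] by (rule free_tts_tmI[OF assms tm_basic_derived[OF assms(1) n that] deg(3,4)[OF n]])
  have n': "Suc n \<ge> 1" by simp
  show "ty_bd (free_tts D X) n (on_ty (adj_unit D X) (Suc n) A) = on_ty (adj_unit D X) n (ty_bd X n A)"
    if A: "A \<in> ty X (Suc n)" for A
    unfolding adj_unit_orbit(1)[OF assms n' A] orb(1)[OF tts_ty_bd[OF assms(1) n A]]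
    using free_tts_ty_bd[OF assms ty_basic_derived[OF assms(1) n' A] deg(1,2)[OF n'] n]
    by (simp add: boundary_ty_basic[OF n])
  show "tm_bd (free_tts D X) n (on_tm (adj_unit D X) n a) = on_ty (adj_unit D X) n (tm_bd X n a)"
    if a: "a \<in> tm X n" for a
    unfolding orb(2)[OF a] orb(1)[OF tts_tm_bd[OF assms(1) n a]]
    using free_tts_tm_bd[OF assms tm_basic_derived[OF assms(1) n a] deg(3)[OF n]]
    by (simp add: boundary_tm_basic)
qed

text \<open>The templates by which a constant translates to itself.\<close>

definition elem_template :: "('a, 'b) elem_sym \<Rightarrow> ('a, 'b) elem_sym expr" where
  "elem_template s = (case s of Inl (n, A) \<Rightarrow> ty_elem_expr n A | Inr (n, a) \<Rightarrow> tm_elem_expr n a)"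

lemma translate_elem_template:
  assumes "length es = n - 1" "map (translate elem_template) es = es"
  shows "translate elem_template (App (Inl (n, A)) es) = App (Inl (n, A)) es"
    "translate elem_template (App (Inr (n, a)) es) = App (Inr (n, a)) es"
proof -
  have "map (inst_args es) [1..<n] = es"
    using assms(1) by (intro nth_equalityI) (simp_all add: inst_args_def del: upt_Suc)
  then show "translate elem_template (App (Inl (n, A)) es) = App (Inl (n, A)) es"
    "translate elem_template (App (Inr (n, a)) es) = App (Inr (n, a)) es"
    using assms(2) by (simp_all add: elem_template_def)
qed

lemma spine_elem_template: "spine X \<Gamma> n A es \<Longrightarrow> map (translate elem_template) es = es"
proof (induction rule: spine.induct)
  case (snoc n B es A t)
  then have "length es = n - 1" using spine_props[OF snoc.hyps(1)] by simp
  then show ?case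
    using snoc translate_elem_template[of es n] unfolding arg_ok_def by auto
qed simp

lemma translate_judg_elem_template:
  assumes "is_tts X" "gat_rules D" "J \<in> der D X" "typing (snd J)"
  shows "translate_judg elem_template J = J"
proof -
  have "translate elem_template e = e" if e: "e \<in> snd ` set (fst J) \<union> exprs (snd J)" for e
  proof -
    obtain \<Gamma> R where R: "(\<Gamma>, R) \<in> der D X" "typing (snd (\<Gamma>, R))" "subject R = e"
      using derived_expr_subject[OF assms e] by auto
    have ok: "judg_ok D X (\<Gamma>, R)" by (rule derived_ok[OF assms(1,2) R(1,2)])
    obtain n A es where sp: "spine X \<Gamma> n A es"
      and "e = App (Inl (n, A)) es \<or> arg_ok X \<Gamma> n A es e"
      using R(2)
    proof (cases rule: typingE)
      case (ty \<Gamma>' U)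
      then show thesis using that ok R(3) by (auto simp: judg_ok_def ty_ok_def)
    next
      case (tm \<Gamma>' u U)
      then show thesis using that ok R(3) by (auto simp: judg_ok_def tm_ok_def)
    qed
    moreover have "length es = n - 1" using spine_props[OF sp] by simp
    note translate_elem_template[OF this spine_elem_template[OF sp]]
    ultimately show ?thesis unfolding arg_ok_def by auto
  qed
  from map_judgement_id[of J "translate elem_template", OF this] show ?thesis by (simp add: translate_judg_def)
qed

text \<open>As \<open>\<sigma>\<close> does not change classes, \<open>P \<sigma>\<close> only regards constants from \<open>S X\<close> as constants from \<open>T X\<close>.\<close>

lemma unit_sigma_template:
  assumes "is_tts X"
  shows "template (free_tts {S} X)
    (tts_comp (adj_unit P_rules (free_tts T_rules X)) (sigma X)) elem_template"
  unfolding template_def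
proof (intro conjI allI impI ballI)
  let ?Y = "free_tts {S} X" and ?Z = "free_tts T_rules X"
  fix n :: nat
  assume n: "n \<ge> 1"
  have Z: "is_tts ?Z" using free_tts_is_tts[OF assms, of T_rules] by simp
  note in_Z = sigma_map[OF assms, unfolded is_tts_map_def] sigma_id[OF assms, of _ n]
  show "\<exists>\<Gamma>. (\<Gamma>, IsTy (elem_template (Inl (n, A)))) \<in> on_ty (tts_comp (adj_unit P_rules ?Z) (sigma X)) n A \<and>
      map fst \<Gamma> = [1..<n]" if A: "A \<in> ty ?Y n" for A
  proof -
    have "A \<in> ty ?Z n" using in_Z n A by metis
    then show ?thesis
      using orbit_self[of "ty_basic ?Z n A"] adj_unit_orbit(1)[OF Z _ n, of P_rules A] in_Z(2)[OF A]
      by (intro exI[of _ "elem_ctx ?Z n A"]) (simp add: tts_comp_def ty_basic_def elem_template_def)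
  qed
  show "\<exists>\<Gamma> T. (\<Gamma>, HasTy (elem_template (Inr (n, a))) T) \<in> on_tm (tts_comp (adj_unit P_rules ?Z) (sigma X)) n a \<and>
      map fst \<Gamma> = [1..<n]" if a: "a \<in> tm ?Y n" for a
  proof -
    have "a \<in> tm ?Z n" using in_Z n a by metis
    then show ?thesis
      using orbit_self[of "tm_basic ?Z n a"] adj_unit_orbit(2)[OF Z _ n, of P_rules a] in_Z(3)[OF a]
      by (intro exI[of _ "elem_ctx ?Z n (tm_bd ?Z n a)"] exI[of _ "ty_elem_expr n (tm_bd ?Z n a)"])
        (simp add: tts_comp_def tm_basic_def elem_template_def)
  qed
qed

lemma counit_template:
  assumes "is_tts X"
  defines "Z \<equiv> free_tts T_rules X"
  shows "is_tts_map Z Z tts_id" "template Z tts_id expand"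
proof -
  have WP: "gat_rules T_rules" by simp
  have "is_tts Z" unfolding Z_def by (rule free_tts_is_tts[OF assms(1) WP])
  then show "is_tts_map Z Z tts_id" by (simp add: is_tts_map_def tts_id_def)
  have can: "canonical (degree J) (orbit J) \<in> orbit J"
    "map fst (fst (canonical (degree J) (orbit J))) = [1..<degree J]"
    if der: "J \<in> der T_rules X" and pr: "typing (snd J)" for J
  proof -
    obtain \<pi> where \<pi>: "bij \<pi>" "map fst (fst (permute \<pi> J)) = [1..<degree J]"
      using canonical_exists[OF assms(1) WP der pr, of "[1..<degree J]"]
      by (auto simp: degree_def simp del: upt_Suc)
    then show "canonical (degree J) (orbit J) \<in> orbit J"
      "map fst (fst (canonical (degree J) (orbit J))) = [1..<degree J]"
      unfolding canonical_orbit[OF assms(1) WP der pr \<pi>] by (auto simp: orbit_def)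
  qed
  show "template Z tts_id expand"
    unfolding template_def
  proof (intro conjI allI impI ballI)
    fix n :: nat
    assume n: "n \<ge> 1"
    show "\<exists>\<Gamma>. (\<Gamma>, IsTy (expand (Inl (n, A)))) \<in> on_ty tts_id n A \<and> map fst \<Gamma> = [1..<n]"
      if A: "A \<in> ty Z n" for A
    proof -
      obtain J where J: "J \<in> der T_rules X" "is_type J" "degree J = n" "A = orbit J"
        using A free_tts_ty[OF assms(1) WP] unfolding Z_def by blast
      define K where "K = canonical n A"
      have K: "K \<in> A" "canonical n A = K" "map fst (fst K) = [1..<n]"
        using can[OF J(1)] J(2-4) by (simp_all add: typing_iff K_def)
      have "is_type K" using K(1) J(2,4) by (auto simp: orbit_def)
      then obtain \<Gamma> U where "K = (\<Gamma>, IsTy U)" by (rule is_typeE)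
      then show ?thesis using K by (intro exI[of _ \<Gamma>]) (simp add: tts_id_def expand_def)
    qed
    show "\<exists>\<Gamma> T. (\<Gamma>, HasTy (expand (Inr (n, a))) T) \<in> on_tm tts_id n a \<and> map fst \<Gamma> = [1..<n]"
      if a: "a \<in> tm Z n" for a
    proof -
      obtain J where J: "J \<in> der T_rules X" "is_term J" "degree J = n" "a = orbit J"
        using a free_tts_tm[OF assms(1) WP] unfolding Z_def by blast
      define K where "K = canonical n a"
      have K: "K \<in> a" "canonical n a = K" "map fst (fst K) = [1..<n]"
        using can[OF J(1)] J(2-4) by (simp_all add: typing_iff K_def)
      have "is_term K" using K(1) J(2,4) by (auto simp: orbit_def)
      then obtain \<Gamma> u U where "K = (\<Gamma>, HasTy u U)" by (rule is_termE)
      then show ?thesis using K by (intro exI[of _ \<Gamma>] exI[of _ U]) (simp add: tts_id_def expand_def)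
    qed
  qed
qed

text \<open>The first two maps of the composite do not change the class, and the multiplication replaces each
constant, a class, by its canonical representative.\<close>

lemma kappa_orbit:
  assumes "is_tts X" "J \<in> der P_rules (free_tts {S} X)" "typing (snd J)"
  shows "on_ty (kappa X) n (orbit J) = orbit (translate_judg expand J)"
    "on_tm (kappa X) n (orbit J) = orbit (translate_judg expand J)"
    "translate_judg expand J \<in> der T_rules X"
proof -
  let ?Y = "free_tts {S} X" and ?Z = "free_tts T_rules X"
  have WP: "gat_rules P_rules" "gat_rules T_rules" by simp_all
  have Z: "is_tts ?Z" using free_tts_is_tts[OF assms(1), of T_rules] by simp
  have Y: "is_tts ?Y" using free_tts_is_tts[OF assms(1), of "{S}"] by simp
  note us = tts_comp_map[OF sigma_map[OF assms(1)] adj_unit_map[OF Z WP(1)]] unit_sigma_template[OF assms(1)]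
  note ct = counit_template[OF assms(1)]
  have "translate_judg elem_template J = J" by (rule translate_judg_elem_template[OF Y WP(1) assms(2,3)])
  then have map: "on_ty (monad_map P_rules ?Y ?Z (sigma X)) n (orbit J) = orbit J"
    "on_tm (monad_map P_rules ?Y ?Z (sigma X)) n (orbit J) = orbit J"
    and JZ: "J \<in> der P_rules ?Z"
    using forget_map_transpose[OF Z WP(1) us assms(2,3), of n]
      interpD(1)[OF translate_judg_interp[OF Z WP(1) us] assms(2)]
    by (simp_all add: monad_map_def free_map_def)
  have JT: "J \<in> der T_rules ?Z" using derived_mono[OF JZ, of T_rules] by blast
  have rho: "on_ty (rho ?Z) n (orbit J) = orbit J" "on_tm (rho ?Z) n (orbit J) = orbit J"
    using to_T_orbit[OF Z WP(1) JZ assms(3)] by (simp_all add: rho_def)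
  have mult: "on_ty (monad_mult T_rules X) n (orbit J) = orbit (translate_judg expand J)"
    "on_tm (monad_mult T_rules X) n (orbit J) = orbit (translate_judg expand J)"
    using forget_map_transpose[OF assms(1) WP(2) ct JT assms(3), of n]
    by (simp_all add: monad_mult_def adj_counit_def)
  show "on_ty (kappa X) n (orbit J) = orbit (translate_judg expand J)"
    "on_tm (kappa X) n (orbit J) = orbit (translate_judg expand J)"
    using map rho mult by (simp_all add: kappa_def tts_comp_def monad_obj_def)
  show "translate_judg expand J \<in> der T_rules X"
    using interpD(1)[OF translate_judg_interp[OF assms(1) WP(2) ct] JT] .
qed

lemma tts_invertibleI:
  assumes "is_tts_map X Y f"
    and ty: "\<And>n. n \<ge> 1 \<Longrightarrow> bij_betw (on_ty f n) (ty X n) (ty Y n)"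
    and tm: "\<And>n. n \<ge> 1 \<Longrightarrow> bij_betw (on_tm f n) (tm X n) (tm Y n)"
  shows "tts_invertible X Y f"
proof -
  define g where "g = \<lparr>on_ty = \<lambda>n. the_inv_into (ty X n) (on_ty f n),
    on_tm = \<lambda>n. the_inv_into (tm X n) (on_tm f n)\<rparr>"
  have X: "is_tts X" and Y: "is_tts Y" using assms(1) by (simp_all add: is_tts_map_def)
  have g: "on_ty g n B \<in> ty X n" "on_ty f n (on_ty g n B) = B" if "n \<ge> 1" "B \<in> ty Y n" for n B
    using ty[OF that(1)] that(2) the_inv_into_into[of "on_ty f n" "ty X n" B "ty X n"]
      f_the_inv_into_f_bij_betw[of "on_ty f n" "ty X n" "ty Y n" B]
    by (simp_all add: g_def bij_betw_def)
  have gt: "on_tm g n b \<in> tm X n" "on_tm f n (on_tm g n b) = b" if "n \<ge> 1" "b \<in> tm Y n" for n b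
    using tm[OF that(1)] that(2) the_inv_into_into[of "on_tm f n" "tm X n" b "tm X n"]
      f_the_inv_into_f_bij_betw[of "on_tm f n" "tm X n" "tm Y n" b]
    by (simp_all add: g_def bij_betw_def)
  have gf: "on_ty g n (on_ty f n A) = A" if "n \<ge> 1" "A \<in> ty X n" for n A
    using ty[OF that(1)] that(2) by (simp add: g_def bij_betw_def the_inv_into_f_f)
  have gft: "on_tm g n (on_tm f n a) = a" if "n \<ge> 1" "a \<in> tm X n" for n a
    using tm[OF that(1)] that(2) by (simp add: g_def bij_betw_def the_inv_into_f_f)
  have "is_tts_map Y X g"
    unfolding is_tts_map_def
  proof (intro conjI allI impI ballI X Y)
    fix n :: nat
    assume n: "n \<ge> 1"
    show "on_ty g n B \<in> ty X n" if "B \<in> ty Y n" for B using g(1)[OF n that] .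
    show "on_tm g n b \<in> tm X n" if "b \<in> tm Y n" for b using gt(1)[OF n that] .
    show "ty_bd X n (on_ty g (Suc n) B) = on_ty g n (ty_bd Y n B)" if B: "B \<in> ty Y (Suc n)" for B
    proof -
      have gB: "on_ty g (Suc n) B \<in> ty X (Suc n)" "on_ty f (Suc n) (on_ty g (Suc n) B) = B"
        using g[of "Suc n" B] B by simp_all
      then have "ty_bd Y n B = on_ty f n (ty_bd X n (on_ty g (Suc n) B))"
        using assms(1) n unfolding is_tts_map_def by metis
      then show ?thesis using gf[OF n tts_ty_bd[OF X n gB(1)]] by simp
    qed
    show "tm_bd X n (on_tm g n b) = on_ty g n (tm_bd Y n b)" if b: "b \<in> tm Y n" for b
    proof -
      have "tm_bd Y n b = on_ty f n (tm_bd X n (on_tm g n b))"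
        using assms(1) n gt[OF n b] unfolding is_tts_map_def by metis
      then show ?thesis using gf[OF n tts_tm_bd[OF X n gt(1)[OF n b]]] by simp
    qed
  qed
  then show ?thesis
    using assms(1) g(2) gt(2) gf gft
    by (auto simp: tts_invertible_def tts_map_eq_def tts_comp_def tts_id_def)
qed

text \<open>Collapsing commutes with the renaming that relates the two expansions, because expansion does.\<close>

lemma translate_judg_expand_inj:
  assumes "is_tts X" and "J \<in> der P_rules (free_tts {S} X)" "typing (snd J)"
    and "J' \<in> der P_rules (free_tts {S} X)" "typing (snd J')"
    and "orbit (translate_judg expand J) = orbit (translate_judg expand J')"
  shows "orbit J = orbit J'"
proof -
  have "translate_judg expand J' \<in> orbit (translate_judg expand J)" using assms(6) orbit_self by blast
  then obtain \<pi> where \<pi>: "bij \<pi>" "translate_judg expand J' = permute \<pi> (translate_judg expand J)"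
    by (auto simp: orbit_def)
  have "J' = collapse_judg X (translate_judg expand J')" using collapse_judg_translate_judg[OF assms(1,4,5)] by simp
  also have "\<dots> = collapse_judg X (translate_judg expand (permute \<pi> J))" by (simp add: \<pi>(2) translate_judg_permute)
  also have "\<dots> = permute \<pi> J"
    using collapse_judg_translate_judg[OF assms(1) derived_perm[OF assms(2) \<pi>(1)]] assms(3) by (simp add: typing_iff)
  finally show ?thesis by (simp add: orbit_permute[OF \<pi>(1)])
qed

lemma is_type_collapse_judg [simp]: "is_type (collapse_judg X J) = is_type J"
  by (cases J rule: is_type.cases) (auto simp: collapse_judg_def)

lemma is_term_collapse_judg [simp]: "is_term (collapse_judg X J) = is_term J"
  by (cases J rule: is_term.cases) (auto simp: collapse_judg_def)

lemma degree_collapse_judg [simp]: "degree (collapse_judg X J) = degree J"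
  by (simp add: collapse_judg_def collapse_ctx_def degree_def)

text \<open>Injective and surjective by the two round trips of expanding and collapsing.  The predicates \<open>Q\<close> and
\<open>Q'\<close> select the type judgements or the term judgements of the two theories.\<close>

lemma bij_of_expand:
  assumes "is_tts X"
    and A: "\<And>c. c \<in> A \<longleftrightarrow> (\<exists>J\<in>der P_rules (free_tts {S} X). Q J \<and> degree J = n \<and> c = orbit J)"
    and B: "\<And>c. c \<in> B \<longleftrightarrow> (\<exists>J\<in>der T_rules X. Q' J \<and> degree J = n \<and> c = orbit J)"
    and F: "\<And>J. J \<in> der P_rules (free_tts {S} X) \<Longrightarrow> Q J \<Longrightarrow>
      F (orbit J) = orbit (translate_judg expand J) \<and> translate_judg expand J \<in> der T_rules X"
    and typing: "\<And>J. Q J \<Longrightarrow> typing (snd J)" "\<And>J. Q' J \<Longrightarrow> typing (snd J)"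
    and forms: "\<And>J. Q' (translate_judg expand J) = Q J" "\<And>J. Q (collapse_judg X J) = Q' J"
  shows "bij_betw F A B"
  unfolding bij_betw_def
proof
  show "inj_on F A"
  proof (rule inj_onI)
    fix c c'
    assume c: "c \<in> A" "c' \<in> A" "F c = F c'"
    obtain J J' where J: "J \<in> der P_rules (free_tts {S} X)" "Q J" "c = orbit J"
      and J': "J' \<in> der P_rules (free_tts {S} X)" "Q J'" "c' = orbit J'"
      using c(1,2) unfolding A by blast
    have "orbit (translate_judg expand J) = orbit (translate_judg expand J')" using c(3) F[OF J(1,2)] F[OF J'(1,2)] J(3) J'(3) by simp
    then show "c = c'"
      using translate_judg_expand_inj[OF assms(1) J(1) typing(1)[OF J(2)] J'(1) typing(1)[OF J'(2)]] J(3) J'(3) by simp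
  qed
  show "F ` A = B"
  proof
    show "F ` A \<subseteq> B"
    proof
      fix d
      assume "d \<in> F ` A"
      then obtain J where J: "J \<in> der P_rules (free_tts {S} X)" "Q J" "degree J = n" "d = F (orbit J)"
        unfolding image_iff Bex_def A by blast
      then show "d \<in> B"
        unfolding B using F[OF J(1,2)] forms(1) by (intro bexI[of _ "translate_judg expand J"]) simp_all
    qed
    show "B \<subseteq> F ` A"
    proof
      fix d
      assume "d \<in> B"
      then obtain J where J: "J \<in> der T_rules X" "Q' J" "degree J = n" "d = orbit J"
        unfolding B by blast
      have H: "collapse_judg X J \<in> der P_rules (free_tts {S} X)" "Q (collapse_judg X J)"
        using collapse_judg_derived[OF assms(1) _ J(1) typing(2)[OF J(2)]] J(2) forms(2) by simp_all
      have "F (orbit (collapse_judg X J)) = d"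
        using F[OF H] translate_judg_collapse_judg[OF assms(1) _ J(1) typing(2)[OF J(2)]] J(4) by simp
      moreover have "orbit (collapse_judg X J) \<in> A"
        unfolding A using H J(3) by (intro bexI[of _ "collapse_judg X J"]) simp_all
      ultimately show "d \<in> F ` A" by blast
    qed
  qed
qed

theorem proposition35:
  fixes X :: "('a, 'b) tts"
  assumes "is_tts X"
  shows "tts_invertible (monad_obj P_rules (monad_obj S_rules X)) (monad_obj T_rules X) (kappa X)"
proof -
  let ?Y = "free_tts {S} X"
  let ?PY = "free_tts P_rules ?Y" and ?Z = "free_tts T_rules X"
  have WP: "gat_rules P_rules" "gat_rules T_rules" by simp_all
  have Y: "is_tts ?Y" using free_tts_is_tts[OF assms, of "{S}"] by simp
  have PY: "is_tts ?PY" by (rule free_tts_is_tts[OF Y WP(1)])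
  have Z: "is_tts ?Z" by (rule free_tts_is_tts[OF assms WP(2)])
  have ty: "bij_betw (on_ty (kappa X) n) (ty ?PY n) (ty ?Z n)" for n
    by (rule bij_of_expand[OF assms free_tts_ty[OF Y WP(1)] free_tts_ty[OF assms WP(2)]])
       (use kappa_orbit[OF assms] in \<open>simp_all add: typing_iff\<close>)
  have tm: "bij_betw (on_tm (kappa X) n) (tm ?PY n) (tm ?Z n)" for n
    by (rule bij_of_expand[OF assms free_tts_tm[OF Y WP(1)] free_tts_tm[OF assms WP(2)]])
       (use kappa_orbit[OF assms] in \<open>simp_all add: typing_iff\<close>)
  have boundary: "orbit (hd (boundary (translate_judg expand J))) = on_ty (kappa X) n (orbit (hd (boundary J)))"
    if "J \<in> der P_rules ?Y" "typing (snd J)" "boundary J \<noteq> []" for J n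
  proof -
    have "hd (boundary (translate_judg expand J)) = translate_judg expand (hd (boundary J))"
      using that(3) by (simp add: boundary_translate_judg hd_map)
    then show ?thesis
      using kappa_orbit(1)[OF assms hd_boundary_props(1)[OF Y WP(1) that]]
        hd_boundary_props(2)[OF Y WP(1) that] by (simp add: typing_iff)
  qed
  have "is_tts_map ?PY ?Z (kappa X)"
    unfolding is_tts_map_def
  proof (intro conjI allI impI ballI PY Z)
    fix n :: nat
    assume n: "n \<ge> 1"
    show "on_ty (kappa X) n c \<in> ty ?Z n" if "c \<in> ty ?PY n" for c using bij_betwE[OF ty] that by blast
    show "on_tm (kappa X) n c \<in> tm ?Z n" if "c \<in> tm ?PY n" for c using bij_betwE[OF tm] that by blast
    show "ty_bd ?Z n (on_ty (kappa X) (Suc n) c) = on_ty (kappa X) n (ty_bd ?PY n c)"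
      if c: "c \<in> ty ?PY (Suc n)" for c
    proof -
      obtain J where J: "J \<in> der P_rules ?Y" "is_type J" "degree J = Suc n" "c = orbit J"
        using c unfolding free_tts_ty[OF Y WP(1)] by blast
      have pr: "typing (snd J)" using J(2) by (simp add: typing_iff)
      have "ty_bd ?Z n (on_ty (kappa X) (Suc n) c) = orbit (hd (boundary (translate_judg expand J)))"
        using free_tts_ty_bd[OF assms WP(2) kappa_orbit(3)[OF assms J(1) pr] _ _ n]
          kappa_orbit(1)[OF assms J(1) pr] J(2-4) by simp
      also have "\<dots> = on_ty (kappa X) n (ty_bd ?PY n c)"
        using boundary[OF J(1) pr boundary_nonempty(1)[OF J(2,3) n]]
          free_tts_ty_bd[OF Y WP(1) J(1-3) n] J(4) by simp
      finally show ?thesis .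
    qed
    show "tm_bd ?Z n (on_tm (kappa X) n c) = on_ty (kappa X) n (tm_bd ?PY n c)"
      if c: "c \<in> tm ?PY n" for c
    proof -
      obtain J where J: "J \<in> der P_rules ?Y" "is_term J" "c = orbit J"
        using c unfolding free_tts_tm[OF Y WP(1)] by blast
      have pr: "typing (snd J)" using J(2) by (simp add: typing_iff)
      have "tm_bd ?Z n (on_tm (kappa X) n c) = orbit (hd (boundary (translate_judg expand J)))"
        using free_tts_tm_bd[OF assms WP(2) kappa_orbit(3)[OF assms J(1) pr]]
          kappa_orbit(2)[OF assms J(1) pr] J(2,3) by simp
      also have "\<dots> = on_ty (kappa X) n (tm_bd ?PY n c)"
        using boundary[OF J(1) pr boundary_nonempty(2)[OF J(2)]]
          free_tts_tm_bd[OF Y WP(1) J(1,2)] J(3) by simp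
      finally show ?thesis .
    qed
  qed
  then have "tts_invertible ?PY ?Z (kappa X)" using ty tm by (rule tts_invertibleI)
  then show ?thesis by (simp add: monad_obj_def)
qed

end
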